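(* Assume $V$ is positive definite with smallest eigenvalue $\lambda$, that $i_n$, $n\ge0$, are i.i.d. uniformly distributed on $\{1,\dots,d\}$ (independent of $(g_n)$), and let $h$ be a $(\kappa,\gamma,V)$-Lipschitz function on $\mathbb R^d$ with $m=E(h(X))$ and $\Sigma^2=\mathrm{Var}(h(X))>0$, $X\sim N(0,V)$. Set $\kappa'=2\kappa d^{1+\gamma}/(\lambda\gamma)$ and $\delta=\lceil 4(\lambda\gamma)^{-1}d\ln(\kappa d/\Sigma)\rceil$. Then for $d\ge3$ and every even $n>0$, $$\Big|E\Big(\frac{\sum_{j=n/2}^{n-1}h(X_j)}{n/2}-m\Big)\Big|\le 2\kappa'\frac{e^{-\lambda\gamma n/(4d)}}{n}.$$ Furthermore, if in addition $n>2\delta$, then $$E\Big(\Big(\frac{\sum_{j=n/2}^{n-1}h(X_j)}{n/2}-m\Big)^2\Big)\le 34\,\frac{\delta\,\Sigma^2}{n}.$$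
   Context: Let $d\ge1$ and let $V$ be a real symmetric $d\times d$ matrix whose diagonal entries all equal $1$. Let $e_i$ be the $i$-th standard basis column vector of $\mathbb R^d$. Let $(i_n)_{n\ge0}$ be a sequence of indices in $\{1,\dots,d\}$ and $(g_n)_{n\ge0}$ i.i.d. standard Gaussian random variables independent of $(i_n)$. Define $X_0=0$ and $X_{n+1}=X_n+(g_n-e_{i_n}^TX_n)\,Ve_{i_n}$ for $n\ge0$. For a vector $x$, $\|x\|$ is its Euclidean norm; for a centered random vector $Z$, $\mathrm{cov}(Z)=E(ZZ^T)$; $A\le B$ means $B-A$ is positive semi-definite. Given $\kappa>0$, $\gamma\in(0,1]$ and a $d\times d$ positive semi-definite matrix $W$, a real-valued Borel function $h$ on $\mathbb R^d$ is $(\kappa,\gamma,W)$-Lipschitz if $E((h(X)-h(X'))^2)\le\kappa^2(E\|X-X'\|^2)^{\gamma}$ for every centered Gaussian vector $(X,X')$ in $\mathbb R^{2d}$ ($X,X'$ each $d$-dimensional) with $\mathrm{cov}(X)\le W$ and $\mathrm{cov}(X')\le W$. *)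

theory Defs
  imports "HOL-Analysis.Analysis" "HOL-Probability.Probability"
begin

primrec Xseq :: "real^'d^'d \<Rightarrow> (nat \<Rightarrow> 'd) \<Rightarrow> (nat \<Rightarrow> real) \<Rightarrow> nat \<Rightarrow> real^'d" where
  "Xseq V ii gg 0 = 0"
| "Xseq V ii gg (Suc n) =
     Xseq V ii gg n + (gg n - Xseq V ii gg n $ ii n) *\<^sub>R column (ii n) V"

definition std_gauss :: "('a::euclidean_space) measure" where
  "std_gauss = density lborel
     (\<lambda>x. ennreal ((2 * pi) powr (- real DIM('a) / 2) * exp (- (norm x)\<^sup>2 / 2)))"

definition gauss_meas :: "real^'d^'d \<Rightarrow> (real^'d) measure" where
  "gauss_meas V = density lborel
     (\<lambda>x. ennreal ((2 * pi) powr (- real CARD('d) / 2) / sqrt (det V)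
                    * exp (- (x \<bullet> (matrix_inv V *v x)) / 2)))"

definition cov_std :: "('z::euclidean_space \<Rightarrow> real^'d) \<Rightarrow> real^'d^'d" where
  "cov_std F = (\<chi> i j. \<integral> z. (F z) $ i * (F z) $ j \<partial>(std_gauss :: 'z measure))"

definition psd_le :: "real^'d^'d \<Rightarrow> real^'d^'d \<Rightarrow> bool" where
  "psd_le A B \<longleftrightarrow> (\<forall>v. v \<bullet> (A *v v) \<le> v \<bullet> (B *v v))"

definition pos_def :: "real^'d^'d \<Rightarrow> bool" where
  "pos_def A \<longleftrightarrow> (\<forall>v. v \<noteq> 0 \<longrightarrow> v \<bullet> (A *v v) > 0)"

definition is_eigenvalue :: "real^'d^'d \<Rightarrow> real \<Rightarrow> bool" where
  "is_eigenvalue A l \<longleftrightarrow> (\<exists>v. v \<noteq> 0 \<and> A *v v = l *\<^sub>R v)"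

text \<open>(kappa,gamma,W)-Lipschitz. A centered Gaussian vector (X,X') in R^{2d} is represented
  as (A Z, B Z) with Z standard Gaussian on R^d x R^d and A, B linear; every centered
  Gaussian vector in R^{2d} has this law.\<close>
definition gauss_lipschitz :: "real \<Rightarrow> real \<Rightarrow> real^'d^'d \<Rightarrow> (real^'d \<Rightarrow> real) \<Rightarrow> bool" where
  "gauss_lipschitz \<kappa> \<gamma> W h \<longleftrightarrow>
     h \<in> borel_measurable borel \<and>
     (\<forall>(A :: ((real^'d) \<times> (real^'d)) \<Rightarrow> real^'d) (B :: ((real^'d) \<times> (real^'d)) \<Rightarrow> real^'d).
        linear A \<and> linear B \<and> psd_le (cov_std A) W \<and> psd_le (cov_std B) W \<longrightarrow>
        (\<integral>\<^sup>+ z. ennreal ((h (A z) - h (B z))\<^sup>2) \<partial>std_gauss)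
          \<le> ennreal (\<kappa>\<^sup>2 * (\<integral> z. (norm (A z - B z))\<^sup>2 \<partial>std_gauss) powr \<gamma>))"

end

theory Submission
  imports Defs
begin

text \<open>
  Factor \<open>V = B B\<^sup>T\<close> and write \<open>x = B z\<close>. The chain becomes \<open>z \<mapsto> z + (g - v \<bullet> z) v\<close> with \<open>v\<close> a random
  row of \<open>B\<close>; the rows are unit vectors, so a step replaces one coordinate of \<open>z\<close> in a random
  direction by a fresh Gaussian. This preserves the standard Gaussian measure. Run the chain with the
  same innovations from \<open>0\<close> and from a standard Gaussian \<open>z\<close>. The difference of the two runs is
  projected orthogonally to \<open>v\<close> at every step, hence its mean square decays by the factor
  \<open>1 - \<lambda> / d\<close> per step. Given the indices the two runs are jointly Gaussian with covariances at most
  \<open>V\<close>, so the Lipschitz condition and the concavity of \<open>t powr \<gamma>\<close> bound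
  \<open>E (h (X\<^sub>j) - h (X'\<^sub>j))\<^sup>2\<close> by \<open>(\<kappa> d powr \<gamma> q ^ j)\<^sup>2\<close> with \<open>q = (1 - \<lambda> / d) powr (\<gamma> / 2)\<close>. Since the run from
  \<open>0\<close> is independent of \<open>z\<close>, the same bound controls the autocovariances of the stationary run. Summing
  geometric series gives the bias; in the second moment the autocovariances are bounded by \<open>\<Sigma>\<^sup>2\<close> up to
  lag \<open>\<delta>\<close> and by a geometric series beyond it.
\<close>

section \<open>Standard Gaussian measures\<close>

text \<open>The Lipschitz condition speaks only of linear images of a standard Gaussian on R^d x
  R^d, whereas after n steps the two runs depend on n further innovations. The runs are therefore
  never written as functions of all the noise. Once \<open>a z\<close> is projected off
  \<open>v\<close>, some direction of \<open>z\<close> is no longer seen, and the innovation common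
  to both runs is stored there. So a step maps a pair \<open>(a z, a z + c z')\<close> to a pair of
  the same shape in law, with a new \<open>a\<close> and a \<open>c\<close> that has been projected.
  The invariant |a^T y|^2 + |c^T y|^2 <= |y|^2 keeps the covariances of both runs at most the
  identity, hence at most \<open>V\<close> after \<open>B\<close> is applied. The factor
  \<open>d powr \<gamma>\<close> in the L2 bound has two equal sources: E|z|^2 = d and |B y|^2 <= d
  |y|^2 each give \<open>d powr (\<gamma> / 2)\<close>. The condition d >= 3 enters through e <= 3:
  it makes the logarithm in \<delta> at least 1/2, so that \<delta> also dominates the relaxation
  time 2 d / (\<lambda> \<gamma>).\<close>

lemma sets_std_gauss [simp, measurable_cong]: "sets (std_gauss :: 'a::euclidean_space measure) = sets borel"
  by (simp add: std_gauss_def)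

lemma space_std_gauss [simp]: "space (std_gauss :: 'a::euclidean_space measure) = UNIV"
  by (simp add: std_gauss_def)

definition std_gauss_density :: "'a::euclidean_space \<Rightarrow> real" where
  "std_gauss_density x = (2 * pi) powr (- real DIM('a) / 2) * exp (- (norm x)\<^sup>2 / 2)"

lemma std_gauss_density_nonneg [simp]: "0 \<le> std_gauss_density x"
  by (simp add: std_gauss_density_def)

lemma borel_measurable_std_gauss_density [measurable]: "std_gauss_density \<in> borel_measurable borel"
  unfolding std_gauss_density_def by measurable

lemma borel_measurable_std_gauss_density_pair [measurable]:
  "std_gauss_density \<in> borel_measurable (borel \<Otimes>\<^sub>M borel)"
  by (simp add: borel_prod)

lemma std_gauss_eq_density: "std_gauss = density lborel (\<lambda>x. ennreal (std_gauss_density x))"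
  by (simp add: std_gauss_def std_gauss_density_def)

lemma nn_integral_std_gauss:
  fixes F :: "'a::euclidean_space \<Rightarrow> ennreal"
  assumes [measurable]: "F \<in> borel_measurable borel"
  shows "(\<integral>\<^sup>+x. F x \<partial>std_gauss) = (\<integral>\<^sup>+x. ennreal (std_gauss_density x) * F x \<partial>lborel)"
  unfolding std_gauss_eq_density by (subst nn_integral_density) auto

lemma std_gauss_real: "(std_gauss :: real measure) = density lborel std_normal_density"
proof -
  have "std_gauss_density x = std_normal_density x" for x :: real
    by (simp add: std_gauss_density_def std_normal_density_def powr_minus powr_half_sqrt inverse_eq_divide)
  then show ?thesis by (simp add: std_gauss_eq_density)
qed

text \<open>The product form reduces the total mass to that of the one-dimensional normal
  density.\<close>

lemma std_gauss_density_Basis: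
  fixes x :: "'a::euclidean_space"
  shows "std_gauss_density x = (\<Prod>b\<in>Basis. std_normal_density (x \<bullet> b))"
proof -
  have "(norm x)\<^sup>2 = (\<Sum>b\<in>Basis. (x \<bullet> b)\<^sup>2)"
    by (simp add: norm_eq_sqrt_inner euclidean_inner[of x x] power2_eq_square sum_nonneg)
  then have "exp (- (norm x)\<^sup>2 / 2) = (\<Prod>b\<in>Basis. exp (- (x \<bullet> b)\<^sup>2 / 2))"
    by (simp add: exp_sum[symmetric] sum_negf sum_divide_distrib)
  moreover have "(2 * pi) powr (- real DIM('a) / 2) = (1 / sqrt (2 * pi)) ^ DIM('a)"
    by (simp add: powr_half_sqrt[symmetric] powr_minus_divide[symmetric] powr_realpow[symmetric] powr_powr
        del: powr_half_sqrt)
  ultimately show ?thesis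
    by (simp add: std_gauss_density_def std_normal_density_def prod.distrib prod_dividef power_one_over
        flip: power_inverse)
qed

lemma nn_integral_std_normal_density: "(\<integral>\<^sup>+x. ennreal (std_normal_density x) \<partial>lborel) = 1"
proof -
  interpret prob_space "density lborel std_normal_density"
    by (rule prob_space_normal_density) simp
  show ?thesis
    using emeasure_space_1 by (simp add: emeasure_density)
qed

lemma prob_space_std_gauss: "prob_space (std_gauss :: 'a::euclidean_space measure)"
proof
  have "emeasure (std_gauss :: 'a measure) (space std_gauss)
      = (\<integral>\<^sup>+x. (\<Prod>b\<in>Basis. ennreal (std_normal_density ((x::'a) \<bullet> b))) \<partial>lborel)"
    by (simp add: std_gauss_eq_density emeasure_density std_gauss_density_Basis prod_ennreal)
  also have "\<dots> = 1"
    by (subst nn_integral_lborel_prod) (auto simp: nn_integral_std_normal_density)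
  finally show "emeasure (std_gauss :: 'a measure) (space std_gauss) = 1" .
qed

interpretation std_gauss: prob_space "std_gauss :: 'a::euclidean_space measure"
  by (rule prob_space_std_gauss)

lemma emeasure_std_gauss_UNIV [simp]: "emeasure (std_gauss :: 'a::euclidean_space measure) UNIV = 1"
  using std_gauss.emeasure_space_1 by simp

lemma std_gauss_density_Pair:
  fixes x :: "'a::euclidean_space" and y :: "'b::euclidean_space"
  shows
  "std_gauss_density (x, y) = std_gauss_density x * std_gauss_density y"
proof -
  have "- (real DIM('a) + real DIM('b)) / 2 = - real DIM('a) / 2 + - real DIM('b) / 2"
    "- ((norm x)\<^sup>2 + (norm y)\<^sup>2) / 2 = - (norm x)\<^sup>2 / 2 + - (norm y)\<^sup>2 / 2"
    by (simp_all add: field_simps)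
  then show ?thesis
    by (simp only: std_gauss_density_def norm_Pair DIM_prod of_nat_add real_sqrt_pow2 sum_power2_ge_zero
        powr_add exp_add mult_ac)
qed

lemma nn_integral_std_gauss_pair:
  fixes F :: "'a::euclidean_space \<times> 'b::euclidean_space \<Rightarrow> ennreal"
  assumes [measurable]: "F \<in> borel_measurable borel"
  shows "(\<integral>\<^sup>+p. F p \<partial>std_gauss) = (\<integral>\<^sup>+x. \<integral>\<^sup>+y. F (x, y) \<partial>std_gauss \<partial>std_gauss)"
proof -
  have F [measurable]: "F \<in> borel_measurable (borel \<Otimes>\<^sub>M borel)"
    using assms by (simp add: borel_prod)
  have "(\<integral>\<^sup>+p. F p \<partial>std_gauss)
      = (\<integral>\<^sup>+p. ennreal (std_gauss_density p) * F p \<partial>(lborel \<Otimes>\<^sub>M lborel))"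
    by (simp add: nn_integral_std_gauss lborel_prod[symmetric])
  also have "\<dots> = (\<integral>\<^sup>+x. \<integral>\<^sup>+y. ennreal (std_gauss_density (x, y)) * F (x, y) \<partial>lborel \<partial>lborel)"
    by (subst lborel.nn_integral_fst[symmetric]) (auto simp: borel_prod)
  also have "\<dots> = (\<integral>\<^sup>+x. ennreal (std_gauss_density x) *
      (\<integral>\<^sup>+y. ennreal (std_gauss_density y) * F (x, y) \<partial>lborel) \<partial>lborel)"
    by (intro nn_integral_cong, subst nn_integral_cmult[symmetric])
       (auto simp: std_gauss_density_Pair ennreal_mult mult.assoc)
  also have "\<dots> = (\<integral>\<^sup>+x. \<integral>\<^sup>+y. F (x, y) \<partial>std_gauss \<partial>std_gauss)"
    by (simp add: nn_integral_std_gauss)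
  finally show ?thesis .
qed

section \<open>Shears of Lebesgue measure and refreshment of one Gaussian direction\<close>

lemma nn_integral_lborel_translate:
  fixes a :: "'a::euclidean_space"
  assumes [measurable]: "F \<in> borel_measurable borel"
  shows "(\<integral>\<^sup>+x. F (x + a) \<partial>lborel) = (\<integral>\<^sup>+x. F x \<partial>lborel)"
proof -
  have "(\<integral>\<^sup>+x. F x \<partial>lborel) = (\<integral>\<^sup>+x. F x \<partial>distr lborel borel ((+) a))"
    by (simp add: lborel_distr_plus)
  also have "\<dots> = (\<integral>\<^sup>+x. F (x + a) \<partial>lborel)"
    by (subst nn_integral_distr) (auto simp: add.commute)
  finally show ?thesis by simp
qed

lemma nn_integral_lborel_shear_fst:
  fixes F :: "'a::euclidean_space \<Rightarrow> real \<Rightarrow> ennreal"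
  assumes [measurable]: "case_prod F \<in> borel_measurable (borel \<Otimes>\<^sub>M borel)"
  shows "(\<integral>\<^sup>+z. \<integral>\<^sup>+t. F (z + t *\<^sub>R w) t \<partial>lborel \<partial>lborel) = (\<integral>\<^sup>+z. \<integral>\<^sup>+t. F z t \<partial>lborel \<partial>lborel)"
proof -
  have "(\<integral>\<^sup>+z. \<integral>\<^sup>+t. F (z + t *\<^sub>R w) t \<partial>lborel \<partial>lborel)
      = (\<integral>\<^sup>+t. \<integral>\<^sup>+z. F (z + t *\<^sub>R w) t \<partial>lborel \<partial>lborel)"
    by (rule lborel_pair.Fubini'[symmetric]) measurable
  also have "\<dots> = (\<integral>\<^sup>+t. \<integral>\<^sup>+z. F z t \<partial>lborel \<partial>lborel)"
    by (intro nn_integral_cong nn_integral_lborel_translate) measurable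
  also have "\<dots> = (\<integral>\<^sup>+z. \<integral>\<^sup>+t. F z t \<partial>lborel \<partial>lborel)"
    by (rule lborel_pair.Fubini') measurable
  finally show ?thesis .
qed

lemma nn_integral_lborel_shear_snd:
  fixes F :: "'a::euclidean_space \<Rightarrow> real \<Rightarrow> ennreal"
  assumes [measurable]: "case_prod F \<in> borel_measurable (borel \<Otimes>\<^sub>M borel)"
  shows "(\<integral>\<^sup>+z. \<integral>\<^sup>+t. F z (t - w \<bullet> z) \<partial>lborel \<partial>lborel) = (\<integral>\<^sup>+z. \<integral>\<^sup>+t. F z t \<partial>lborel \<partial>lborel)"
proof (rule nn_integral_cong)
  fix z
  show "(\<integral>\<^sup>+t. F z (t - w \<bullet> z) \<partial>lborel) = (\<integral>\<^sup>+t. F z t \<partial>lborel)"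
    using nn_integral_lborel_translate[of "F z" "- (w \<bullet> z)"] by simp
qed

text \<open>The map \<open>(z, t) \<mapsto> (z + (t - w \<bullet> z) w, - (w \<bullet> z))\<close> is a rotation; it is a composition of three
  shears, and these preserve Lebesgue measure by Fubini and translation invariance.\<close>

lemma nn_integral_std_gauss_refresh:
  fixes F :: "'a::euclidean_space \<Rightarrow> ennreal"
  assumes [measurable]: "F \<in> borel_measurable borel" and w: "norm w = 1"
  shows "(\<integral>\<^sup>+z. \<integral>\<^sup>+t. F (z + (t - w \<bullet> z) *\<^sub>R w) \<partial>std_gauss \<partial>std_gauss) = (\<integral>\<^sup>+z. F z \<partial>std_gauss)"
proof -
  have ww: "w \<bullet> w = 1"
    using w by (simp add: norm_eq_1)
  define H where "H = (\<lambda>(z::'a) (t::real). ennreal (std_gauss_density (z, t)) * F z)"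
  have H [measurable]: "case_prod H \<in> borel_measurable (borel \<Otimes>\<^sub>M borel)"
    unfolding H_def by measurable
  \<comment> \<open>The rotation preserves the norm on the product space, so the joint density takes
    the same value at the image point.\<close>
  have eq: "H (z + (t - w \<bullet> z) *\<^sub>R w) (- (w \<bullet> z)) =
      ennreal (std_gauss_density (z, t)) * F (z + (t - w \<bullet> z) *\<^sub>R w)" for z t
  proof -
    have "(norm (z + (t - w \<bullet> z) *\<^sub>R w))\<^sup>2 + (- (w \<bullet> z))\<^sup>2 = (norm z)\<^sup>2 + t\<^sup>2"
      unfolding power2_norm_eq_inner
      by (simp add: inner_add_left inner_add_right ww inner_commute power2_eq_square algebra_simps)
    then have "norm (z + (t - w \<bullet> z) *\<^sub>R w, - (w \<bullet> z)) = norm (z, t)"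
      by (simp add: norm_Pair)
    then show ?thesis
      by (simp only: H_def std_gauss_density_def)
  qed
  have "(\<integral>\<^sup>+z. \<integral>\<^sup>+t. F (z + (t - w \<bullet> z) *\<^sub>R w) \<partial>std_gauss \<partial>std_gauss)
      = (\<integral>\<^sup>+z. \<integral>\<^sup>+t. H (z + (t - w \<bullet> z) *\<^sub>R w) (- (w \<bullet> z)) \<partial>lborel \<partial>lborel)"
    unfolding eq std_gauss_density_Pair
    by (simp add: nn_integral_std_gauss nn_integral_cmult[symmetric] ennreal_mult mult.assoc)
  \<comment> \<open>As \<open>w\<close> is a unit vector,
    \<open>w \<bullet> (z + t *\<^sub>R w)\<close> equals \<open>w \<bullet> z + t\<close>. This
    spelling exposes the outer shear; each of the next three equalities removes one shear.\<close>
  also have "\<dots> = (\<integral>\<^sup>+z. \<integral>\<^sup>+t. H (z + t *\<^sub>R w + (t - w \<bullet> (z + t *\<^sub>R w)) *\<^sub>R w) (t - w \<bullet> (z + t *\<^sub>R w)) \<partial>lborel \<partial>lborel)"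
    by (simp add: inner_add_right ww algebra_simps)
  also have "\<dots> = (\<integral>\<^sup>+z. \<integral>\<^sup>+t. H (z + (t - w \<bullet> z) *\<^sub>R w) (t - w \<bullet> z) \<partial>lborel \<partial>lborel)"
    by (rule nn_integral_lborel_shear_fst[where F="\<lambda>z t. H (z + (t - w \<bullet> z) *\<^sub>R w) (t - w \<bullet> z)"]) measurable
  also have "\<dots> = (\<integral>\<^sup>+z. \<integral>\<^sup>+t. H (z + t *\<^sub>R w) t \<partial>lborel \<partial>lborel)"
    by (rule nn_integral_lborel_shear_snd[where F="\<lambda>z t. H (z + t *\<^sub>R w) t"]) measurable
  also have "\<dots> = (\<integral>\<^sup>+z. \<integral>\<^sup>+t. H z t \<partial>lborel \<partial>lborel)"
    by (rule nn_integral_lborel_shear_fst) measurable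
  also have "\<dots> = (\<integral>\<^sup>+z. \<integral>\<^sup>+t. F z \<partial>(std_gauss :: real measure) \<partial>std_gauss)"
    by (simp add: nn_integral_std_gauss H_def std_gauss_density_Pair ennreal_mult mult.assoc nn_integral_cmult
        del: nn_integral_const)
  also have "\<dots> = (\<integral>\<^sup>+z. F z \<partial>std_gauss)"
    by simp
  finally show ?thesis .
qed

section \<open>Second moments and covariances of linear images\<close>

lemma nn_integral_std_gauss_real_sq: "(\<integral>\<^sup>+t. ennreal (t\<^sup>2) \<partial>(std_gauss :: real measure)) = 1"
proof -
  have hb: "has_bochner_integral lborel (\<lambda>x. std_normal_density x * x ^ (2 * 1)) 1"
    using std_normal_moment_even[of 1] by (simp add: fact_numeral)
  have "(\<integral>\<^sup>+t. ennreal (t\<^sup>2) \<partial>(std_gauss :: real measure))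
      = (\<integral>\<^sup>+t. ennreal (std_normal_density t * t ^ (2 * 1)) \<partial>lborel)"
    unfolding std_gauss_real by (subst nn_integral_density) (auto simp: ennreal_mult)
  also have "\<dots> = ennreal (\<integral>t. std_normal_density t * t ^ (2 * 1) \<partial>lborel)"
    using hb by (intro nn_integral_eq_integral) (auto simp: has_bochner_integral_iff)
  also have "\<dots> = 1"
    using has_bochner_integral_integral_eq[OF hb] by simp
  finally show ?thesis .
qed

text \<open>Refreshing along the normalized vector \<open>w\<close> turns
  \<open>w \<bullet> z\<close> into \<open>t\<close>, so the invariance just proved leaves only the
  one-dimensional second moment.\<close>

lemma nn_integral_std_gauss_inner_sq:
  fixes y :: "'a::euclidean_space"
  shows "(\<integral>\<^sup>+z. ennreal ((y \<bullet> z)\<^sup>2) \<partial>std_gauss) = ennreal ((norm y)\<^sup>2)"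
proof (cases "y = 0")
  case False
  define w where "w = y /\<^sub>R norm y"
  have w: "norm w = 1" and y: "y = norm y *\<^sub>R w"
    using False by (simp_all add: w_def)
  have ww: "w \<bullet> w = 1"
    using w by (simp add: norm_eq_1)
  have "(\<integral>\<^sup>+z. ennreal ((w \<bullet> z)\<^sup>2) \<partial>std_gauss)
      = (\<integral>\<^sup>+z. \<integral>\<^sup>+t. ennreal ((w \<bullet> (z + (t - w \<bullet> z) *\<^sub>R w))\<^sup>2) \<partial>std_gauss \<partial>std_gauss)"
    by (rule nn_integral_std_gauss_refresh[symmetric]) (auto simp: w)
  also have "\<dots> = 1"
    by (simp add: inner_add_right ww nn_integral_std_gauss_real_sq emeasure_std_gauss_UNIV)
  finally have 1: "(\<integral>\<^sup>+z. ennreal ((w \<bullet> z)\<^sup>2) \<partial>std_gauss) = 1" .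
  have "(y \<bullet> z)\<^sup>2 = (norm y)\<^sup>2 * (w \<bullet> z)\<^sup>2" for z
    by (subst y) (simp add: power_mult_distrib w)
  then have "(\<integral>\<^sup>+z. ennreal ((y \<bullet> z)\<^sup>2) \<partial>std_gauss) = (\<integral>\<^sup>+z. ennreal ((norm y)\<^sup>2) * ennreal ((w \<bullet> z)\<^sup>2) \<partial>std_gauss)"
    by (simp add: ennreal_mult)
  also have "\<dots> = ennreal ((norm y)\<^sup>2)"
    by (subst nn_integral_cmult) (auto simp: 1)
  finally show ?thesis .
qed simp

lemma
  fixes y :: "'a::euclidean_space"
  shows integrable_std_gauss_inner_sq: "integrable std_gauss (\<lambda>z. (y \<bullet> z)\<^sup>2)"
    and integral_std_gauss_inner_sq: "(\<integral>z. (y \<bullet> z)\<^sup>2 \<partial>std_gauss) = (norm y)\<^sup>2"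
proof -
  show "integrable std_gauss (\<lambda>z. (y \<bullet> z)\<^sup>2)"
    by (rule integrableI_nonneg) (auto simp: nn_integral_std_gauss_inner_sq)
  show "(\<integral>z. (y \<bullet> z)\<^sup>2 \<partial>std_gauss) = (norm y)\<^sup>2"
    by (subst integral_eq_nn_integral) (auto simp: nn_integral_std_gauss_inner_sq)
qed

text \<open>Polarization of the preceding second moment.\<close>

lemma integral_std_gauss_inner_mult:
  fixes x y :: "'a::euclidean_space"
  shows "(\<integral>z. (x \<bullet> z) * (y \<bullet> z) \<partial>std_gauss) = x \<bullet> y"
proof -
  have eq: "(x \<bullet> z) * (y \<bullet> z) = (((x + y) \<bullet> z)\<^sup>2 - (x \<bullet> z)\<^sup>2 - (y \<bullet> z)\<^sup>2) / 2" for z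
    by (simp add: inner_add_left power2_eq_square algebra_simps)
  show ?thesis
    unfolding eq
    by (simp add: integrable_std_gauss_inner_sq integral_std_gauss_inner_sq del: inner_add_left inner_simps)
       (simp add: power2_norm_eq_inner inner_add_left inner_add_right inner_commute)
qed

lemma norm_linear_sq_adjoint:
  fixes c :: "'a::euclidean_space \<Rightarrow> 'b::euclidean_space"
  assumes "linear c"
  shows "(norm (c z))\<^sup>2 = (\<Sum>b\<in>Basis. (adjoint c b \<bullet> z)\<^sup>2)"
proof -
  have "(norm (c z))\<^sup>2 = (\<Sum>b\<in>Basis. (c z \<bullet> b)\<^sup>2)"
    by (simp add: norm_eq_sqrt_inner euclidean_inner[of "c z" "c z"] power2_eq_square sum_nonneg)
  also have "\<dots> = (\<Sum>b\<in>Basis. (adjoint c b \<bullet> z)\<^sup>2)"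
    by (simp add: adjoint_works[OF assms] inner_commute[of "adjoint c _"])
  finally show ?thesis .
qed

lemma
  fixes c :: "'a::euclidean_space \<Rightarrow> 'b::euclidean_space"
  assumes "linear c"
  shows integrable_std_gauss_norm_sq: "integrable std_gauss (\<lambda>z. (norm (c z))\<^sup>2)"
    and integral_std_gauss_norm_sq:
      "(\<integral>z. (norm (c z))\<^sup>2 \<partial>std_gauss) = (\<Sum>b\<in>Basis. (norm (adjoint c b))\<^sup>2)"
  by (simp_all add: norm_linear_sq_adjoint[OF assms] integrable_std_gauss_inner_sq integral_std_gauss_inner_sq)

lemma integral_std_gauss_norm_sq_id: "(\<integral>z. (norm z)\<^sup>2 \<partial>(std_gauss :: 'a::euclidean_space measure)) = DIM('a)"
proof -
  have "adjoint (\<lambda>z::'a. z) b = b" for b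
    by (simp add: adjoint_unique[of "\<lambda>z::'a. z" "\<lambda>z. z"])
  then show ?thesis
    using integral_std_gauss_norm_sq[of "\<lambda>z::'a. z"] by (simp add: linear_id[unfolded id_def])
qed

text \<open>The covariance of \<open>F z\<close> is F F^T. Conditions \<open>psd_le\<close> on
  covariances thereby become norm bounds on adjoints, the form in which the coupling invariant is
  kept.\<close>

lemma inner_cov_std:
  fixes F :: "'z::euclidean_space \<Rightarrow> real^'d"
  assumes F: "linear F"
  shows "v \<bullet> (cov_std F *v v) = (norm (adjoint F v))\<^sup>2"
proof -
  have 1: "F z $ i = adjoint F (axis i 1) \<bullet> z" for i z
    by (simp add: adjoint_clauses(2)[OF F] inner_axis')
  have 2: "cov_std F $ i $ j = adjoint F (axis i 1) \<bullet> adjoint F (axis j 1)" for i j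
    by (simp add: cov_std_def 1 integral_std_gauss_inner_mult)
  have 3: "adjoint F v = (\<Sum>i\<in>UNIV. (v $ i) *\<^sub>R adjoint F (axis i 1))"
    using linear_sum[OF adjoint_linear[OF F], of "\<lambda>i. v $ i *\<^sub>R axis i 1" UNIV]
    unfolding linear_scale[OF adjoint_linear[OF F]]
    by (simp only: basis_expansion[of v, unfolded scalar_mult_eq_scaleR])
  show ?thesis
    unfolding power2_norm_eq_inner 3 inner_vec_def matrix_vector_mult_def 2
    by (simp add: inner_sum_left inner_sum_right sum_distrib_left sum_distrib_right mult_ac inner_commute)
qed

lemma psd_le_cov_std_iff:
  fixes F :: "'z::euclidean_space \<Rightarrow> real^'d"
  assumes "linear F"
  shows "psd_le (cov_std F) W \<longleftrightarrow> (\<forall>v. (norm (adjoint F v))\<^sup>2 \<le> v \<bullet> (W *v v))"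
  by (simp add: psd_le_def inner_cov_std[OF assms])

section \<open>The randomized Gibbs chain\<close>

text \<open>For a unit vector \<open>v k\<close> the coordinate along \<open>v k\<close> becomes
  \<open>t\<close> and the orthogonal part stays: a Gibbs update in whitened coordinates.\<close>

definition refresh :: "('i \<Rightarrow> 'a::euclidean_space) \<Rightarrow> 'a \<Rightarrow> 'i \<Rightarrow> real \<Rightarrow> 'a" where
  "refresh v x k t = x + (t - v k \<bullet> x) *\<^sub>R v k"

primrec gibbs :: "('i \<Rightarrow> 'a::euclidean_space) \<Rightarrow> 'a \<Rightarrow> (nat \<Rightarrow> 'i) \<times> (nat \<Rightarrow> real) \<Rightarrow> nat \<Rightarrow> 'a" where
  "gibbs v x p 0 = x"
| "gibbs v x p (Suc n) = refresh v (gibbs v x p n) (fst p n) (snd p n)"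

text \<open>The recursion peels off the last step. The inductions over time need the first one,
  which changes the starting point and shifts the noise.\<close>

lemma gibbs_case_nat:
  "gibbs v x (case_nat k \<iota>, case_nat t \<gamma>) (Suc n) = gibbs v (refresh v x k t) (\<iota>, \<gamma>) n"
  by (induction n) auto

section \<open>The driving noise and its one-step decomposition\<close>

definition unif :: "'i::finite measure" where
  "unif = uniform_count_measure UNIV"

lemma sets_unif [simp, measurable_cong]: "sets (unif :: 'i::finite measure) = sets (count_space UNIV)"
  by (simp add: unif_def)

lemma space_unif [simp]: "space (unif :: 'i::finite measure) = UNIV"
  by (simp add: unif_def space_uniform_count_measure)

lemma prob_space_unif: "prob_space (unif :: 'i::finite measure)"
  unfolding unif_def by (rule prob_space_uniform_count_measure) auto

interpretation unif: prob_space "unif :: 'i::finite measure"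
  by (rule prob_space_unif)

lemma nn_integral_unif:
  fixes f :: "'i::finite \<Rightarrow> ennreal"
  shows "(\<integral>\<^sup>+k. f k \<partial>unif) = (\<Sum>k\<in>UNIV. ennreal (1 / CARD('i)) * f k)"
  unfolding unif_def uniform_count_measure_def by (rule nn_integral_point_measure_finite) simp

text \<open>Two independent sequences rather than one sequence of pairs: this matches the assumption
  that the whole families of indices and innovations are independent.\<close>

definition drive :: "((nat \<Rightarrow> 'i::finite) \<times> (nat \<Rightarrow> real)) measure" where
  "drive = (\<Pi>\<^sub>M n\<in>UNIV. unif) \<Otimes>\<^sub>M (\<Pi>\<^sub>M n\<in>UNIV. std_gauss)"

lemma sets_drive [measurable_cong]:
  "sets (drive :: ((nat \<Rightarrow> 'i::finite) \<times> (nat \<Rightarrow> real)) measure)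
     = sets ((\<Pi>\<^sub>M n\<in>UNIV. count_space UNIV) \<Otimes>\<^sub>M (\<Pi>\<^sub>M n\<in>UNIV. borel))"
  unfolding drive_def by (intro sets_pair_measure_cong sets_PiM_cong) auto

interpretation unif_seq: sequence_space "unif :: 'i::finite measure"
  by unfold_locales

interpretation gauss_seq: sequence_space "std_gauss :: real measure"
  by unfold_locales

interpretation drive_pair: pair_prob_space
  "\<Pi>\<^sub>M n\<in>(UNIV::nat set). (unif :: 'i::finite measure)" "\<Pi>\<^sub>M n\<in>(UNIV::nat set). (std_gauss :: real measure)"
  by unfold_locales

lemma prob_space_drive: "prob_space (drive :: ((nat \<Rightarrow> 'i::finite) \<times> (nat \<Rightarrow> real)) measure)"
  unfolding drive_def by (rule drive_pair.prob_space_axioms)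

interpretation drive: prob_space "drive :: ((nat \<Rightarrow> 'i::finite) \<times> (nat \<Rightarrow> real)) measure"
  by (rule prob_space_drive)

text \<open>An i.i.d. sequence is a first term followed by an independent copy of the sequence.
  Together with \<open>gibbs_case_nat\<close> this acts as the Markov property at time 1.\<close>

lemma nn_integral_drive_step:
  fixes f :: "(nat \<Rightarrow> 'i::finite) \<times> (nat \<Rightarrow> real) \<Rightarrow> ennreal"
  assumes [measurable]: "f \<in> borel_measurable drive"
  shows "(\<integral>\<^sup>+p. f p \<partial>drive) = (\<integral>\<^sup>+k. \<integral>\<^sup>+t. \<integral>\<^sup>+p. f (case_nat k (fst p), case_nat t (snd p)) \<partial>drive \<partial>std_gauss \<partial>unif)"
proof -
  let ?U = "\<Pi>\<^sub>M n\<in>(UNIV::nat set). (unif :: 'i measure)" and ?G = "\<Pi>\<^sub>M n\<in>(UNIV::nat set). (std_gauss :: real measure)"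
  have f [measurable]: "f \<in> borel_measurable (?U \<Otimes>\<^sub>M ?G)"
    using assms by (simp add: drive_def)
  have U: "(\<integral>\<^sup>+\<iota>. F \<iota> \<partial>?U) = (\<integral>\<^sup>+k. \<integral>\<^sup>+\<iota>. F (case_nat k \<iota>) \<partial>?U \<partial>unif)" if [measurable]: "F \<in> borel_measurable ?U" for F
    by (subst unif_seq.PiM_iter[symmetric], subst nn_integral_distr, measurable,
        subst unif_seq.P.nn_integral_fst[symmetric]) auto
  have G: "(\<integral>\<^sup>+\<iota>. F \<iota> \<partial>?G) = (\<integral>\<^sup>+k. \<integral>\<^sup>+\<iota>. F (case_nat k \<iota>) \<partial>?G \<partial>std_gauss)" if [measurable]: "F \<in> borel_measurable ?G" for F
    by (subst gauss_seq.PiM_iter[symmetric], subst nn_integral_distr, measurable,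
        subst gauss_seq.P.nn_integral_fst[symmetric]) auto
  interpret sg: pair_sigma_finite "std_gauss :: real measure" ?U
    by unfold_locales
  have "(\<integral>\<^sup>+p. f p \<partial>drive) = (\<integral>\<^sup>+\<iota>. \<integral>\<^sup>+\<gamma>. f (\<iota>, \<gamma>) \<partial>?G \<partial>?U)"
    unfolding drive_def by (rule gauss_seq.P.nn_integral_fst[symmetric]) measurable
  also have "\<dots> = (\<integral>\<^sup>+k. \<integral>\<^sup>+\<iota>. \<integral>\<^sup>+\<gamma>. f (case_nat k \<iota>, \<gamma>) \<partial>?G \<partial>?U \<partial>unif)"
    by (rule U) measurable
  also have "\<dots> = (\<integral>\<^sup>+k. \<integral>\<^sup>+\<iota>. \<integral>\<^sup>+t. \<integral>\<^sup>+\<gamma>. f (case_nat k \<iota>, case_nat t \<gamma>) \<partial>?G \<partial>std_gauss \<partial>?U \<partial>unif)"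
    by (intro nn_integral_cong G) measurable
  \<comment> \<open>The first innovation is moved past the tail of the index sequence, so that the
    two tails can be reassembled into \<open>drive\<close>.\<close>
  also have "\<dots> = (\<integral>\<^sup>+k. \<integral>\<^sup>+t. \<integral>\<^sup>+\<iota>. \<integral>\<^sup>+\<gamma>. f (case_nat k \<iota>, case_nat t \<gamma>) \<partial>?G \<partial>?U \<partial>std_gauss \<partial>unif)"
    by (intro nn_integral_cong sg.Fubini') measurable
  also have "\<dots> = (\<integral>\<^sup>+k. \<integral>\<^sup>+t. \<integral>\<^sup>+p. f (case_nat k (fst p), case_nat t (snd p)) \<partial>drive \<partial>std_gauss \<partial>unif)"
    unfolding drive_def
    by (intro nn_integral_cong, subst gauss_seq.P.nn_integral_fst[symmetric]) auto
  finally show ?thesis .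
qed

lemma borel_measurable_refresh [measurable (raw)]:
  fixes v :: "'i::finite \<Rightarrow> 'a::euclidean_space"
  assumes [measurable]: "X \<in> borel_measurable M" "k \<in> measurable M (count_space UNIV)" "t \<in> borel_measurable M"
  shows "(\<lambda>\<omega>. refresh v (X \<omega>) (k \<omega>) (t \<omega>)) \<in> borel_measurable M"
proof -
  have [measurable]: "(\<lambda>\<omega>. v (k \<omega>)) \<in> borel_measurable M"
    by (rule measurable_compose[OF assms(2)]) simp
  show ?thesis
    unfolding refresh_def by measurable
qed

lemma
  shows measurable_drive_fst: "(\<lambda>p. fst p n) \<in> measurable drive (count_space UNIV)"
    and measurable_drive_snd: "(\<lambda>p. snd p n) \<in> borel_measurable drive"
  by measurable

lemma borel_measurable_gibbs [measurable (raw)]: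
  fixes v :: "'i::finite \<Rightarrow> 'a::euclidean_space"
  assumes [measurable]: "X \<in> borel_measurable M" "p \<in> measurable M drive"
  shows "(\<lambda>\<omega>. gibbs v (X \<omega>) (p \<omega>) n) \<in> borel_measurable M"
proof (induction n)
  case (Suc n)
  note [measurable] = Suc
  have [measurable]: "(\<lambda>\<omega>. fst (p \<omega>) n) \<in> measurable M (count_space UNIV)" "(\<lambda>\<omega>. snd (p \<omega>) n) \<in> borel_measurable M"
    using measurable_compose[OF assms(2)] by (auto intro: measurable_drive_fst measurable_drive_snd)
  show ?case
    by simp
qed simp

section \<open>Coupling of chains and stationarity\<close>

text \<open>The kernel of \<open>z \<mapsto> a z - (v \<bullet> a z) v\<close> contains a unit vector \<open>w\<close>; the coordinate \<open>w \<bullet> z\<close> is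
  therefore unused and can serve as the fresh Gaussian.\<close>

lemma linear_refresh_absorb:
  fixes a :: "'a::euclidean_space \<Rightarrow> 'a"
  assumes a: "linear a" and v: "norm v = 1"
  shows "\<exists>a' :: 'a \<Rightarrow> 'a. linear a' \<and>
    (\<forall>y. (norm (adjoint a' y))\<^sup>2 = (norm (adjoint a (y - (v \<bullet> y) *\<^sub>R v)))\<^sup>2 + (v \<bullet> y)\<^sup>2) \<and>
    (\<forall>H\<in>borel_measurable borel.
      (\<integral>\<^sup>+z. \<integral>\<^sup>+t. H (a z + (t - v \<bullet> a z) *\<^sub>R v) \<partial>std_gauss \<partial>std_gauss) = (\<integral>\<^sup>+z. H (a' z) \<partial>std_gauss))"
proof -
  have vv: "v \<bullet> v = 1"
    using v by (simp add: norm_eq_1)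
  define b where "b = (\<lambda>z. a z - (v \<bullet> a z) *\<^sub>R v)"
  have lb: "linear b"
    unfolding b_def
    by (intro linearI) (simp_all add: linear_add[OF a] linear_scale[OF a] inner_add_right algebra_simps)
  have "v \<bullet> b z = 0" for z
    by (simp add: b_def inner_diff_right vv)
  \<comment> \<open>The range of \<open>b\<close> misses \<open>v\<close>, so \<open>b\<close> is
    not surjective and, in finite dimension, not injective; this supplies the direction
    \<open>w\<close>.\<close>
  then have "v \<notin> range b"
    using vv by (metis imageE zero_neq_one)
  then have "\<not> inj b"
    using linear_injective_imp_surjective[OF lb] by auto
  then obtain u where u: "u \<noteq> 0" "b u = 0"
    using linear_injective_0[OF lb] by auto
  define w where "w = u /\<^sub>R norm u"
  have w: "norm w = 1" "b w = 0"
    using u by (simp_all add: w_def linear_scale[OF lb])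
  have ww: "w \<bullet> w = 1"
    using w by (simp add: norm_eq_1)
  define a' where "a' = (\<lambda>z. b z + (w \<bullet> z) *\<^sub>R v)"
  have la': "linear a'"
    unfolding a'_def
    by (intro linearI) (simp_all add: linear_add[OF lb] linear_scale[OF lb] inner_add_right algebra_simps)
  have adj: "adjoint a' = (\<lambda>y. adjoint a (y - (v \<bullet> y) *\<^sub>R v) + (v \<bullet> y) *\<^sub>R w)"
  proof (rule adjoint_unique, intro allI)
    fix x y
    show "a' x \<bullet> y = x \<bullet> (adjoint a (y - (v \<bullet> y) *\<^sub>R v) + (v \<bullet> y) *\<^sub>R w)"
      by (simp add: a'_def b_def inner_add_right inner_add_left inner_diff_right inner_diff_left
          adjoint_works[OF a] inner_commute mult.commute)
  qed
  \<comment> \<open>The range of the adjoint of \<open>b\<close> is orthogonal to the kernel of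
    \<open>b\<close>. Hence the two summands of the adjoint of \<open>a'\<close> are orthogonal and
    the norm identity is Pythagoras.\<close>
  have orth: "adjoint a (y - (v \<bullet> y) *\<^sub>R v) \<bullet> w = 0" for y
  proof -
    have "w \<bullet> adjoint a (y - (v \<bullet> y) *\<^sub>R v) = b w \<bullet> y"
      by (simp add: adjoint_works[OF a] b_def inner_diff_right inner_diff_left inner_commute mult.commute)
    then show ?thesis
      by (simp add: w inner_commute)
  qed
  show ?thesis
  proof (intro exI[of _ a'] conjI allI ballI)
    show "linear a'" by (rule la')
  next
    fix y
    show "(norm (adjoint a' y))\<^sup>2 = (norm (adjoint a (y - (v \<bullet> y) *\<^sub>R v)))\<^sup>2 + (v \<bullet> y)\<^sup>2"
      unfolding adj power2_norm_eq_inner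
      using orth[of y] by (simp add: inner_add_left inner_add_right ww inner_commute power2_eq_square)
  next
    fix H :: "'a \<Rightarrow> ennreal"
    assume [measurable]: "H \<in> borel_measurable borel"
    have [measurable]: "a' \<in> borel_measurable borel"
      using la' by (intro borel_measurable_continuous_onI linear_continuous_on linear_linear[THEN iffD2])
    \<comment> \<open>As \<open>b w = 0\<close>, refreshing \<open>z\<close> along \<open>w\<close>
      leaves the \<open>b\<close> part alone and replaces the coefficient of \<open>v\<close> by
      \<open>t\<close>.\<close>
    have "a z + (t - v \<bullet> a z) *\<^sub>R v = a' (z + (t - w \<bullet> z) *\<^sub>R w)" for z t
      by (simp add: a'_def b_def[symmetric] linear_add[OF lb] linear_scale[OF lb] w inner_add_right ww)
         (simp add: b_def algebra_simps)
    then have "(\<integral>\<^sup>+z. \<integral>\<^sup>+t. H (a z + (t - v \<bullet> a z) *\<^sub>R v) \<partial>std_gauss \<partial>std_gauss)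
        = (\<integral>\<^sup>+z. \<integral>\<^sup>+t. H (a' (z + (t - w \<bullet> z) *\<^sub>R w)) \<partial>std_gauss \<partial>std_gauss)"
      by simp
    also have "\<dots> = (\<integral>\<^sup>+z. H (a' z) \<partial>std_gauss)"
      by (rule nn_integral_std_gauss_refresh) (auto simp: w)
    finally show "(\<integral>\<^sup>+z. \<integral>\<^sup>+t. H (a z + (t - v \<bullet> a z) *\<^sub>R v) \<partial>std_gauss \<partial>std_gauss)
        = (\<integral>\<^sup>+z. H (a' z) \<partial>std_gauss)" .
  qed
qed

text \<open>Jensen's inequality through the tangent at the mean \<open>s\<close>: Young's inequality
  gives \<open>x k powr g * s powr (1 - g) \<le> g * x k + (1 - g) * s\<close>, and summation
  followed by cancellation of \<open>s powr (1 - g)\<close> yields the claim. There is no such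
  tangent at 0, hence the separate case.\<close>

lemma mean_powr_le:
  fixes x :: "'i \<Rightarrow> real"
  assumes I: "finite I" "I \<noteq> {}" and x: "\<And>k. k \<in> I \<Longrightarrow> 0 \<le> x k" and g: "0 < g" "g \<le> 1"
  shows "(\<Sum>k\<in>I. x k powr g) / card I \<le> ((\<Sum>k\<in>I. x k) / card I) powr g"
proof -
  define s where "s = (\<Sum>k\<in>I. x k) / card I"
  have cpos: "real (card I) > 0"
    using I by (simp add: card_gt_0_iff)
  show ?thesis
  proof (cases "s = 0")
    case True
    then have "(\<Sum>k\<in>I. x k) = 0"
      using cpos by (simp add: s_def)
    then have "\<forall>k\<in>I. x k = 0"
      using sum_nonneg_eq_0_iff[of I x] I x by auto
    then show ?thesis by simp
  next
    case False
    moreover have "0 \<le> s"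
      unfolding s_def using x by (intro divide_nonneg_nonneg sum_nonneg) auto
    ultimately have s: "0 < s" by simp
    have young: "x k powr g * s powr (1 - g) \<le> g * x k + (1 - g) * s" if "k \<in> I" for k
    proof (cases "x k = 0")
      case True
      then show ?thesis using g s by simp
    next
      case False
      then show ?thesis
        using x[OF that] s g by (intro Youngs_inequality_0) auto
    qed
    have "(\<Sum>k\<in>I. x k powr g) * s powr (1 - g) \<le> (\<Sum>k\<in>I. g * x k + (1 - g) * s)"
      unfolding sum_distrib_right by (intro sum_mono young)
    also have "\<dots> = g * (\<Sum>k\<in>I. x k) + (1 - g) * (card I * s)"
      by (simp add: sum.distrib sum_distrib_left mult_ac)
    also have "(\<Sum>k\<in>I. x k) = card I * s"
      using cpos by (simp add: s_def)
    also have "g * (card I * s) + (1 - g) * (card I * s) = card I * (s powr g * s powr (1 - g))"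
      using s by (simp add: powr_add[symmetric] algebra_simps)
    finally have "(\<Sum>k\<in>I. x k powr g) * s powr (1 - g) \<le> (card I * s powr g) * s powr (1 - g)"
      by (simp add: mult_ac)
    then have "(\<Sum>k\<in>I. x k powr g) \<le> card I * s powr g"
      using s by simp
    then show ?thesis
      using cpos by (simp add: s_def divide_le_eq mult.commute)
  qed
qed

lemma borel_measurable_linear:
  fixes a :: "'a::euclidean_space \<Rightarrow> 'b::euclidean_space"
  assumes "linear a"
  shows "a \<in> borel_measurable borel"
  using assms by (intro borel_measurable_continuous_onI linear_continuous_on linear_linear[THEN iffD2])

text \<open>The induction runs over all \<open>a\<close> and \<open>c\<close>, because the first
  step changes both. The pair keeps its shape: the common innovation is absorbed into
  \<open>z\<close> by \<open>linear_refresh_absorb\<close>, and only the difference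
  \<open>c z'\<close> is projected. The last hypothesis bounds the covariance of
  \<open>a z + c z'\<close> by the identity, with \<open>z\<close> and \<open>z'\<close>
  independent; it has to survive each step so that \<open>lip\<close> applies at time 0.\<close>

lemma gibbs_coupling:
  fixes v :: "'i::finite \<Rightarrow> 'a::euclidean_space" and f :: "'a \<Rightarrow> real" and a c :: "'a \<Rightarrow> 'a"
  assumes f [measurable]: "f \<in> borel_measurable borel"
    and K: "0 \<le> K" and g: "0 < g" "g \<le> 1"
    and lip: "\<And>(a :: 'a \<Rightarrow> 'a) (c :: 'a \<Rightarrow> 'a). linear a \<Longrightarrow> linear c \<Longrightarrow> (\<And>y. (norm (adjoint a y))\<^sup>2 + (norm (adjoint c y))\<^sup>2 \<le> (norm y)\<^sup>2) \<Longrightarrow>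
      (\<integral>\<^sup>+z'. \<integral>\<^sup>+z. ennreal ((f (a z) - f (a z + c z'))\<^sup>2) \<partial>std_gauss \<partial>std_gauss)
        \<le> ennreal (K * (\<integral>z. (norm (c z))\<^sup>2 \<partial>std_gauss) powr g)"
    and v: "\<And>k. norm (v k) = 1"
    and lam: "\<And>y. l * (norm y)\<^sup>2 \<le> (\<Sum>k\<in>UNIV. (v k \<bullet> y)\<^sup>2)"
    and r: "r = 1 - l / CARD('i)" "0 \<le> r"
    and ac: "linear a" "linear c" "\<And>y. (norm (adjoint a y))\<^sup>2 + (norm (adjoint c y))\<^sup>2 \<le> (norm y)\<^sup>2"
  shows "(\<integral>\<^sup>+p. \<integral>\<^sup>+z'. \<integral>\<^sup>+z. ennreal ((f (gibbs v (a z) p n) - f (gibbs v (a z + c z') p n))\<^sup>2)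
           \<partial>std_gauss \<partial>std_gauss \<partial>drive)
       \<le> ennreal (K * (r ^ n * (\<integral>z. (norm (c z))\<^sup>2 \<partial>std_gauss)) powr g)"
  using ac
proof (induction n arbitrary: a c)
  case 0
  then show ?case
    using lip[OF 0(1,2)] 0(3) by (simp add: drive.emeasure_space_1)
next
  case (Suc n)
  note la = Suc.prems(1) and lc = Suc.prems(2) and bound = Suc.prems(3)
  note [measurable] = borel_measurable_linear[OF la] borel_measurable_linear[OF lc]
  have vv: "v k \<bullet> v k = 1" for k
    using v by (simp add: norm_eq_1)
  define D :: "'a \<Rightarrow> 'a \<Rightarrow> (nat \<Rightarrow> 'i) \<times> (nat \<Rightarrow> real) \<Rightarrow> nat \<Rightarrow> ennreal"
    where "D x y p n = ennreal ((f (gibbs v x p n) - f (gibbs v y p n))\<^sup>2)" for x y p n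
  have D [measurable (raw)]: "(\<lambda>\<omega>. D (X \<omega>) (Y \<omega>) (P \<omega>) n) \<in> borel_measurable M"
    if [measurable]: "X \<in> borel_measurable M" "Y \<in> borel_measurable M" "P \<in> measurable M drive" for X Y P n and M :: "'q measure"
    unfolding D_def by measurable
  \<comment> \<open>Both runs receive the same value along \<open>v k\<close>, so this component of
    their difference disappears.\<close>
  define c' where "c' k z = c z - (v k \<bullet> c z) *\<^sub>R v k" for k z
  have lc': "linear (c' k)" for k
    unfolding c'_def
    by (intro linearI) (simp_all add: linear_add[OF lc] linear_scale[OF lc] inner_add_right algebra_simps)
  note [measurable] = borel_measurable_linear[OF lc']
  have adjc': "adjoint (c' k) = (\<lambda>y. adjoint c (y - (v k \<bullet> y) *\<^sub>R v k))" for k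
    by (rule adjoint_unique) (simp add: c'_def adjoint_works[OF lc] inner_diff_left inner_diff_right inner_commute mult.commute)
  have step: "(\<integral>\<^sup>+p. \<integral>\<^sup>+z'. \<integral>\<^sup>+z. \<integral>\<^sup>+t. D (refresh v (a z) k t) (refresh v (a z + c z') k t) p n
           \<partial>std_gauss \<partial>std_gauss \<partial>std_gauss \<partial>drive)
       \<le> ennreal (K * (r ^ n * (\<integral>z. (norm (c' k z))\<^sup>2 \<partial>std_gauss)) powr g)" for k
  proof -
    obtain a' :: "'a \<Rightarrow> 'a" where a': "linear a'"
      "\<And>y. (norm (adjoint a' y))\<^sup>2 = (norm (adjoint a (y - (v k \<bullet> y) *\<^sub>R v k)))\<^sup>2 + (v k \<bullet> y)\<^sup>2"
      "\<forall>H\<in>borel_measurable borel.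
        (\<integral>\<^sup>+z. \<integral>\<^sup>+t. H (a z + (t - v k \<bullet> a z) *\<^sub>R v k) \<partial>std_gauss \<partial>std_gauss) = (\<integral>\<^sup>+z. H (a' z) \<partial>std_gauss)"
      using linear_refresh_absorb[OF la v[of k]] by auto
    have refr: "refresh v (a z + c z') k t = (a z + (t - v k \<bullet> a z) *\<^sub>R v k) + c' k z'" for z z' t
      by (simp add: refresh_def c'_def inner_add_right algebra_simps)
    have "(\<integral>\<^sup>+p. \<integral>\<^sup>+z'. \<integral>\<^sup>+z. \<integral>\<^sup>+t. D (refresh v (a z) k t) (refresh v (a z + c z') k t) p n
           \<partial>std_gauss \<partial>std_gauss \<partial>std_gauss \<partial>drive)
       = (\<integral>\<^sup>+p. \<integral>\<^sup>+z'. \<integral>\<^sup>+z. D (a' z) (a' z + c' k z') p n \<partial>std_gauss \<partial>std_gauss \<partial>drive)"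
      unfolding refr unfolding refresh_def
    proof (rule nn_integral_cong, rule nn_integral_cong)
      fix p :: "(nat \<Rightarrow> 'i) \<times> (nat \<Rightarrow> real)" and z'
      assume p [measurable]: "p \<in> space drive"
      show "(\<integral>\<^sup>+z. \<integral>\<^sup>+t. D (a z + (t - v k \<bullet> a z) *\<^sub>R v k) (a z + (t - v k \<bullet> a z) *\<^sub>R v k + c' k z') p n \<partial>std_gauss \<partial>std_gauss)
         = (\<integral>\<^sup>+z. D (a' z) (a' z + c' k z') p n \<partial>std_gauss)"
        by (rule bspec[OF a'(3), of "\<lambda>y. D y (y + c' k z') p n"]) measurable
    qed
    also have "\<dots> \<le> ennreal (K * (r ^ n * (\<integral>z. (norm (c' k z))\<^sup>2 \<partial>std_gauss)) powr g)"
      unfolding D_def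
    proof (rule Suc.IH[OF a'(1) lc'])
      fix y
      define y' where "y' = y - (v k \<bullet> y) *\<^sub>R v k"
      \<comment> \<open>Splitting \<open>y\<close> along \<open>v k\<close>: the old invariant is
        applied to the orthogonal part \<open>y'\<close>, and the extra
        \<open>(v k \<bullet> y)\<^sup>2\<close> from the absorbed innovation is exactly what the
        projection leaves free.\<close>
      have "(norm y')\<^sup>2 + (v k \<bullet> y)\<^sup>2 = (norm y)\<^sup>2"
        unfolding power2_norm_eq_inner y'_def
        by (simp add: inner_diff_left inner_diff_right vv inner_commute power2_eq_square)
      then show "(norm (adjoint a' y))\<^sup>2 + (norm (adjoint (c' k) y))\<^sup>2 \<le> (norm y)\<^sup>2"
        using bound[of y'] by (simp add: a'(2) adjc' y'_def)
    qed
    finally show ?thesis .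
  qed
  interpret sd: pair_sigma_finite "std_gauss :: real measure" "drive :: ((nat \<Rightarrow> 'i) \<times> (nat \<Rightarrow> real)) measure"
    by unfold_locales
  interpret ss: pair_sigma_finite "std_gauss :: real measure" "std_gauss :: 'a measure"
    by unfold_locales
  have "(\<integral>\<^sup>+p. \<integral>\<^sup>+z'. \<integral>\<^sup>+z. D (a z) (a z + c z') p (Suc n) \<partial>std_gauss \<partial>std_gauss \<partial>drive)
     = (\<integral>\<^sup>+k. \<integral>\<^sup>+t. \<integral>\<^sup>+p. \<integral>\<^sup>+z'. \<integral>\<^sup>+z. D (refresh v (a z) k t) (refresh v (a z + c z') k t) p n
           \<partial>std_gauss \<partial>std_gauss \<partial>drive \<partial>std_gauss \<partial>unif)"
    by (subst nn_integral_drive_step, measurable) (simp add: D_def gibbs_case_nat del: gibbs.simps)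
  \<comment> \<open>The integral over \<open>t\<close> must become innermost, because the absorption
    acts on \<open>z\<close> and \<open>t\<close> together while \<open>z'\<close> and the later
    noise are fixed.\<close>
  also have "\<dots> = (\<integral>\<^sup>+k. \<integral>\<^sup>+p. \<integral>\<^sup>+z'. \<integral>\<^sup>+z. \<integral>\<^sup>+t. D (refresh v (a z) k t) (refresh v (a z + c z') k t) p n
           \<partial>std_gauss \<partial>std_gauss \<partial>std_gauss \<partial>drive \<partial>unif)"
  proof (intro nn_integral_cong)
    fix k
    have "(\<integral>\<^sup>+t. \<integral>\<^sup>+p. \<integral>\<^sup>+z'. \<integral>\<^sup>+z. D (refresh v (a z) k t) (refresh v (a z + c z') k t) p n
           \<partial>std_gauss \<partial>std_gauss \<partial>drive \<partial>std_gauss)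
      = (\<integral>\<^sup>+p. \<integral>\<^sup>+t. \<integral>\<^sup>+z'. \<integral>\<^sup>+z. D (refresh v (a z) k t) (refresh v (a z + c z') k t) p n
           \<partial>std_gauss \<partial>std_gauss \<partial>std_gauss \<partial>drive)"
      by (rule sd.Fubini'[symmetric]) measurable
    also have "\<dots> = (\<integral>\<^sup>+p. \<integral>\<^sup>+z'. \<integral>\<^sup>+t. \<integral>\<^sup>+z. D (refresh v (a z) k t) (refresh v (a z + c z') k t) p n
           \<partial>std_gauss \<partial>std_gauss \<partial>std_gauss \<partial>drive)"
      by (rule nn_integral_cong, rule ss.Fubini'[symmetric]) measurable
    also have "\<dots> = (\<integral>\<^sup>+p. \<integral>\<^sup>+z'. \<integral>\<^sup>+z. \<integral>\<^sup>+t. D (refresh v (a z) k t) (refresh v (a z + c z') k t) p n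
           \<partial>std_gauss \<partial>std_gauss \<partial>std_gauss \<partial>drive)"
      by (rule nn_integral_cong, rule nn_integral_cong, rule ss.Fubini'[symmetric]) measurable
    finally show "(\<integral>\<^sup>+t. \<integral>\<^sup>+p. \<integral>\<^sup>+z'. \<integral>\<^sup>+z. D (refresh v (a z) k t) (refresh v (a z + c z') k t) p n
           \<partial>std_gauss \<partial>std_gauss \<partial>drive \<partial>std_gauss)
       = (\<integral>\<^sup>+p. \<integral>\<^sup>+z'. \<integral>\<^sup>+z. \<integral>\<^sup>+t. D (refresh v (a z) k t) (refresh v (a z + c z') k t) p n
           \<partial>std_gauss \<partial>std_gauss \<partial>std_gauss \<partial>drive)" .
  qed
  also have "\<dots> \<le> (\<integral>\<^sup>+k. ennreal (K * (r ^ n * (\<integral>z. (norm (c' k z))\<^sup>2 \<partial>std_gauss)) powr g) \<partial>unif)"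
    by (intro nn_integral_mono step)
  also have "\<dots> = ennreal (K * ((\<Sum>k\<in>UNIV. (r ^ n * (\<integral>z. (norm (c' k z))\<^sup>2 \<partial>std_gauss)) powr g) / CARD('i)))"
    using K by (simp add: nn_integral_unif ennreal_mult[symmetric] sum_ennreal sum_distrib_left
        sum_divide_distrib)
  also have "\<dots> \<le> ennreal (K * (r ^ Suc n * (\<integral>z. (norm (c z))\<^sup>2 \<partial>std_gauss)) powr g)"
  proof (intro ennreal_leI mult_left_mono K)
    \<comment> \<open>A step in direction \<open>v k\<close> removes
      \<open>(v k \<bullet> c z)\<^sup>2\<close> from the squared difference. Summed over
      \<open>k\<close>, \<open>lam\<close> bounds the loss below, which is the source of the factor
      \<open>r = 1 - l / CARD('i)\<close> in the mean.\<close>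
    have "(\<Sum>k\<in>UNIV. (norm (c' k z))\<^sup>2) \<le> (CARD('i) - l) * (norm (c z))\<^sup>2" for z
    proof -
      have "(norm (c' k z))\<^sup>2 = (norm (c z))\<^sup>2 - (v k \<bullet> c z)\<^sup>2" for k
        unfolding power2_norm_eq_inner c'_def
        by (simp add: inner_diff_left inner_diff_right vv inner_commute power2_eq_square)
      then have "(\<Sum>k\<in>UNIV. (norm (c' k z))\<^sup>2) = CARD('i) * (norm (c z))\<^sup>2 - (\<Sum>k\<in>UNIV. (v k \<bullet> c z)\<^sup>2)"
        by (simp only: sum_subtractf sum_constant)
      then show ?thesis
        using lam[of "c z"] by (simp add: algebra_simps)
    qed
    then have "(\<integral>z. (\<Sum>k\<in>UNIV. (norm (c' k z))\<^sup>2) \<partial>std_gauss) \<le> (\<integral>z. (CARD('i) - l) * (norm (c z))\<^sup>2 \<partial>std_gauss)"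
      by (intro integral_mono Bochner_Integration.integrable_sum integrable_mult_right
          integrable_std_gauss_norm_sq lc' lc)
    then have sum_le: "(\<Sum>k\<in>UNIV. (\<integral>z. (norm (c' k z))\<^sup>2 \<partial>std_gauss)) \<le> (CARD('i) - l) * (\<integral>z. (norm (c z))\<^sup>2 \<partial>std_gauss)"
      by (subst (asm) Bochner_Integration.integral_sum) (auto intro: integrable_std_gauss_norm_sq lc')
    \<comment> \<open>The Lipschitz bound has been applied for each index separately, so the average
      is over powers; concavity moves it inside the power, where the contraction is known.\<close>
    have "(\<Sum>k\<in>UNIV. (r ^ n * (\<integral>z. (norm (c' k z))\<^sup>2 \<partial>std_gauss)) powr g) / CARD('i)
        \<le> ((\<Sum>k\<in>UNIV. r ^ n * (\<integral>z. (norm (c' k z))\<^sup>2 \<partial>std_gauss)) / CARD('i)) powr g"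
      using r g by (intro mean_powr_le) auto
    also have "\<dots> \<le> (r ^ Suc n * (\<integral>z. (norm (c z))\<^sup>2 \<partial>std_gauss)) powr g"
    proof (rule powr_mono2)
      have "(\<Sum>k\<in>UNIV. r ^ n * (\<integral>z. (norm (c' k z))\<^sup>2 \<partial>std_gauss)) / CARD('i)
          = r ^ n * ((\<Sum>k\<in>UNIV. \<integral>z. (norm (c' k z))\<^sup>2 \<partial>std_gauss) / CARD('i))"
        by (simp add: sum_distrib_left)
      also have "\<dots> \<le> r ^ n * ((CARD('i) - l) * (\<integral>z. (norm (c z))\<^sup>2 \<partial>std_gauss) / CARD('i))"
        using r(2) sum_le by (intro mult_left_mono divide_right_mono) auto
      also have "\<dots> = r ^ Suc n * (\<integral>z. (norm (c z))\<^sup>2 \<partial>std_gauss)"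
        by (simp add: r(1) field_simps)
      finally show "(\<Sum>k\<in>UNIV. r ^ n * (\<integral>z. (norm (c' k z))\<^sup>2 \<partial>std_gauss)) / CARD('i)
        \<le> r ^ Suc n * (\<integral>z. (norm (c z))\<^sup>2 \<partial>std_gauss)" .
      show "0 \<le> (\<Sum>k\<in>UNIV. r ^ n * (\<integral>z. (norm (c' k z))\<^sup>2 \<partial>std_gauss)) / CARD('i)"
        using r(2) by (intro divide_nonneg_nonneg sum_nonneg) auto
    qed (use g in simp)
    finally show "(\<Sum>k\<in>UNIV. (r ^ n * (\<integral>z. (norm (c' k z))\<^sup>2 \<partial>std_gauss)) powr g) / CARD('i)
        \<le> (r ^ Suc n * (\<integral>z. (norm (c z))\<^sup>2 \<partial>std_gauss)) powr g" .
  qed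
  finally show ?case
    unfolding D_def .
qed

text \<open>The first refreshment leaves the standard Gaussian invariant, and induction removes
  \<open>j\<close> steps. The two-time form is needed because covariances must depend on the lag
  alone; an \<open>F\<close> depending only on its first argument gives the one-time law.\<close>

lemma gibbs_stationary:
  fixes v :: "'i::finite \<Rightarrow> 'a::euclidean_space" and F :: "'a \<Rightarrow> 'a \<Rightarrow> ennreal"
  assumes F [measurable]: "case_prod F \<in> borel_measurable (borel \<Otimes>\<^sub>M borel)"
    and v: "\<And>k. norm (v k) = 1"
  shows "(\<integral>\<^sup>+p. \<integral>\<^sup>+z. F (gibbs v z p j) (gibbs v z p (j + m)) \<partial>std_gauss \<partial>drive)
       = (\<integral>\<^sup>+p. \<integral>\<^sup>+z. F z (gibbs v z p m) \<partial>std_gauss \<partial>drive)"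
proof (induction j)
  case (Suc j)
  interpret sd: pair_sigma_finite "std_gauss :: real measure" "drive :: ((nat \<Rightarrow> 'i) \<times> (nat \<Rightarrow> real)) measure"
    by unfold_locales
  interpret ss: pair_sigma_finite "std_gauss :: real measure" "std_gauss :: 'a measure"
    by unfold_locales
  define D :: "'a \<Rightarrow> (nat \<Rightarrow> 'i) \<times> (nat \<Rightarrow> real) \<Rightarrow> ennreal"
    where "D x p = F (gibbs v x p j) (gibbs v x p (j + m))" for x p
  have D [measurable (raw)]: "(\<lambda>\<omega>. D (X \<omega>) (P \<omega>)) \<in> borel_measurable M"
    if [measurable]: "X \<in> borel_measurable M" "P \<in> measurable M drive" for X P and M :: "'q measure"
    unfolding D_def by measurable
  have "(\<integral>\<^sup>+p. \<integral>\<^sup>+z. F (gibbs v z p (Suc j)) (gibbs v z p (Suc (j + m))) \<partial>std_gauss \<partial>drive)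
     = (\<integral>\<^sup>+k. \<integral>\<^sup>+t. \<integral>\<^sup>+p. \<integral>\<^sup>+z. D (refresh v z k t) p \<partial>std_gauss \<partial>drive \<partial>std_gauss \<partial>unif)"
    by (subst nn_integral_drive_step, measurable) (simp add: D_def gibbs_case_nat del: gibbs.simps)
  also have "\<dots> = (\<integral>\<^sup>+(k::'i). \<integral>\<^sup>+p. \<integral>\<^sup>+z. D z p \<partial>std_gauss \<partial>drive \<partial>unif)"
  proof (rule nn_integral_cong)
    fix k :: 'i
    have "(\<integral>\<^sup>+t. \<integral>\<^sup>+p. \<integral>\<^sup>+z. D (refresh v z k t) p \<partial>std_gauss \<partial>drive \<partial>std_gauss)
       = (\<integral>\<^sup>+p. \<integral>\<^sup>+t. \<integral>\<^sup>+z. D (refresh v z k t) p \<partial>std_gauss \<partial>std_gauss \<partial>drive)"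
      by (rule sd.Fubini'[symmetric]) measurable
    also have "\<dots> = (\<integral>\<^sup>+p. \<integral>\<^sup>+z. \<integral>\<^sup>+t. D (refresh v z k t) p \<partial>std_gauss \<partial>std_gauss \<partial>drive)"
      by (rule nn_integral_cong, rule ss.Fubini'[symmetric]) measurable
    also have "\<dots> = (\<integral>\<^sup>+p. \<integral>\<^sup>+z. D z p \<partial>std_gauss \<partial>drive)"
      unfolding refresh_def
      by (rule nn_integral_cong, rule nn_integral_std_gauss_refresh) (auto simp: v)
    finally show "(\<integral>\<^sup>+t. \<integral>\<^sup>+p. \<integral>\<^sup>+z. D (refresh v z k t) p \<partial>std_gauss \<partial>drive \<partial>std_gauss)
      = (\<integral>\<^sup>+p. \<integral>\<^sup>+z. D z p \<partial>std_gauss \<partial>drive)" .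
  qed
  also have "\<dots> = (\<integral>\<^sup>+p. \<integral>\<^sup>+z. D z p \<partial>std_gauss \<partial>drive)"
    by (simp add: unif.emeasure_space_1[simplified])
  finally show ?case
    using Suc by (simp add: D_def)
qed simp

section \<open>Averages after a burn-in period\<close>

lemma integrable_mult_square:
  fixes f g :: "'a \<Rightarrow> real"
  assumes [measurable]: "f \<in> borel_measurable M" "g \<in> borel_measurable M"
    and f2: "integrable M (\<lambda>x. (f x)\<^sup>2)" and g2: "integrable M (\<lambda>x. (g x)\<^sup>2)"
  shows "integrable M (\<lambda>x. f x * g x)"
proof (rule Bochner_Integration.integrable_bound)
  show "integrable M (\<lambda>x. (f x)\<^sup>2 + (g x)\<^sup>2)"
    using f2 g2 by simp
  have "2 * \<bar>f x * g x\<bar> \<le> (f x)\<^sup>2 + (g x)\<^sup>2" for x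
    using sum_squares_bound[of "\<bar>f x\<bar>" "\<bar>g x\<bar>"] by (simp add: abs_mult)
  then have "\<bar>f x * g x\<bar> \<le> (f x)\<^sup>2 + (g x)\<^sup>2" for x
    by (smt (verit) abs_ge_zero)
  then show "AE x in M. norm (f x * g x) \<le> norm ((f x)\<^sup>2 + (g x)\<^sup>2)"
    by (simp add: abs_of_nonneg)
qed simp

text \<open>Cauchy-Schwarz with prescribed bounds: the arithmetic-geometric mean inequality with
  weights \<open>b / (2 * a)\<close> and \<open>a / (2 * b)\<close> integrates to exactly
  \<open>a * b\<close>. The weights are the reason for asking both bounds to be positive.\<close>

lemma integral_mult_le:
  fixes f g :: "'a \<Rightarrow> real"
  assumes [measurable]: "f \<in> borel_measurable M" "g \<in> borel_measurable M"
    and f2: "integrable M (\<lambda>x. (f x)\<^sup>2)" and g2: "integrable M (\<lambda>x. (g x)\<^sup>2)"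
    and a: "(\<integral>x. (f x)\<^sup>2 \<partial>M) \<le> a\<^sup>2" "0 < a" and b: "(\<integral>x. (g x)\<^sup>2 \<partial>M) \<le> b\<^sup>2" "0 < b"
  shows "\<bar>\<integral>x. f x * g x \<partial>M\<bar> \<le> a * b"
proof -
  have pt: "\<bar>f x * g x\<bar> \<le> (b / (2 * a)) * (f x)\<^sup>2 + (a / (2 * b)) * (g x)\<^sup>2" for x
  proof -
    have "2 * (b * \<bar>f x\<bar>) * (a * \<bar>g x\<bar>) \<le> (b * \<bar>f x\<bar>)\<^sup>2 + (a * \<bar>g x\<bar>)\<^sup>2"
      by (rule sum_squares_bound)
    then show ?thesis
      using a b by (simp add: abs_mult field_simps power2_eq_square)
  qed
  have "\<bar>\<integral>x. f x * g x \<partial>M\<bar> \<le> (\<integral>x. \<bar>f x * g x\<bar> \<partial>M)"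
    by (rule integral_abs_bound)
  also have "\<dots> \<le> (\<integral>x. (b / (2 * a)) * (f x)\<^sup>2 + (a / (2 * b)) * (g x)\<^sup>2 \<partial>M)"
    using f2 g2 by (intro integral_mono pt integrable_abs integrable_mult_square) auto
  also have "\<dots> = (b / (2 * a)) * (\<integral>x. (f x)\<^sup>2 \<partial>M) + (a / (2 * b)) * (\<integral>x. (g x)\<^sup>2 \<partial>M)"
    using f2 g2 by simp
  also have "\<dots> \<le> (b / (2 * a)) * a\<^sup>2 + (a / (2 * b)) * b\<^sup>2"
    using a b by (intro add_mono mult_left_mono) auto
  also have "\<dots> = a * b"
    using a b by (simp add: power2_eq_square)
  finally show ?thesis .
qed

lemma integral_sum_square_le:
  fixes u :: "nat \<Rightarrow> 'a \<Rightarrow> real"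
  assumes [measurable]: "\<And>j. u j \<in> borel_measurable M"
    and u2: "\<And>j. integrable M (\<lambda>x. (u j x)\<^sup>2)"
    and C: "\<And>j k. j \<in> J \<Longrightarrow> k \<in> J \<Longrightarrow> \<bar>\<integral>x. u j x * u k x \<partial>M\<bar> \<le> C j k"
  shows "integrable M (\<lambda>x. (\<Sum>j\<in>J. u j x)\<^sup>2)"
    and "(\<integral>x. (\<Sum>j\<in>J. u j x)\<^sup>2 \<partial>M) \<le> (\<Sum>j\<in>J. \<Sum>k\<in>J. C j k)"
proof -
  have eq: "(\<Sum>j\<in>J. u j x)\<^sup>2 = (\<Sum>j\<in>J. \<Sum>k\<in>J. u j x * u k x)" for x
    by (simp add: power2_eq_square sum_product)
  have int: "integrable M (\<lambda>x. u j x * u k x)" for j k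
    by (intro integrable_mult_square u2) auto
  show "integrable M (\<lambda>x. (\<Sum>j\<in>J. u j x)\<^sup>2)"
    unfolding eq by (intro Bochner_Integration.integrable_sum int)
  have "(\<integral>x. (\<Sum>j\<in>J. u j x)\<^sup>2 \<partial>M) = (\<Sum>j\<in>J. \<Sum>k\<in>J. \<integral>x. u j x * u k x \<partial>M)"
    unfolding eq by (simp add: int)
  also have "\<dots> \<le> (\<Sum>j\<in>J. \<Sum>k\<in>J. C j k)"
    using C by (intro sum_mono) (meson abs_le_iff)
  finally show "(\<integral>x. (\<Sum>j\<in>J. u j x)\<^sup>2 \<partial>M) \<le> (\<Sum>j\<in>J. \<Sum>k\<in>J. C j k)" .
qed

section \<open>Geometric sums over times and lags\<close>

lemma sum_power_le:
  fixes q x :: real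
  assumes "0 < q" "0 < x" "q \<le> 1 - x"
  shows "(\<Sum>l<L. q ^ l) \<le> 1 / x"
proof -
  have "(\<Sum>l<L. q ^ l) \<le> 1 / (1 - q)"
    using assms sum_le_suminf[of "\<lambda>l. q ^ l" "{..<L}"] by (simp add: suminf_geometric)
  also have "\<dots> \<le> 1 / x"
    using assms by (intro divide_left_mono mult_pos_pos) auto
  finally show ?thesis .
qed

lemma sum_power_tail_le:
  fixes q x :: real
  assumes "0 < q" "0 < x" "q \<le> 1 - x"
  shows "(\<Sum>j\<in>{N..<2 * N}. q ^ j) \<le> q ^ N / x"
proof -
  have "(\<Sum>j\<in>{N..<2 * N}. q ^ j) = (\<Sum>l<N. q ^ (l + N))"
    using sum.shift_bounds_nat_ivl[of "\<lambda>j. q ^ j" 0 N N] by (simp add: mult_2 lessThan_atLeast0)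
  also have "\<dots> = q ^ N * (\<Sum>l<N. q ^ l)"
    by (simp add: power_add sum_distrib_left mult.commute)
  also have "\<dots> \<le> q ^ N * (1 / x)"
    using assms by (intro mult_left_mono sum_power_le) auto
  finally show ?thesis by simp
qed

lemma sum_truncated_power_le:
  fixes q x :: real and \<delta> :: nat
  assumes "0 < q" "0 < x" "q \<le> 1 - x"
  shows "(\<Sum>l<L. if l < \<delta> then 1 else q ^ (l - \<delta>)) \<le> \<delta> + 1 / x"
proof -
  let ?c = "\<lambda>l. if l < \<delta> then 1 else q ^ (l - \<delta>)"
  have "(\<Sum>l<L. ?c l) \<le> (\<Sum>l<\<delta> + L. ?c l)"
    using assms by (intro sum_mono2) auto
  also have "{..<\<delta> + L} = {..<\<delta>} \<union> {\<delta>..<\<delta> + L}" by auto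
  also have "(\<Sum>l\<in>{..<\<delta>} \<union> {\<delta>..<\<delta> + L}. ?c l) = (\<Sum>l<\<delta>. ?c l) + (\<Sum>l\<in>{\<delta>..<\<delta> + L}. ?c l)"
    by (intro sum.union_disjoint) auto
  also have "(\<Sum>l<\<delta>. ?c l) = \<delta>"
    by simp
  also have "(\<Sum>l\<in>{\<delta>..<\<delta> + L}. ?c l) = (\<Sum>l<L. q ^ l)"
    using sum.shift_bounds_nat_ivl[of ?c 0 \<delta> L] by (simp add: lessThan_atLeast0 add.commute)
  also have "\<delta> + \<dots> \<le> \<delta> + 1 / x"
    using sum_power_le[OF assms] by simp
  finally show ?thesis .
qed

text \<open>Seen from a fixed time \<open>j\<close> in the window, each lag occurs at most once on
  either side.\<close>

lemma sum_dist_le: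
  fixes c :: "nat \<Rightarrow> real"
  assumes c: "\<And>l. 0 \<le> c l" and j: "j \<in> {N..<2 * N}"
  shows "(\<Sum>k\<in>{N..<2 * N}. c (if j \<le> k then k - j else j - k)) \<le> 2 * (\<Sum>l<N. c l)"
proof -
  have 1: "(\<Sum>k\<in>{j..<2 * N}. c (k - j)) \<le> (\<Sum>l<N. c l)"
  proof -
    have "(\<Sum>k\<in>{j..<2 * N}. c (k - j)) = sum c ((\<lambda>k. k - j) ` {j..<2 * N})"
      by (subst sum.reindex) (auto simp: inj_on_def)
    also have "\<dots> \<le> (\<Sum>l<N. c l)"
      using j c by (intro sum_mono2) auto
    finally show ?thesis .
  qed
  have 2: "(\<Sum>k\<in>{N..<j}. c (j - k)) \<le> (\<Sum>l<N. c l)"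
  proof -
    have "(\<Sum>k\<in>{N..<j}. c (j - k)) = sum c ((\<lambda>k. j - k) ` {N..<j})"
      by (subst sum.reindex) (auto simp: inj_on_def)
    also have "\<dots> \<le> (\<Sum>l<N. c l)"
      using j c by (intro sum_mono2) auto
    finally show ?thesis .
  qed
  have "{N..<2 * N} = {N..<j} \<union> {j..<2 * N}"
    using j by auto
  then have "(\<Sum>k\<in>{N..<2 * N}. c (if j \<le> k then k - j else j - k))
      = (\<Sum>k\<in>{N..<j}. c (if j \<le> k then k - j else j - k)) + (\<Sum>k\<in>{j..<2 * N}. c (if j \<le> k then k - j else j - k))"
    by (simp only:) (intro sum.union_disjoint, auto)
  also have "\<dots> = (\<Sum>k\<in>{N..<j}. c (j - k)) + (\<Sum>k\<in>{j..<2 * N}. c (k - j))"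
    by (intro arg_cong2[where f="(+)"] sum.cong) auto
  finally show ?thesis
    using 1 2 by simp
qed

section \<open>Burn-in estimates for a process approaching a centred one\<close>

context
  fixes M :: "'a measure" and \<phi> \<psi> :: "nat \<Rightarrow> 'a \<Rightarrow> real" and b q x S :: real
  assumes M: "prob_space M"
    and \<phi> [measurable]: "\<And>j. \<phi> j \<in> borel_measurable M" and \<psi> [measurable]: "\<And>j. \<psi> j \<in> borel_measurable M"
    and int\<psi>: "\<And>j. integrable M (\<lambda>\<omega>. (\<psi> j \<omega>)\<^sup>2)"
    and intd: "\<And>j. integrable M (\<lambda>\<omega>. (\<phi> j \<omega> - \<psi> j \<omega>)\<^sup>2)"
    and diff: "\<And>j. (\<integral>\<omega>. (\<phi> j \<omega> - \<psi> j \<omega>)\<^sup>2 \<partial>M) \<le> (b * q ^ j)\<^sup>2"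
    and mean: "\<And>j. (\<integral>\<omega>. \<psi> j \<omega> \<partial>M) = 0"
    and b: "0 < b" and q: "0 < q" "q \<le> 1 - x" and x: "0 < x"
begin

interpretation prob_space M by (rule M)

lemma burn_in_integrable_diff: "integrable M (\<lambda>\<omega>. \<phi> j \<omega> - \<psi> j \<omega>)"
  using integrable_mult_square[OF _ _ intd[of j], of "\<lambda>_. 1"] by simp

lemma burn_in_integrable_stationary: "integrable M (\<psi> j)"
  using integrable_mult_square[OF _ _ int\<psi>[of j], of "\<lambda>_. 1"] by simp

lemma burn_in_integrable: "integrable M (\<phi> j)"
  using Bochner_Integration.integrable_add[OF burn_in_integrable_diff burn_in_integrable_stationary, of j j] by simp

text \<open>As \<open>\<psi> j\<close> is centred, the mean of \<open>\<phi> j\<close> is the mean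
  of the difference, at most its L2 norm. The sum over the window is then a geometric tail.\<close>

lemma burn_in_bias:
  "\<bar>\<integral>\<omega>. (\<Sum>j\<in>{N..<2 * N}. \<phi> j \<omega>) / N \<partial>M\<bar> \<le> b * q ^ N / (x * N)"
proof -
  have 1: "\<bar>\<integral>\<omega>. \<phi> j \<omega> \<partial>M\<bar> \<le> b * q ^ j" for j
  proof -
    have "(\<integral>\<omega>. \<phi> j \<omega> \<partial>M) = (\<integral>\<omega>. (\<phi> j \<omega> - \<psi> j \<omega>) * 1 \<partial>M)"
      using mean[of j] by (simp add: burn_in_integrable burn_in_integrable_stationary)
    moreover have "\<bar>\<integral>\<omega>. (\<phi> j \<omega> - \<psi> j \<omega>) * 1 \<partial>M\<bar> \<le> (b * q ^ j) * 1"
      using intd[of j] diff[of j] b q by (intro integral_mult_le) (auto simp: prob_space)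
    ultimately show ?thesis by simp
  qed
  have "\<bar>\<integral>\<omega>. (\<Sum>j\<in>{N..<2 * N}. \<phi> j \<omega>) / N \<partial>M\<bar> = \<bar>\<Sum>j\<in>{N..<2 * N}. \<integral>\<omega>. \<phi> j \<omega> \<partial>M\<bar> / N"
    by (simp add: burn_in_integrable)
  also have "\<dots> \<le> (\<Sum>j\<in>{N..<2 * N}. b * q ^ j) / N"
    by (intro divide_right_mono order_trans[OF sum_abs] sum_mono 1) auto
  also have "\<dots> \<le> b * (q ^ N / x) / N"
    unfolding sum_distrib_left[symmetric]
    using b by (intro divide_right_mono mult_left_mono sum_power_tail_le q x) auto
  finally show ?thesis by simp
qed

text \<open>The constant is 10 = 2 * 4 + 2 * 1, from (u + w)^2 <= 2 u^2 + 2 w^2. The sum of the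
  \<open>\<psi> j\<close> contributes 4 N \<delta> S^2: N rows, two sides per row, and at most
  \<delta> + 1/x <= 2 \<delta> per side. The sum of the differences contributes at most (S
  \<delta>)^2 <= N \<delta> S^2. Division by N^2 finishes.\<close>

lemma burn_in_second_moment:
  fixes \<delta> N :: nat
  assumes S: "0 < S" and var: "\<And>j k. \<bar>\<integral>\<omega>. \<psi> j \<omega> * \<psi> k \<omega> \<partial>M\<bar> \<le> S\<^sup>2"
    and cov: "\<And>j k. j \<le> k \<Longrightarrow> \<bar>\<integral>\<omega>. \<psi> j \<omega> * \<psi> k \<omega> \<partial>M\<bar> \<le> S * (b * q ^ (k - j))"
    and \<delta>: "1 / x \<le> \<delta>" "b * q ^ \<delta> \<le> S" and N: "\<delta> \<le> N" "0 < N"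
  shows "integrable M (\<lambda>\<omega>. ((\<Sum>j\<in>{N..<2 * N}. \<phi> j \<omega>) / N)\<^sup>2)"
    and "(\<integral>\<omega>. ((\<Sum>j\<in>{N..<2 * N}. \<phi> j \<omega>) / N)\<^sup>2 \<partial>M) \<le> 10 * \<delta> * S\<^sup>2 / N"
proof -
  \<comment> \<open>Up to lag \<delta> the variance bound is used; beyond it
    \<open>b * q ^ \<delta> \<le> S\<close> absorbs the constant \<open>b\<close>, and decay
    restarts from \<open>S\<^sup>2\<close> at lag \<delta>.\<close>
  define c where "c l = (if l < \<delta> then 1 else q ^ (l - \<delta>))" for l
  have c0: "0 \<le> c l" for l
    using q by (simp add: c_def)
  let ?J = "{N..<2 * N}"
  let ?dist = "\<lambda>j k. if j \<le> k then k - j else j - k :: nat"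
  have cov_le: "\<bar>\<integral>\<omega>. \<psi> j \<omega> * \<psi> k \<omega> \<partial>M\<bar> \<le> S\<^sup>2 * c (k - j)" if "j \<le> k" for j k
  proof (cases "k - j < \<delta>")
    case True
    then show ?thesis using var[of j k] by (simp add: c_def)
  next
    case False
    have "k - j = \<delta> + (k - j - \<delta>)"
      using False by simp
    then have "b * q ^ (k - j) = b * q ^ \<delta> * q ^ (k - j - \<delta>)"
      by (metis power_add mult.assoc)
    also have "\<dots> \<le> S * q ^ (k - j - \<delta>)"
      using \<delta> q by (intro mult_right_mono) auto
    finally have "S * (b * q ^ (k - j)) \<le> S * (S * q ^ (k - j - \<delta>))"
      using S by (intro mult_left_mono) auto
    then show ?thesis
      using cov[OF that] False by (simp add: c_def power2_eq_square mult.assoc)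
  qed
  have cov_le': "\<bar>\<integral>\<omega>. \<psi> j \<omega> * \<psi> k \<omega> \<partial>M\<bar> \<le> S\<^sup>2 * c (?dist j k)" for j k
    using cov_le[of j k] cov_le[of k j] by (auto simp: mult.commute)
  note S1 = integral_sum_square_le[where J="?J" and u=\<psi>, OF \<psi> int\<psi> cov_le']
  have "(\<Sum>j\<in>?J. \<Sum>k\<in>?J. S\<^sup>2 * c (?dist j k)) = S\<^sup>2 * (\<Sum>j\<in>?J. \<Sum>k\<in>?J. c (?dist j k))"
    by (simp add: sum_distrib_left)
  also have "\<dots> \<le> S\<^sup>2 * (\<Sum>j\<in>?J. 2 * (2 * real \<delta>))"
  proof (intro mult_left_mono sum_mono)
    fix j assume j: "j \<in> ?J"
    have "(\<Sum>k\<in>?J. c (?dist j k)) \<le> 2 * (\<Sum>l<N. c l)"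
      by (rule sum_dist_le[OF c0 j])
    also have "(\<Sum>l<N. c l) \<le> real \<delta> + 1 / x"
      unfolding c_def by (rule sum_truncated_power_le[OF q(1) x q(2)])
    also have "\<dots> \<le> 2 * real \<delta>"
      using \<delta>(1) by simp
    finally show "(\<Sum>k\<in>?J. c (?dist j k)) \<le> 2 * (2 * real \<delta>)" by simp
  qed auto
  finally have I1: "(\<integral>\<omega>. (\<Sum>j\<in>?J. \<psi> j \<omega>)\<^sup>2 \<partial>M) \<le> 4 * real N * real \<delta> * S\<^sup>2"
    using S1(2) by (simp add: algebra_simps)
  have dm [measurable]: "(\<lambda>\<omega>. \<phi> j \<omega> - \<psi> j \<omega>) \<in> borel_measurable M" for j
    by measurable
  have "\<bar>\<integral>\<omega>. (\<phi> j \<omega> - \<psi> j \<omega>) * (\<phi> k \<omega> - \<psi> k \<omega>) \<partial>M\<bar> \<le> (b * q ^ j) * (b * q ^ k)" for j k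
    using b q by (intro integral_mult_le intd diff) auto
  note S2 = integral_sum_square_le[where J="?J" and u="\<lambda>j \<omega>. \<phi> j \<omega> - \<psi> j \<omega>", OF dm intd this]
  \<comment> \<open>The Cauchy-Schwarz bounds factorize in \<open>j\<close> and \<open>k\<close>, so
    the double sum is a square and no decay in the lag is required.\<close>
  have "(\<Sum>j\<in>?J. \<Sum>k\<in>?J. (b * q ^ j) * (b * q ^ k)) = (b * (\<Sum>j\<in>?J. q ^ j))\<^sup>2"
    by (simp add: power2_eq_square sum_product sum_distrib_left mult_ac)
  also have "\<dots> \<le> (S * \<delta>)\<^sup>2"
  proof (rule power_mono)
    have "b * (\<Sum>j\<in>?J. q ^ j) \<le> b * (q ^ N * (1 / x))"
      using b sum_power_tail_le[OF q(1) x q(2), of N] by (intro mult_left_mono) auto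
    \<comment> \<open>Here \<delta> serves twice: \<delta> <= N bounds \<open>q ^ N\<close> by
      \<open>q ^ \<delta>\<close>, and \<open>1 / x\<close> is replaced by \<delta>.\<close>
    also have "\<dots> \<le> b * (q ^ \<delta> * \<delta>)"
      using b q \<delta> N x by (intro mult_left_mono mult_mono power_decreasing) auto
    also have "\<dots> \<le> S * \<delta>"
      using \<delta> by (simp add: mult.assoc[symmetric] mult_right_mono)
    finally show "b * (\<Sum>j\<in>?J. q ^ j) \<le> S * \<delta>" .
    show "0 \<le> b * (\<Sum>j\<in>?J. q ^ j)"
      using b q by (intro mult_nonneg_nonneg sum_nonneg) auto
  qed
  finally have "(\<integral>\<omega>. (\<Sum>j\<in>?J. \<phi> j \<omega> - \<psi> j \<omega>)\<^sup>2 \<partial>M) \<le> (S * \<delta>)\<^sup>2"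
    using S2(2) by linarith
  also have "(S * \<delta>)\<^sup>2 \<le> real N * real \<delta> * S\<^sup>2"
    using N(1) S mult_right_mono[of "real \<delta>" "real N" "real \<delta> * S\<^sup>2"]
    by (simp add: power_mult_distrib power2_eq_square mult_ac)
  finally have I2: "(\<integral>\<omega>. (\<Sum>j\<in>?J. \<phi> j \<omega> - \<psi> j \<omega>)\<^sup>2 \<partial>M) \<le> real N * real \<delta> * S\<^sup>2" .
  have pt: "(\<Sum>j\<in>?J. \<phi> j \<omega>)\<^sup>2 \<le> 2 * (\<Sum>j\<in>?J. \<psi> j \<omega>)\<^sup>2 + 2 * (\<Sum>j\<in>?J. \<phi> j \<omega> - \<psi> j \<omega>)\<^sup>2" for \<omega>
    using sum_squares_bound[of "\<Sum>j\<in>?J. \<psi> j \<omega>" "\<Sum>j\<in>?J. \<phi> j \<omega> - \<psi> j \<omega>"]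
    unfolding sum_subtractf by (simp add: power2_eq_square algebra_simps)
  have intsum: "integrable M (\<lambda>\<omega>. 2 * (\<Sum>j\<in>?J. \<psi> j \<omega>)\<^sup>2 + 2 * (\<Sum>j\<in>?J. \<phi> j \<omega> - \<psi> j \<omega>)\<^sup>2)"
    using S1(1) S2(1) by simp
  have int\<phi>: "integrable M (\<lambda>\<omega>. (\<Sum>j\<in>?J. \<phi> j \<omega>)\<^sup>2)"
    by (rule Bochner_Integration.integrable_bound[OF intsum]) (use pt in \<open>auto intro!: AE_I2 order_trans[OF pt]\<close>)
  then show "integrable M (\<lambda>\<omega>. ((\<Sum>j\<in>?J. \<phi> j \<omega>) / N)\<^sup>2)"
    by (simp add: power_divide)
  have "(\<integral>\<omega>. (\<Sum>j\<in>?J. \<phi> j \<omega>)\<^sup>2 \<partial>M) \<le> (\<integral>\<omega>. 2 * (\<Sum>j\<in>?J. \<psi> j \<omega>)\<^sup>2 + 2 * (\<Sum>j\<in>?J. \<phi> j \<omega> - \<psi> j \<omega>)\<^sup>2 \<partial>M)"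
    by (intro integral_mono int\<phi> intsum pt)
  also have "\<dots> \<le> 10 * real N * real \<delta> * S\<^sup>2"
    using S1(1) S2(1) I1 I2 by simp
  finally show "(\<integral>\<omega>. ((\<Sum>j\<in>?J. \<phi> j \<omega>) / N)\<^sup>2 \<partial>M) \<le> 10 * \<delta> * S\<^sup>2 / N"
    using N by (simp add: power_divide divide_simps power2_eq_square mult_ac)
qed

end

section \<open>Covariance matrices\<close>

lemma symmetric_matrix_inner:
  fixes V :: "real^'d^'d"
  assumes "transpose V = V"
  shows "x \<bullet> (V *v y) = (V *v x) \<bullet> y"
  using assms by (metis dot_lmul_matrix transpose_matrix_vector)

text \<open>A minimiser \<open>u\<close> of the quadratic form on the unit sphere is an eigenvector: with \<open>\<mu>\<close> the
  minimum, the form \<open>V - \<mu>\<close> is nonnegative and vanishes at \<open>u\<close>.\<close>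

lemma least_eigenvalue_le_quadratic_form:
  fixes V :: "real^'d^'d"
  assumes sym: "transpose V = V" and lam: "\<And>l. is_eigenvalue V l \<Longrightarrow> lam \<le> l"
  shows "lam * (norm x)\<^sup>2 \<le> x \<bullet> (V *v x)"
proof -
  define Q where "Q x = x \<bullet> (V *v x)" for x
  have "\<exists>u\<in>sphere 0 1. \<forall>x\<in>sphere 0 1. Q u \<le> Q x"
  proof (rule continuous_attains_inf)
    show "sphere (0::real^'d) 1 \<noteq> {}"
      using vector_choose_size[of 1] by (auto simp: dist_norm)
    show "continuous_on (sphere 0 1) Q"
      unfolding Q_def by (intro continuous_intros matrix_vector_mult_linear_continuous_on)
  qed simp
  then obtain u where u: "norm u = 1" and min: "\<And>x. norm x = 1 \<Longrightarrow> Q u \<le> Q x"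
    by auto
  define \<mu> where "\<mu> = Q u"
  have low: "\<mu> * (norm x)\<^sup>2 \<le> Q x" for x
  proof (cases "x = 0")
    case False
    have "Q (x /\<^sub>R norm x) = Q x / (norm x)\<^sup>2"
      by (simp add: Q_def matrix_vector_mult_scaleR power2_eq_square field_simps)
    then show ?thesis
      using min[of "x /\<^sub>R norm x"] False by (simp add: \<mu>_def pos_le_divide_eq)
  qed (simp add: Q_def)
  \<comment> \<open>The residual of the eigenvector equation. It is orthogonal to \<open>u\<close>,
    and if it were nonzero, moving from \<open>u\<close> against it would lower the form
    \<open>V - \<mu>\<close> below 0.\<close>
  define w where "w = V *v u - \<mu> *\<^sub>R u"
  have "w = 0"
  proof (rule ccontr)
    assume "w \<noteq> 0"
    then have s: "0 < w \<bullet> w" by simp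
    define C where "C = Q w - \<mu> * (w \<bullet> w)"
    have C: "0 \<le> C"
      using low[of w] by (simp add: C_def power2_norm_eq_inner)
    have uw: "V *v u = w + \<mu> *\<^sub>R u"
      by (simp add: w_def)
    have uu: "u \<bullet> u = 1"
      using u by (simp add: norm_eq_1)
    have Vu: "u \<bullet> w = 0"
      using uu by (simp add: w_def inner_diff_right \<mu>_def Q_def)
    have expand: "Q (u - t *\<^sub>R w) - \<mu> * (norm (u - t *\<^sub>R w))\<^sup>2 = - 2 * t * (w \<bullet> w) + t\<^sup>2 * C" for t
    proof -
      have "u \<bullet> (V *v w) = w \<bullet> w"
        using symmetric_matrix_inner[OF sym, of u w] Vu by (simp add: uw inner_add_left)
      moreover have "w \<bullet> (V *v u) = w \<bullet> w"
        using Vu by (simp add: uw inner_add_right inner_commute)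
      moreover have "u \<bullet> (V *v u) = \<mu>"
        by (simp add: \<mu>_def Q_def)
      ultimately show ?thesis
        using Vu unfolding Q_def C_def power2_norm_eq_inner
        by (simp add: matrix_vector_mult_diff_distrib matrix_vector_mult_scaleR inner_diff_left inner_diff_right
            inner_commute uu power2_eq_square algebra_simps)
    qed
    \<comment> \<open>The step is short enough for the linear gain to beat the quadratic cost:
      \<open>t * C \<le> w \<bullet> w < 2 * (w \<bullet> w)\<close>. Using \<open>C + 1\<close>
      avoids division by zero when \<open>C = 0\<close>.\<close>
    define t where "t = (w \<bullet> w) / (C + 1)"
    have t: "0 < t"
      using s C by (simp add: t_def)
    have "0 \<le> t * (- 2 * (w \<bullet> w) + t * C)"
      using low[of "u - t *\<^sub>R w"] expand[of t] by (simp add: power2_eq_square algebra_simps)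
    then have "2 * (w \<bullet> w) \<le> t * C"
      using t by (simp add: zero_le_mult_iff)
    also have "t * C \<le> w \<bullet> w"
      using s C by (simp add: t_def divide_le_eq mult_left_mono)
    finally show False
      using s by simp
  qed
  then have "is_eigenvalue V \<mu>"
    using u unfolding is_eigenvalue_def w_def by (intro exI[of _ u]) auto
  then have "lam * (norm x)\<^sup>2 \<le> \<mu> * (norm x)\<^sup>2"
    using lam by (intro mult_right_mono) auto
  then show ?thesis
    using low[of x] by (simp add: Q_def)
qed

text \<open>Gram-Schmidt for the inner product \<open>x \<bullet> (V *v y)\<close>. If the columns
  of W are an orthonormal basis for it, then W^T V W = 1, so V W has inverse W^T, and (V W)(V W)^T =
  (V W) W^T V^T = V. Thus B = V W and B' = W^T.\<close>

lemma pos_def_factorization: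
  fixes V :: "real^'d^'d"
  assumes sym: "transpose V = V" and pd: "pos_def V"
  obtains B B' :: "real^'d^'d" where "B ** transpose B = V" "B ** B' = mat 1" "B' ** B = mat 1"
proof -
  define orth where "orth S \<longleftrightarrow> (\<forall>x\<in>S. \<forall>y\<in>S. x \<bullet> (V *v y) = (if x = y then 1 else 0))" for S
  have indep: "independent S" if S: "finite S" "orth S" for S
  proof (rule independent_if_scalars_zero[OF S(1)])
    fix f x assume 0: "(\<Sum>y\<in>S. f y *\<^sub>R y) = 0" and x: "x \<in> S"
    have "0 = (\<Sum>y\<in>S. f y *\<^sub>R y) \<bullet> (V *v x)"
      by (simp add: 0)
    also have "\<dots> = (\<Sum>y\<in>S. if y = x then f y else 0)"
      unfolding inner_sum_left using S(2) x by (intro sum.cong) (auto simp: orth_def)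
    finally show "f x = 0"
      using S(1) x by simp
  qed
  have "\<exists>S. finite S \<and> orth S \<and> card S = k" if "k \<le> CARD('d)" for k
    using that
  proof (induction k)
    case 0
    show ?case by (intro exI[of _ "{}"]) (simp add: orth_def)
  next
    case (Suc k)
    then obtain S where S: "finite S" "orth S" "card S = k" by auto
    \<comment> \<open>Orthonormal sets are independent, so fewer than d vectors leave a direction
      outside their span to continue with.\<close>
    have "dim S = k"
      using S indep dim_eq_card_independent by metis
    then have "span S \<noteq> UNIV"
      using Suc.prems by (metis dim_UNIV dim_span DIM_cart DIM_real mult.right_neutral not_less_eq_eq order_refl)
    then obtain y where y: "y \<notin> span S" by auto
    define z where "z = y - (\<Sum>x\<in>S. (x \<bullet> (V *v y)) *\<^sub>R x)"
    have zS: "z \<notin> span S"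
      using y span_diff[of y S z] span_add[of z S "\<Sum>x\<in>S. (x \<bullet> (V *v y)) *\<^sub>R x"]
      by (auto simp: z_def span_sum span_scale span_base)
    then have z0: "z \<noteq> 0"
      using span_zero by metis
    have xz: "x \<bullet> (V *v z) = 0" if x: "x \<in> S" for x
    proof -
      have "x \<bullet> (V *v z) = x \<bullet> (V *v y) - (\<Sum>x'\<in>S. (x' \<bullet> (V *v y)) * (x \<bullet> (V *v x')))"
        unfolding z_def
        by (simp add: matrix_vector_mult_diff_distrib inner_diff_right inner_sum_right
            linear_sum[OF matrix_vector_mul_linear] matrix_vector_mult_scaleR)
      also have "(\<Sum>x'\<in>S. (x' \<bullet> (V *v y)) * (x \<bullet> (V *v x'))) = (\<Sum>x'\<in>S. if x' = x then x' \<bullet> (V *v y) else 0)"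
        using S(2) x by (intro sum.cong) (auto simp: orth_def)
      also have "\<dots> = x \<bullet> (V *v y)"
        using S(1) x by simp
      finally show ?thesis by simp
    qed
    have zV: "0 < z \<bullet> (V *v z)"
      using pd z0 by (simp add: pos_def_def)
    define z' where "z' = z /\<^sub>R sqrt (z \<bullet> (V *v z))"
    have z'S: "z' \<notin> S"
    proof
      assume "z' \<in> S"
      then have "sqrt (z \<bullet> (V *v z)) *\<^sub>R z' \<in> span S"
        by (intro span_scale span_base)
      then show False
        using zS zV by (simp add: z'_def)
    qed
    have "orth (insert z' S)"
      unfolding orth_def
    proof (intro ballI)
      fix p q assume pq: "p \<in> insert z' S" "q \<in> insert z' S"
      have z'z': "z' \<bullet> (V *v z') = 1"
        using zV by (simp add: z'_def matrix_vector_mult_scaleR field_simps)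
      have xz': "x \<bullet> (V *v z') = 0" "z' \<bullet> (V *v x) = 0" if "x \<in> S" for x
        using xz[OF that] symmetric_matrix_inner[OF sym, of z x]
        by (simp_all add: z'_def matrix_vector_mult_scaleR inner_commute)
      show "p \<bullet> (V *v q) = (if p = q then 1 else 0)"
        using pq S(2) z'z' xz' z'S by (auto simp: orth_def)
    qed
    then show ?case
      using S z'S by (intro exI[of _ "insert z' S"]) auto
  qed
  then obtain S where S: "finite S" "orth S" "card S = CARD('d)"
    by blast
  then obtain f :: "'d \<Rightarrow> real^'d" where f: "bij_betw f UNIV S"
    using finite_same_card_bij[of "UNIV :: 'd set" S] by auto
  define W :: "real^'d^'d" where "W = (\<chi> i j. f j $ i)"
  have "transpose W ** (V ** W) = mat 1"
  proof -
    have col: "column j W = f j" for j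
      by (simp add: W_def column_def vec_eq_iff)
    have "(transpose W ** (V ** W)) $ i $ j = f i \<bullet> (V *v f j)" for i j
      by (simp add: matrix_matrix_mult_def W_def transpose_def inner_vec_def matrix_vector_mult_def)
    moreover have "f i \<bullet> (V *v f j) = (if i = j then 1 else 0)" for i j
      using f S(2) by (auto simp: orth_def bij_betw_def inj_on_def)
    ultimately show ?thesis
      by (simp add: vec_eq_iff mat_def)
  qed
  then have inv: "(V ** W) ** transpose W = mat 1"
    by (simp add: matrix_left_right_inverse)
  show thesis
  proof
    have "(V ** W) ** transpose (V ** W) = ((V ** W) ** transpose W) ** transpose V"
      by (simp add: matrix_transpose_mul matrix_mul_assoc)
    then show "(V ** W) ** transpose (V ** W) = V"
      by (simp add: inv sym)
    show "(V ** W) ** transpose W = mat 1"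
      by (rule inv)
    then show "transpose W ** (V ** W) = mat 1"
      by (simp add: matrix_left_right_inverse)
  qed
qed

text \<open>The spectral bound is known for B B^T but the contraction needs it for B^T B. Writing y
  = B^T x gives |y|^2 = x . V x and B y = V x, so Cauchy-Schwarz yields |y|^4 <= |x|^2 |B y|^2,
  while \<lambda> |x|^2 <= |y|^2.\<close>

lemma norm_factor_ge:
  fixes B :: "real^'d^'d"
  assumes B: "B ** transpose B = V" and lam: "0 < lam" "\<And>x. lam * (norm x)\<^sup>2 \<le> x \<bullet> (V *v x)"
    and inv: "B' ** B = mat 1"
  shows "lam * (norm y)\<^sup>2 \<le> (norm (B *v y))\<^sup>2"
proof (cases "y = 0")
  case False
  define x where "x = transpose B' *v y"
  have "transpose B ** transpose B' = mat 1"
    by (simp add: matrix_transpose_mul[symmetric] inv)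
  then have y: "transpose B *v x = y"
    by (simp add: x_def matrix_vector_mul_assoc del: transpose_matrix_vector)
  then have x: "x \<noteq> 0"
    using False by auto
  have By: "B *v y = V *v x"
    unfolding B[symmetric] y[symmetric] by (simp only: matrix_vector_mul_assoc)
  have xV: "x \<bullet> (V *v x) = (norm y)\<^sup>2"
    unfolding By[symmetric] power2_norm_eq_inner
    using y by (metis dot_lmul_matrix transpose_matrix_vector)
  have ny: "0 < (norm y)\<^sup>2"
    using False by simp
  have "((norm y)\<^sup>2)\<^sup>2 \<le> (norm x)\<^sup>2 * (norm (B *v y))\<^sup>2"
    using Cauchy_Schwarz_ineq[of x "V *v x"] by (simp add: xV By power2_norm_eq_inner)
  then have "lam * ((norm y)\<^sup>2)\<^sup>2 \<le> (lam * (norm x)\<^sup>2) * (norm (B *v y))\<^sup>2"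
    using lam(1) by (simp add: mult.assoc)
  also have "\<dots> \<le> (norm y)\<^sup>2 * (norm (B *v y))\<^sup>2"
    using lam(2)[of x] by (intro mult_right_mono) (auto simp: xV)
  finally have "(norm y)\<^sup>2 * (lam * (norm y)\<^sup>2) \<le> (norm y)\<^sup>2 * (norm (B *v y))\<^sup>2"
    by (simp add: power2_eq_square mult_ac)
  then show ?thesis
    using ny by simp
qed simp

text \<open>The transvection is a commutator of two shears once an auxiliary variable
  \<open>t\<close> is added; the indicator of the unit interval gives that variable total mass 1.
  Orthogonality of \<open>w\<close> and \<open>a\<close> keeps the inner product with
  \<open>w\<close> unchanged under moves along \<open>a\<close>.\<close>

lemma nn_integral_lborel_transvection:
  fixes a w :: "'a::euclidean_space"
  assumes [measurable]: "F \<in> borel_measurable borel" and wa: "w \<bullet> a = 0"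
  shows "(\<integral>\<^sup>+z. F (z + (w \<bullet> z) *\<^sub>R a) \<partial>lborel) = (\<integral>\<^sup>+z. F z \<partial>lborel)"
proof -
  define H where "H = (\<lambda>(z::'a) (t::real). F z * indicator {0..1} t)"
  have H [measurable]: "case_prod H \<in> borel_measurable (borel \<Otimes>\<^sub>M borel)"
    unfolding H_def by measurable
  have int: "(\<integral>\<^sup>+z. \<integral>\<^sup>+t. H (f z) t \<partial>lborel \<partial>lborel) = (\<integral>\<^sup>+z. F (f z) \<partial>lborel)" for f
    unfolding H_def by (simp add: nn_integral_cmult)
  have "(\<integral>\<^sup>+z. \<integral>\<^sup>+t. H z t \<partial>lborel \<partial>lborel) = (\<integral>\<^sup>+z. \<integral>\<^sup>+t. H z (t - w \<bullet> z) \<partial>lborel \<partial>lborel)"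
    by (rule nn_integral_lborel_shear_snd[symmetric]) measurable
  also have "\<dots> = (\<integral>\<^sup>+z. \<integral>\<^sup>+t. H (z + t *\<^sub>R a) (t - w \<bullet> (z + t *\<^sub>R a)) \<partial>lborel \<partial>lborel)"
    by (rule nn_integral_lborel_shear_fst[where F="\<lambda>z t. H z (t - w \<bullet> z)", symmetric]) measurable
  also have "\<dots> = (\<integral>\<^sup>+z. \<integral>\<^sup>+t. H (z + t *\<^sub>R a) (t - w \<bullet> z) \<partial>lborel \<partial>lborel)"
    by (simp add: inner_add_right wa)
  also have "\<dots> = (\<integral>\<^sup>+z. \<integral>\<^sup>+t. H (z + (t - (- w) \<bullet> z) *\<^sub>R a) (t - (- w) \<bullet> z - w \<bullet> z) \<partial>lborel \<partial>lborel)"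
    by (rule nn_integral_lborel_shear_snd[where F="\<lambda>z t. H (z + t *\<^sub>R a) (t - w \<bullet> z)" and w="- w", symmetric]) measurable
  also have "\<dots> = (\<integral>\<^sup>+z. \<integral>\<^sup>+t. H (z + (t + w \<bullet> z) *\<^sub>R a) t \<partial>lborel \<partial>lborel)"
    by simp
  also have "\<dots> = (\<integral>\<^sup>+z. \<integral>\<^sup>+t. H (z + t *\<^sub>R (- a) + (t + w \<bullet> (z + t *\<^sub>R (- a))) *\<^sub>R a) t \<partial>lborel \<partial>lborel)"
    by (rule nn_integral_lborel_shear_fst[where F="\<lambda>z t. H (z + (t + w \<bullet> z) *\<^sub>R a) t" and w="- a", symmetric]) measurable
  also have "\<dots> = (\<integral>\<^sup>+z. \<integral>\<^sup>+t. H (z + (w \<bullet> z) *\<^sub>R a) t \<partial>lborel \<partial>lborel)"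
    by (simp add: inner_diff_right wa algebra_simps)
  finally show ?thesis
    unfolding int by simp
qed

text \<open>Exchanging two coordinates carries boxes to boxes with permuted side lengths, and the
  volumes of boxes determine Lebesgue measure.\<close>

lemma nn_integral_lborel_swap:
  fixes F :: "real^'d \<Rightarrow> ennreal" and m n :: 'd
  assumes [measurable]: "F \<in> borel_measurable borel"
  defines "T \<equiv> \<lambda>(x::real^'d). \<chi> i. x $ Transposition.transpose m n i"
  shows "(\<integral>\<^sup>+x. F (T x) \<partial>lborel) = (\<integral>\<^sup>+x. F x \<partial>lborel)"
proof -
  have T [measurable]: "T \<in> borel_measurable borel"
    unfolding T_def by (intro borel_measurable_continuous_onI continuous_intros)
  have "lborel = distr lborel borel T"
  proof (rule lborel_eqI)
    fix l u :: "real^'d"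
    assume lu: "\<And>b. b \<in> Basis \<Longrightarrow> l \<bullet> b \<le> u \<bullet> b"
    have lu': "l $ i \<le> u $ i" for i
      using lu[of "axis i 1"] by (simp add: inner_axis)
    have prod_Basis: "(\<Prod>b\<in>Basis. (v::real^'d) \<bullet> b) = (\<Prod>i\<in>UNIV. v $ i)" for v
    proof -
      have B: "(Basis :: (real^'d) set) = range (\<lambda>i. axis i 1)"
        by (auto simp: Basis_vec_def)
      have inj: "inj (\<lambda>i::'d. axis i (1::real))"
        by (auto simp: inj_on_def axis_eq_axis)
      show ?thesis
        unfolding B by (simp add: prod.reindex[OF inj] inner_axis)
    qed
    have mem: "T x \<in> box l u \<longleftrightarrow> x \<in> box (T l) (T u)" for x
    proof -
      have "(\<forall>i. P i) \<longleftrightarrow> (\<forall>i. P (Transposition.transpose m n i))" for P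
        by (metis transpose_involutory)
      from this[of "\<lambda>i. l $ i < T x $ i \<and> T x $ i < u $ i"] show ?thesis
        by (simp add: mem_box_cart T_def)
    qed
    then have "T -` box l u = box (T l) (T u)"
      by auto
    then have "emeasure (distr lborel borel T) (box l u) = emeasure lborel (box (T l) (T u))"
      by (simp add: emeasure_distr)
    also have "\<dots> = ennreal (\<Prod>b\<in>Basis. (T u - T l) \<bullet> b)"
      using lu' by (subst emeasure_lborel_box) (auto simp: Basis_vec_def T_def inner_axis)
    also have "(\<Prod>b\<in>Basis. (T u - T l) \<bullet> b) = (\<Prod>i\<in>UNIV. (u - l) $ Transposition.transpose m n i)"
      unfolding prod_Basis by (simp add: T_def)
    also have "\<dots> = (\<Prod>i\<in>UNIV. (u - l) $ i)"
      by (rule prod.reindex_bij_betw[OF bij_transpose])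
    finally show "emeasure (distr lborel borel T) (box l u) = ennreal (\<Prod>b\<in>Basis. (u - l) \<bullet> b)"
      unfolding prod_Basis .
  qed simp
  then have "(\<integral>\<^sup>+x. F x \<partial>lborel) = (\<integral>\<^sup>+x. F x \<partial>distr lborel borel T)"
    by simp
  then show ?thesis
    by (simp add: nn_integral_distr)
qed

lemma borel_measurable_matrix_vector_mult [measurable]: "(*v) (B :: real^'d^'c) \<in> borel_measurable borel"
  by (intro borel_measurable_continuous_onI matrix_vector_mult_linear_continuous_on)

text \<open>The change of variables formulas of \<open>HOL-Analysis\<close> need a wellordered index type; elementary
  matrices give the linear case for every finite index type.\<close>

lemma nn_integral_lborel_matrix:
  fixes A :: "real^'d^'d"
  assumes "det A \<noteq> 0" "F \<in> borel_measurable borel"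
  shows "(\<integral>\<^sup>+x. F x \<partial>lborel) = ennreal \<bar>det A\<bar> * (\<integral>\<^sup>+x. F (A *v x) \<partial>lborel)"
proof -
  \<comment> \<open>The induction on elementary matrices also passes through singular ones, so
    invertibility is part of the property; for a matrix with a zero row it then holds
    vacuously.\<close>
  define P where "P A \<longleftrightarrow> (det A \<noteq> 0 \<longrightarrow> (\<forall>F\<in>borel_measurable borel.
      (\<integral>\<^sup>+x. F x \<partial>lborel) = ennreal \<bar>det A\<bar> * (\<integral>\<^sup>+x. F (A *v x) \<partial>lborel)))" for A :: "real^'d^'d"
  have "P A"
  proof (induction rule: induct_matrix_elementary)
    case (1 A B)
    show ?case
      unfolding P_def
    proof (intro impI ballI)
      fix F :: "real^'d \<Rightarrow> ennreal"
      assume d: "det (A ** B) \<noteq> 0" and [measurable]: "F \<in> borel_measurable borel"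
      have d': "det A \<noteq> 0" "det B \<noteq> 0"
        using d by (auto simp: det_mul)
      have PA: "\<forall>F\<in>borel_measurable borel. (\<integral>\<^sup>+x. F x \<partial>lborel) = ennreal \<bar>det A\<bar> * (\<integral>\<^sup>+x. F (A *v x) \<partial>lborel)"
        and PB: "\<forall>F\<in>borel_measurable borel. (\<integral>\<^sup>+x. F x \<partial>lborel) = ennreal \<bar>det B\<bar> * (\<integral>\<^sup>+x. F (B *v x) \<partial>lborel)"
        using 1 d' unfolding P_def by blast+
      have "(\<integral>\<^sup>+x. F x \<partial>lborel) = ennreal \<bar>det A\<bar> * (\<integral>\<^sup>+x. F (A *v x) \<partial>lborel)"
        by (rule bspec[OF PA]) measurable
      also have "(\<integral>\<^sup>+x. F (A *v x) \<partial>lborel) = ennreal \<bar>det B\<bar> * (\<integral>\<^sup>+x. F (A *v (B *v x)) \<partial>lborel)"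
        by (rule bspec[OF PB, of "\<lambda>x. F (A *v x)"]) measurable
      finally show "(\<integral>\<^sup>+x. F x \<partial>lborel) = ennreal \<bar>det (A ** B)\<bar> * (\<integral>\<^sup>+x. F ((A ** B) *v x) \<partial>lborel)"
        by (simp add: det_mul abs_mult ennreal_mult mult.assoc matrix_vector_mul_assoc)
    qed
  next
    case (2 A i)
    then show ?case
      using det_zero_row(2)[of i A] by (simp add: P_def)
  next
    case (3 A)
    show ?case
      unfolding P_def
    proof (intro impI ballI)
      fix F :: "real^'d \<Rightarrow> ennreal"
      assume d: "det A \<noteq> 0" and [measurable]: "F \<in> borel_measurable borel"
      have det: "det A = (\<Prod>i\<in>UNIV. A $ i $ i)"
        by (rule det_diagonal) (rule 3)
      then have nz: "A $ i $ i \<noteq> 0" for i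
        using d by auto
      \<comment> \<open>The affine transformation rule takes scaling factors indexed by basis
        vectors; this function returns the diagonal entry \<open>A $ i $ i\<close> at
        \<open>axis i 1\<close>.\<close>
      define c where "c b = (\<Sum>i\<in>UNIV. A $ i $ i * b $ i)" for b :: "real^'d"
      have c: "c (axis i 1) = A $ i $ i" for i
        by (simp add: c_def axis_def if_distrib cong: if_cong)
      have B: "(Basis :: (real^'d) set) = range (\<lambda>i. axis i 1)"
        by (auto simp: Basis_vec_def)
      have inj: "inj (\<lambda>i::'d. axis i (1::real))"
        by (auto simp: inj_on_def axis_eq_axis)
      have cn: "c j \<noteq> 0" if "j \<in> Basis" for j
        using that nz unfolding B by (auto simp: c)
      have T: "0 + (\<Sum>j\<in>Basis. (c j * (x \<bullet> j)) *\<^sub>R j) = A *v x" for x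
      proof -
        have "(\<Sum>j\<in>Basis. (c j * (x \<bullet> j)) *\<^sub>R j) = (\<Sum>i\<in>UNIV. (A $ i $ i * x $ i) *\<^sub>R axis i 1)"
          unfolding B by (simp add: sum.reindex[OF inj] c inner_axis)
        also have "\<dots> = A *v x"
        proof -
          have "(\<Sum>j\<in>UNIV. A $ i $ j * x $ j) = A $ i $ i * x $ i" for i
            using 3 by (subst sum.remove[of _ i]) (auto intro!: sum.neutral)
          then show ?thesis
            by (simp add: vec_eq_iff matrix_vector_mult_def axis_def if_distrib cong: if_cong)
        qed
        finally show ?thesis by simp
      qed
      have "lborel = density (distr lborel borel (\<lambda>x. A *v x)) (\<lambda>_. ennreal (\<Prod>j\<in>Basis. \<bar>c j\<bar>))"
        using lborel_affine_euclidean[of c 0, OF cn] unfolding T .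
      also have "(\<Prod>j\<in>Basis. \<bar>c j\<bar>) = \<bar>det A\<bar>"
        unfolding B det by (simp add: prod.reindex[OF inj] c abs_prod)
      finally have "(\<integral>\<^sup>+x. F x \<partial>lborel) = (\<integral>\<^sup>+x. F x \<partial>density (distr lborel borel (\<lambda>x. A *v x)) (\<lambda>_. ennreal \<bar>det A\<bar>))"
        by simp
      also have "\<dots> = ennreal \<bar>det A\<bar> * (\<integral>\<^sup>+x. F (A *v x) \<partial>lborel)"
        by (simp add: nn_integral_density nn_integral_distr nn_integral_cmult)
      finally show "(\<integral>\<^sup>+x. F x \<partial>lborel) = ennreal \<bar>det A\<bar> * (\<integral>\<^sup>+x. F (A *v x) \<partial>lborel)" .
    qed
  next
    case (4 m n)
    let ?A = "(\<chi> i j. mat 1 $ i $ Transposition.transpose m n j) :: real^'d^'d"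
    have det: "\<bar>det ?A\<bar> = 1"
      by (subst det_permute_columns) (auto simp: permutes_swap_id sign_swap_id abs_mult 4)
    have A: "?A *v x = (\<chi> i. x $ Transposition.transpose m n i)" for x
    proof -
      have "(\<Sum>j\<in>UNIV. mat 1 $ i $ Transposition.transpose m n j * x $ j) = x $ Transposition.transpose m n i" for i
      proof -
        have "mat 1 $ i $ Transposition.transpose m n j * x $ j = (if j = Transposition.transpose m n i then x $ j else 0)" for j
          by (auto simp: mat_def)
        then show ?thesis by simp
      qed
      then show ?thesis
        by (simp add: vec_eq_iff matrix_vector_mult_def)
    qed
    show ?case
      unfolding P_def det A by (simp add: nn_integral_lborel_swap)
  next
    case (5 m n c)
    let ?A = "(\<chi> i j. if i = m \<and> j = n then c else of_bool (i = j)) :: real^'d^'d"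
    \<comment> \<open>Adding a multiple of one row to another is a transvection:
      \<open>m \<noteq> n\<close> makes the two axes orthogonal.\<close>
    have A: "?A *v x = x + (axis n c \<bullet> x) *\<^sub>R axis m 1" for x
    proof -
      have "(\<Sum>j\<in>UNIV. (if i = m \<and> j = n then c else of_bool (i = j)) * x $ j)
          = x $ i + (if i = m then c * x $ n else 0)" for i
      proof -
        have "(if i = m \<and> j = n then c else of_bool (i = j)) * x $ j
          = (if j = i then x $ j else 0) + (if j = n then (if i = m then c * x $ n else 0) else 0)" for j
          using 5 by auto
        then show ?thesis by (simp add: sum.distrib)
      qed
      moreover have "axis n c \<bullet> x = c * x $ n"
        by (simp add: inner_axis')
      moreover have "axis m (1::real) $ i = (if i = m then 1 else 0)" for i
        by (simp add: axis_def)
      ultimately show ?thesis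
        by (simp add: vec_eq_iff matrix_vector_mult_def)
    qed
    have row: "?A = (\<chi> k. if k = m then row m (mat 1) + c *s row n (mat 1) else row k (mat 1))"
      unfolding vec_eq_iff
    proof (intro allI)
      fix i j
      show "?A $ i $ j = (\<chi> k. if k = m then row m (mat 1) + c *s row n (mat 1) else row k (mat 1)) $ i $ j"
        using 5 by (cases "i = m"; cases "j = n") (simp_all add: row_def mat_def)
    qed
    have det: "det ?A = 1"
      unfolding row det_row_operation[OF 5] by simp
    show ?case
      unfolding P_def
    proof (intro impI ballI)
      fix F :: "real^'d \<Rightarrow> ennreal"
      assume "F \<in> borel_measurable borel"
      moreover have "axis n c \<bullet> axis m 1 = 0"
        using 5 by (simp add: inner_axis_axis)
      ultimately have "(\<integral>\<^sup>+x. F (?A *v x) \<partial>lborel) = (\<integral>\<^sup>+x. F x \<partial>lborel)"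
        unfolding A by (rule nn_integral_lborel_transvection)
      then show "(\<integral>\<^sup>+x. F x \<partial>lborel) = ennreal \<bar>det ?A\<bar> * (\<integral>\<^sup>+x. F (?A *v x) \<partial>lborel)"
        unfolding det by simp
    qed
  qed
  then have "det A \<noteq> 0 \<longrightarrow> (\<forall>F\<in>borel_measurable borel.
      (\<integral>\<^sup>+x. F x \<partial>lborel) = ennreal \<bar>det A\<bar> * (\<integral>\<^sup>+x. F (A *v x) \<partial>lborel))"
    unfolding P_def .
  from bspec[OF mp[OF this assms(1)] assms(2)] show ?thesis .
qed

section \<open>Identification of the Gaussian and driving laws\<close>

lemma matrix_inv_eqI:
  fixes A B :: "real^'d^'d"
  assumes "A ** B = mat 1"
  shows "matrix_inv A = B"
  unfolding matrix_inv_def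
proof (rule some_equality)
  show AB: "A ** B = mat 1 \<and> B ** A = mat 1"
    using assms by (simp add: matrix_left_right_inverse)
  fix C assume "A ** C = mat 1 \<and> C ** A = mat 1"
  then show "C = B"
    using AB by (metis matrix_mul_assoc matrix_mul_lid matrix_mul_rid)
qed

text \<open>Under x = B z the form of V^(-1) = B'^T B' becomes |z|^2, and the Jacobian |det B|
  cancels the normalization \<open>sqrt (det V)\<close>.\<close>

lemma gauss_meas_eq_distr:
  fixes B V :: "real^'d^'d"
  assumes B: "B ** transpose B = V" and B': "B ** B' = mat 1" "B' ** B = mat 1"
  shows "gauss_meas V = distr std_gauss borel ((*v) B)"
proof -
  define \<rho> where "\<rho> x = (2 * pi) powr (- real CARD('d) / 2) / sqrt (det V) * exp (- (x \<bullet> (matrix_inv V *v x)) / 2)" for x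
  have V: "matrix_inv V = transpose B' ** B'"
  proof (rule matrix_inv_eqI)
    have "V ** (transpose B' ** B') = B ** (transpose B ** transpose B') ** B'"
      by (simp add: B[symmetric] matrix_mul_assoc)
    also have "transpose B ** transpose B' = mat 1"
      by (simp add: matrix_transpose_mul[symmetric] B')
    finally show "V ** (transpose B' ** B') = mat 1"
      by (simp add: B')
  qed
  have detV: "sqrt (det V) = \<bar>det B\<bar>"
    by (simp add: B[symmetric] det_mul real_sqrt_mult)
  have det0: "det B \<noteq> 0"
    using B'(1) by (metis det_I det_mul mult_zero_left zero_neq_one)
  have quad: "(B *v z) \<bullet> (matrix_inv V *v (B *v z)) = (norm z)\<^sup>2" for z
  proof -
    have "matrix_inv V *v (B *v z) = transpose B' *v z"
      using B' by (simp add: V matrix_vector_mul_assoc matrix_mul_assoc[symmetric])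
    then have "(B *v z) \<bullet> (matrix_inv V *v (B *v z)) = (B' *v (B *v z)) \<bullet> z"
      by (metis dot_lmul_matrix transpose_matrix_vector inner_commute)
    then show ?thesis
      using B' by (simp add: matrix_vector_mul_assoc power2_norm_eq_inner)
  qed
  have \<rho>B: "\<bar>det B\<bar> * \<rho> (B *v z) = std_gauss_density z" for z
    using det0 by (simp add: \<rho>_def quad detV std_gauss_density_def)
  have [measurable]: "\<rho> \<in> borel_measurable borel"
  proof -
    have [measurable]: "(*v) (matrix_inv V) \<in> borel_measurable borel" by measurable
    show ?thesis unfolding \<rho>_def by measurable
  qed
  show ?thesis
  proof (rule measure_eqI)
    show "sets (gauss_meas V) = sets (distr std_gauss borel ((*v) B))"
      by (simp add: gauss_meas_def)
    fix A assume "A \<in> sets (gauss_meas V)"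
    then have [measurable]: "A \<in> sets borel"
      by (simp add: gauss_meas_def)
    have "emeasure (gauss_meas V) A = (\<integral>\<^sup>+x. ennreal (\<rho> x) * indicator A x \<partial>lborel)"
      unfolding gauss_meas_def \<rho>_def[symmetric] by (rule emeasure_density) auto
    also have "\<dots> = (\<integral>\<^sup>+z. ennreal \<bar>det B\<bar> * (ennreal (\<rho> (B *v z)) * indicator A (B *v z)) \<partial>lborel)"
      by (subst nn_integral_lborel_matrix[OF det0]) (auto simp: nn_integral_cmult)
    also have "\<dots> = (\<integral>\<^sup>+z. ennreal (std_gauss_density z) * indicator A (B *v z) \<partial>lborel)"
      by (simp add: \<rho>B[symmetric] ennreal_mult' mult.assoc)
    also have "\<dots> = (\<integral>\<^sup>+z. indicator A (B *v z) \<partial>std_gauss)"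
      by (subst nn_integral_std_gauss) auto
    also have "\<dots> = emeasure (distr std_gauss borel ((*v) B)) A"
      by (subst nn_integral_indicator[symmetric], simp, subst nn_integral_distr) auto
    finally show "emeasure (gauss_meas V) A = emeasure (distr std_gauss borel ((*v) B)) A" .
  qed
qed

text \<open>Transfers the problem from the abstract probability space to the canonical one.
  Independence within each family gives the two infinite products; independence of the two generated
  sigma-algebras gives the product formula on rectangles, which determines the joint law.\<close>

lemma distr_eq_drive:
  fixes i :: "nat \<Rightarrow> 'a \<Rightarrow> 'd::finite" and g :: "nat \<Rightarrow> 'a \<Rightarrow> real"
  assumes P: "prob_space M"
    and i_rv: "\<And>k. i k \<in> measurable M (count_space UNIV)"
    and i_unif: "\<And>k. distr M (count_space UNIV) (i k) = uniform_count_measure UNIV"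
    and i_indep: "prob_space.indep_vars M (\<lambda>_. count_space UNIV) i UNIV"
    and g_gauss: "\<And>k. distributed M lborel (g k) std_normal_density"
    and g_indep: "prob_space.indep_vars M (\<lambda>_. borel) g UNIV"
    and ig_indep: "prob_space.indep_set M
                     (sets (vimage_algebra (space M) (\<lambda>\<omega> k. i k \<omega>) (Pi\<^sub>M UNIV (\<lambda>_. count_space UNIV))))
                     (sets (vimage_algebra (space M) (\<lambda>\<omega> k. g k \<omega>) (Pi\<^sub>M UNIV (\<lambda>_. borel))))"
  shows "(\<lambda>\<omega>. (\<lambda>k. i k \<omega>, \<lambda>k. g k \<omega>)) \<in> measurable M drive"
    and "distr M drive (\<lambda>\<omega>. (\<lambda>k. i k \<omega>, \<lambda>k. g k \<omega>)) = drive"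
proof -
  interpret prob_space M by (rule P)
  let ?U = "Pi\<^sub>M (UNIV::nat set) (\<lambda>_. count_space (UNIV::'d set))" and ?G = "Pi\<^sub>M (UNIV::nat set) (\<lambda>_. borel :: real measure)"
  have g_rv: "g k \<in> borel_measurable M" for k
    using distributed_measurable[OF g_gauss[of k]] by simp
  have I: "(\<lambda>\<omega> k. i k \<omega>) \<in> measurable M ?U"
    by (rule measurable_PiM_single') (auto simp: i_rv)
  have G: "(\<lambda>\<omega> k. g k \<omega>) \<in> measurable M ?G"
    by (rule measurable_PiM_single') (auto simp: g_rv)
  have dI: "distr M ?U (\<lambda>\<omega> k. i k \<omega>) = Pi\<^sub>M UNIV (\<lambda>_. unif)"
    using i_indep indep_vars_iff_distr_eq_PiM[where I=UNIV and M'="\<lambda>_. count_space UNIV" and X=i] i_rv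
    by (simp add: i_unif unif_def restrict_UNIV)
  have "distr M borel (g k) = std_gauss" for k
    using distributed_distr_eq_density[OF g_gauss[of k]] by (simp add: std_gauss_real cong: distr_cong)
  then have dG: "distr M ?G (\<lambda>\<omega> k. g k \<omega>) = Pi\<^sub>M UNIV (\<lambda>_. std_gauss)"
    using g_indep indep_vars_iff_distr_eq_PiM[where I=UNIV and M'="\<lambda>_. borel" and X=g] g_rv
    by (simp add: restrict_UNIV)
  let ?T = "\<lambda>\<omega>. (\<lambda>k. i k \<omega>, \<lambda>k. g k \<omega>)"
  have T: "?T \<in> measurable M (?U \<Otimes>\<^sub>M ?G)"
    using I G by (rule measurable_Pair)
  have sets: "sets drive = sets (?U \<Otimes>\<^sub>M ?G)"
    by (rule sets_drive)
  have "drive = distr M (?U \<Otimes>\<^sub>M ?G) ?T"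
    unfolding drive_def
  proof (rule pair_measure_eqI)
    show "sigma_finite_measure (Pi\<^sub>M (UNIV::nat set) (\<lambda>_. unif :: 'd measure))"
      "sigma_finite_measure (Pi\<^sub>M (UNIV::nat set) (\<lambda>_. std_gauss :: real measure))"
      by unfold_locales
    show "sets (Pi\<^sub>M (UNIV::nat set) (\<lambda>_. unif :: 'd measure) \<Otimes>\<^sub>M Pi\<^sub>M (UNIV::nat set) (\<lambda>_. std_gauss :: real measure))
        = sets (distr M (?U \<Otimes>\<^sub>M ?G) ?T)"
      using sets by (simp add: drive_def)
    fix A B
    assume "A \<in> sets (Pi\<^sub>M (UNIV::nat set) (\<lambda>_. unif :: 'd measure))"
      and "B \<in> sets (Pi\<^sub>M (UNIV::nat set) (\<lambda>_. std_gauss :: real measure))"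
    then have A: "A \<in> sets ?U" and B: "B \<in> sets ?G"
      by (simp_all add: dI[symmetric] dG[symmetric])
    have AB: "A \<times> B \<in> sets (?U \<Otimes>\<^sub>M ?G)"
      using A B by (rule pair_measureI)
    let ?a = "(\<lambda>\<omega> k. i k \<omega>) -` A \<inter> space M" and ?b = "(\<lambda>\<omega> k. g k \<omega>) -` B \<inter> space M"
    have "prob (?a \<inter> ?b) = prob ?a * prob ?b"
      by (rule indep_setD[OF ig_indep]) (auto intro: in_vimage_algebra A B)
    then have "emeasure M (?a \<inter> ?b) = emeasure M ?a * emeasure M ?b"
      by (simp add: emeasure_eq_measure ennreal_mult)
    moreover have "?T -` (A \<times> B) \<inter> space M = ?a \<inter> ?b"
      by auto
    ultimately show "emeasure (Pi\<^sub>M UNIV (\<lambda>_. unif)) A * emeasure (Pi\<^sub>M UNIV (\<lambda>_. std_gauss)) B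
        = emeasure (distr M (?U \<Otimes>\<^sub>M ?G) ?T) (A \<times> B)"
      unfolding dI[symmetric] dG[symmetric] emeasure_distr[OF I A] emeasure_distr[OF G B] emeasure_distr[OF T AB]
      by simp
  qed
  also have "\<dots> = distr M drive ?T"
    by (rule distr_cong) (auto simp: sets)
  finally show "distr M drive ?T = drive" ..
  show "(\<lambda>\<omega>. (\<lambda>k. i k \<omega>, \<lambda>k. g k \<omega>)) \<in> measurable M drive"
    using I G by (simp cong: measurable_cong_sets[OF refl sets])
qed

section \<open>The coupled chains in L2\<close>

context
  fixes v :: "'i::finite \<Rightarrow> 'a::euclidean_space" and f :: "'a \<Rightarrow> real" and K g l r m b q x S :: real
  assumes f [measurable]: "f \<in> borel_measurable borel"
    and K: "0 \<le> K" and g: "0 < g" "g \<le> 1"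
    and lip: "\<And>(a :: 'a \<Rightarrow> 'a) (c :: 'a \<Rightarrow> 'a). linear a \<Longrightarrow> linear c \<Longrightarrow>
      (\<And>y. (norm (adjoint a y))\<^sup>2 + (norm (adjoint c y))\<^sup>2 \<le> (norm y)\<^sup>2) \<Longrightarrow>
      (\<integral>\<^sup>+z'. \<integral>\<^sup>+z. ennreal ((f (a z) - f (a z + c z'))\<^sup>2) \<partial>std_gauss \<partial>std_gauss)
        \<le> ennreal (K * (\<integral>z. (norm (c z))\<^sup>2 \<partial>std_gauss) powr g)"
    and v: "\<And>k. norm (v k) = 1"
    and lam: "\<And>y. l * (norm y)\<^sup>2 \<le> (\<Sum>k\<in>UNIV. (v k \<bullet> y)\<^sup>2)"
    and r: "r = 1 - l / CARD('i)" "0 \<le> r"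
    and f2: "integrable std_gauss (\<lambda>z. (f z - m)\<^sup>2)" and m: "m = (\<integral>z. f z \<partial>std_gauss)"
    and S: "0 < S" "S\<^sup>2 = (\<integral>z. (f z - m)\<^sup>2 \<partial>std_gauss)"
    and b: "0 < b" and q: "0 < q" "q \<le> 1 - x" and x: "0 < x"
    and bq: "\<And>n. K * (r ^ n * DIM('a)) powr g = (b * q ^ n)\<^sup>2"
begin

definition coupled :: "(((nat \<Rightarrow> 'i) \<times> (nat \<Rightarrow> real)) \<times> 'a) measure" where
  "coupled = drive \<Otimes>\<^sub>M std_gauss"

text \<open>It lives on the product space so that it can be compared pointwise with
  \<open>from_equilibrium\<close> under the same noise. Subtracting the equilibrium mean
  \<open>m\<close> centres the stationary run.\<close>

definition from_origin :: "nat \<Rightarrow> ((nat \<Rightarrow> 'i) \<times> (nat \<Rightarrow> real)) \<times> 'a \<Rightarrow> real" where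
  "from_origin j \<omega> = f (gibbs v 0 (fst \<omega>) j) - m"

definition from_equilibrium :: "nat \<Rightarrow> ((nat \<Rightarrow> 'i) \<times> (nat \<Rightarrow> real)) \<times> 'a \<Rightarrow> real" where
  "from_equilibrium j \<omega> = f (gibbs v (snd \<omega>) (fst \<omega>) j) - m"

interpretation coupled_pair: pair_prob_space "drive :: ((nat \<Rightarrow> 'i) \<times> (nat \<Rightarrow> real)) measure" "std_gauss :: 'a measure"
  by unfold_locales

lemma prob_space_coupled: "prob_space coupled"
  unfolding coupled_def by (rule coupled_pair.prob_space_axioms)

lemma measurable_coupled [measurable]:
  shows "fst \<in> measurable coupled drive" "snd \<in> borel_measurable coupled"
  unfolding coupled_def by measurable

lemma nn_integral_coupled:
  assumes "F \<in> borel_measurable coupled"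
  shows "(\<integral>\<^sup>+\<omega>. F \<omega> \<partial>coupled) = (\<integral>\<^sup>+p. \<integral>\<^sup>+z. F (p, z) \<partial>std_gauss \<partial>drive)"
  using assms unfolding coupled_def by (rule std_gauss.nn_integral_fst[symmetric])

lemma measurable_from_origin [measurable]: "from_origin j \<in> borel_measurable coupled"
  unfolding from_origin_def by measurable

lemma measurable_from_equilibrium [measurable]: "from_equilibrium j \<in> borel_measurable coupled"
  unfolding from_equilibrium_def by measurable

lemma integrable_f: "integrable std_gauss f"
proof -
  have "integrable std_gauss (\<lambda>z. (f z - m) * 1)"
    by (rule integrable_mult_square) (auto simp: f2)
  then have "integrable std_gauss (\<lambda>z. (f z - m) + m)"
    by (intro Bochner_Integration.integrable_add) auto
  then show ?thesis by simp
qed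

lemma distr_coupled_gibbs: "distr coupled borel (\<lambda>\<omega>. gibbs v (snd \<omega>) (fst \<omega>) j) = std_gauss"
proof (rule measure_eqI)
  fix A assume "A \<in> sets (distr coupled borel (\<lambda>\<omega>. gibbs v (snd \<omega>) (fst \<omega>) j))"
  then have [measurable]: "A \<in> sets borel" by simp
  have "emeasure (distr coupled borel (\<lambda>\<omega>. gibbs v (snd \<omega>) (fst \<omega>) j)) A
      = (\<integral>\<^sup>+\<omega>. indicator A (gibbs v (snd \<omega>) (fst \<omega>) j) \<partial>coupled)"
    by (subst nn_integral_indicator[symmetric], simp, subst nn_integral_distr) auto
  also have "\<dots> = (\<integral>\<^sup>+p. \<integral>\<^sup>+z. indicator A (gibbs v z p j) \<partial>std_gauss \<partial>drive)"
    by (subst nn_integral_coupled) auto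
  also have "\<dots> = (\<integral>\<^sup>+p. \<integral>\<^sup>+z. indicator A z \<partial>std_gauss \<partial>(drive :: ((nat \<Rightarrow> 'i) \<times> (nat \<Rightarrow> real)) measure))"
    by (rule gibbs_stationary[where F="\<lambda>y _. indicator A y", OF _ v]) measurable
  also have "\<dots> = emeasure std_gauss A"
    by (simp add: drive.emeasure_space_1)
  finally show "emeasure (distr coupled borel (\<lambda>\<omega>. gibbs v (snd \<omega>) (fst \<omega>) j)) A = emeasure std_gauss A" .
qed simp

text \<open>Equality of two-time laws lets the covariance at times \<open>j\<close> and
  \<open>j + n\<close> be computed with the earlier time at 0.\<close>

lemma distr_coupled_pair:
  "distr coupled (borel \<Otimes>\<^sub>M borel) (\<lambda>\<omega>. (gibbs v (snd \<omega>) (fst \<omega>) j, gibbs v (snd \<omega>) (fst \<omega>) (j + n)))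
    = distr coupled (borel \<Otimes>\<^sub>M borel) (\<lambda>\<omega>. (snd \<omega>, gibbs v (snd \<omega>) (fst \<omega>) n))" (is "?L = ?R")
proof (rule measure_eqI)
  fix A assume "A \<in> sets ?L"
  then have [measurable]: "A \<in> sets (borel \<Otimes>\<^sub>M borel)" by simp
  have "emeasure ?L A = (\<integral>\<^sup>+\<omega>. indicator A (gibbs v (snd \<omega>) (fst \<omega>) j, gibbs v (snd \<omega>) (fst \<omega>) (j + n)) \<partial>coupled)"
    by (subst nn_integral_indicator[symmetric], simp, subst nn_integral_distr) auto
  also have "\<dots> = (\<integral>\<^sup>+p. \<integral>\<^sup>+z. indicator A (gibbs v z p j, gibbs v z p (j + n)) \<partial>std_gauss \<partial>drive)"
    by (subst nn_integral_coupled) auto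
  also have "\<dots> = (\<integral>\<^sup>+p. \<integral>\<^sup>+z. indicator A (z, gibbs v z p n) \<partial>std_gauss \<partial>drive)"
    by (rule gibbs_stationary[where F="\<lambda>y y'. indicator A (y, y')", OF _ v]) measurable
  also have "\<dots> = (\<integral>\<^sup>+\<omega>. indicator A (snd \<omega>, gibbs v (snd \<omega>) (fst \<omega>) n) \<partial>coupled)"
    by (subst nn_integral_coupled) auto
  also have "\<dots> = emeasure ?R A"
    by (subst nn_integral_indicator[symmetric], simp, subst nn_integral_distr) auto
  finally show "emeasure ?L A = emeasure ?R A" .
qed simp

lemma from_equilibrium_moments:
  shows "integrable coupled (\<lambda>\<omega>. (from_equilibrium j \<omega>)\<^sup>2)" "(\<integral>\<omega>. (from_equilibrium j \<omega>)\<^sup>2 \<partial>coupled) = S\<^sup>2" "(\<integral>\<omega>. from_equilibrium j \<omega> \<partial>coupled) = 0"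
proof -
  have [measurable]: "(\<lambda>\<omega>. gibbs v (snd \<omega>) (fst \<omega>) j) \<in> borel_measurable coupled" by measurable
  have "integrable (distr coupled borel (\<lambda>\<omega>. gibbs v (snd \<omega>) (fst \<omega>) j)) (\<lambda>z. (f z - m)\<^sup>2)"
    unfolding distr_coupled_gibbs by (rule f2)
  then show "integrable coupled (\<lambda>\<omega>. (from_equilibrium j \<omega>)\<^sup>2)"
    unfolding from_equilibrium_def by (subst (asm) integrable_distr_eq) auto
  have "(\<integral>z. (f z - m)\<^sup>2 \<partial>distr coupled borel (\<lambda>\<omega>. gibbs v (snd \<omega>) (fst \<omega>) j)) = (\<integral>\<omega>. (from_equilibrium j \<omega>)\<^sup>2 \<partial>coupled)"
    unfolding from_equilibrium_def by (subst integral_distr) auto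
  then show "(\<integral>\<omega>. (from_equilibrium j \<omega>)\<^sup>2 \<partial>coupled) = S\<^sup>2"
    unfolding distr_coupled_gibbs by (simp add: S)
  have "(\<integral>z. (f z - m) \<partial>distr coupled borel (\<lambda>\<omega>. gibbs v (snd \<omega>) (fst \<omega>) j)) = (\<integral>\<omega>. from_equilibrium j \<omega> \<partial>coupled)"
    unfolding from_equilibrium_def by (subst integral_distr) auto
  moreover have "(\<integral>z. (f z - m) \<partial>std_gauss) = 0"
    using integrable_f by (simp add: m std_gauss.prob_space[simplified])
  ultimately show "(\<integral>\<omega>. from_equilibrium j \<omega> \<partial>coupled) = 0"
    unfolding distr_coupled_gibbs by simp
qed

lemma coupling_difference:
  shows "integrable coupled (\<lambda>\<omega>. (from_origin j \<omega> - from_equilibrium j \<omega>)\<^sup>2)"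
    and "(\<integral>\<omega>. (from_origin j \<omega> - from_equilibrium j \<omega>)\<^sup>2 \<partial>coupled) \<le> (b * q ^ j)\<^sup>2"
proof -
  have adj: "adjoint (\<lambda>z::'a. 0::'a) = (\<lambda>y. 0)" "adjoint (\<lambda>z::'a. z) = (\<lambda>y. y)"
    by (intro adjoint_unique; simp)+
  have "(\<integral>\<^sup>+\<omega>. ennreal ((from_origin j \<omega> - from_equilibrium j \<omega>)\<^sup>2) \<partial>coupled)
      = (\<integral>\<^sup>+p. \<integral>\<^sup>+z'. ennreal ((f (gibbs v 0 p j) - f (gibbs v z' p j))\<^sup>2) \<partial>std_gauss \<partial>drive)"
    by (subst nn_integral_coupled) (auto simp: from_origin_def from_equilibrium_def)
  \<comment> \<open>An integration over \<open>z\<close> of total mass 1 gives the shape of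
    \<open>gibbs_coupling\<close> with \<open>a = 0\<close> and \<open>c\<close> the identity. The
    covariances at the start are then 0 and the identity, and E|z'|^2 is the dimension, as in
    \<open>bq\<close>.\<close>
  also have "\<dots> = (\<integral>\<^sup>+p. \<integral>\<^sup>+z'. \<integral>\<^sup>+(z::'a). ennreal ((f (gibbs v 0 p j) - f (gibbs v (0 + z') p j))\<^sup>2)
      \<partial>std_gauss \<partial>std_gauss \<partial>drive)"
    by simp
  also have "\<dots> \<le> ennreal (K * (r ^ j * (\<integral>z. (norm (z::'a))\<^sup>2 \<partial>std_gauss)) powr g)"
    by (rule gibbs_coupling[where a="\<lambda>_. 0" and c="\<lambda>z. z", OF f K g lip v lam r])
       (auto simp: adj linear_id[unfolded id_def] linear_zero)
  also have "\<dots> = ennreal ((b * q ^ j)\<^sup>2)"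
    by (simp add: integral_std_gauss_norm_sq_id bq)
  finally have le: "(\<integral>\<^sup>+\<omega>. ennreal ((from_origin j \<omega> - from_equilibrium j \<omega>)\<^sup>2) \<partial>coupled) \<le> ennreal ((b * q ^ j)\<^sup>2)" .
  show int: "integrable coupled (\<lambda>\<omega>. (from_origin j \<omega> - from_equilibrium j \<omega>)\<^sup>2)"
    by (rule integrableI_nonneg) (use le in \<open>auto simp: less_top[symmetric] top_unique\<close>)
  show "(\<integral>\<omega>. (from_origin j \<omega> - from_equilibrium j \<omega>)\<^sup>2 \<partial>coupled) \<le> (b * q ^ j)\<^sup>2"
    using le by (subst (asm) nn_integral_eq_integral[OF int]) auto
qed

lemma from_origin_square_integrable: "integrable coupled (\<lambda>\<omega>. (from_origin j \<omega>)\<^sup>2)"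
proof (rule Bochner_Integration.integrable_bound)
  show "integrable coupled (\<lambda>\<omega>. 2 * (from_origin j \<omega> - from_equilibrium j \<omega>)\<^sup>2 + 2 * (from_equilibrium j \<omega>)\<^sup>2)"
    by (simp add: coupling_difference from_equilibrium_moments)
  have "(from_origin j \<omega>)\<^sup>2 \<le> 2 * (from_origin j \<omega> - from_equilibrium j \<omega>)\<^sup>2 + 2 * (from_equilibrium j \<omega>)\<^sup>2" for \<omega>
    using sum_squares_bound[of "from_origin j \<omega> - from_equilibrium j \<omega>" "from_equilibrium j \<omega>"] by (simp add: power2_eq_square algebra_simps)
  then show "AE \<omega> in coupled. norm ((from_origin j \<omega>)\<^sup>2) \<le> norm (2 * (from_origin j \<omega> - from_equilibrium j \<omega>)\<^sup>2 + 2 * (from_equilibrium j \<omega>)\<^sup>2)"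
    by simp
qed simp

lemma from_equilibrium_variance_bound: "\<bar>\<integral>\<omega>. from_equilibrium j \<omega> * from_equilibrium k \<omega> \<partial>coupled\<bar> \<le> S\<^sup>2"
proof -
  have "\<bar>\<integral>\<omega>. from_equilibrium j \<omega> * from_equilibrium k \<omega> \<partial>coupled\<bar> \<le> S * S"
    by (rule integral_mult_le) (auto simp: from_equilibrium_moments S(1))
  then show ?thesis by (simp add: power2_eq_square)
qed

text \<open>By stationarity the earlier time may be taken to be 0; the chain started at the origin is then
  independent of \<open>from_equilibrium 0\<close>, so \<open>from_equilibrium n\<close> can be replaced by \<open>from_equilibrium n - from_origin n\<close>.\<close>

lemma from_equilibrium_covariance_bound:
  assumes "j \<le> k"
  shows "\<bar>\<integral>\<omega>. from_equilibrium j \<omega> * from_equilibrium k \<omega> \<partial>coupled\<bar> \<le> S * (b * q ^ (k - j))"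
proof -
  define n where "n = k - j"
  have k: "k = j + n"
    using assms by (simp add: n_def)
  let ?F = "\<lambda>y. (f (fst y) - m) * (f (snd y) - m)"
  have "(\<integral>\<omega>. from_equilibrium j \<omega> * from_equilibrium k \<omega> \<partial>coupled)
      = (\<integral>y. ?F y \<partial>distr coupled (borel \<Otimes>\<^sub>M borel) (\<lambda>\<omega>. (gibbs v (snd \<omega>) (fst \<omega>) j, gibbs v (snd \<omega>) (fst \<omega>) (j + n))))"
    unfolding k from_equilibrium_def by (subst integral_distr) auto
  also have "\<dots> = (\<integral>\<omega>. from_equilibrium 0 \<omega> * from_equilibrium n \<omega> \<partial>coupled)"
    unfolding distr_coupled_pair from_equilibrium_def by (subst integral_distr) auto
  finally have eq: "(\<integral>\<omega>. from_equilibrium j \<omega> * from_equilibrium k \<omega> \<partial>coupled) = (\<integral>\<omega>. from_equilibrium 0 \<omega> * from_equilibrium n \<omega> \<partial>coupled)" .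
  have int: "integrable coupled (\<lambda>\<omega>. from_equilibrium 0 \<omega> * from_origin n \<omega>)"
    by (rule integrable_mult_square) (auto simp: from_equilibrium_moments from_origin_square_integrable)
  have int': "integrable coupled (\<lambda>\<omega>. from_equilibrium 0 \<omega> * (from_origin n \<omega> - from_equilibrium n \<omega>))"
    by (rule integrable_mult_square) (auto simp: from_equilibrium_moments coupling_difference)
  have "(\<integral>\<omega>. from_equilibrium 0 \<omega> * from_origin n \<omega> \<partial>coupled) = (\<integral>p. \<integral>z. from_equilibrium 0 (p, z) * from_origin n (p, z) \<partial>std_gauss \<partial>drive)"
    using int unfolding coupled_def by (rule coupled_pair.integral_fst'[symmetric])
  also have "\<dots> = (\<integral>p. (\<integral>z. (f z - m) \<partial>std_gauss) * (f (gibbs v 0 p n) - m) \<partial>drive)"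
    unfolding from_equilibrium_def from_origin_def by simp
  also have "\<dots> = 0"
    using integrable_f by (simp add: m std_gauss.prob_space[simplified])
  finally have zero: "(\<integral>\<omega>. from_equilibrium 0 \<omega> * from_origin n \<omega> \<partial>coupled) = 0" .
  have "(\<integral>\<omega>. from_equilibrium 0 \<omega> * from_equilibrium n \<omega> \<partial>coupled) = (\<integral>\<omega>. from_equilibrium 0 \<omega> * from_origin n \<omega> - from_equilibrium 0 \<omega> * (from_origin n \<omega> - from_equilibrium n \<omega>) \<partial>coupled)"
    by (simp add: algebra_simps)
  also have "\<dots> = - (\<integral>\<omega>. from_equilibrium 0 \<omega> * (from_origin n \<omega> - from_equilibrium n \<omega>) \<partial>coupled)"
    using int int' by (subst Bochner_Integration.integral_diff) (auto simp: zero)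
  finally have "\<bar>\<integral>\<omega>. from_equilibrium j \<omega> * from_equilibrium k \<omega> \<partial>coupled\<bar> = \<bar>\<integral>\<omega>. from_equilibrium 0 \<omega> * (from_origin n \<omega> - from_equilibrium n \<omega>) \<partial>coupled\<bar>"
    by (simp add: eq)
  also have "\<dots> \<le> S * (b * q ^ n)"
    using b q by (intro integral_mult_le) (auto simp: from_equilibrium_moments coupling_difference S(1))
  finally show ?thesis by (simp add: n_def)
qed

lemma distr_coupled_fst: "distr coupled drive fst = drive"
  unfolding coupled_def by (rule std_gauss.distr_pair_fst)

text \<open>The average depends on the driving noise alone, so the estimate on
  \<open>coupled\<close> passes to the marginal \<open>drive\<close>.\<close>

lemma gibbs_average_bias:
  defines "Y \<equiv> \<lambda>N p. (\<Sum>j\<in>{N..<2 * N}. f (gibbs v 0 p j) - m) / real N"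
  shows "integrable drive (Y N)"
    and "\<bar>\<integral>p. Y N p \<partial>drive\<bar> \<le> b * q ^ N / (x * N)"
proof -
  have [measurable]: "Y N \<in> borel_measurable drive"
    unfolding Y_def by measurable
  note hyps = prob_space_coupled measurable_from_origin measurable_from_equilibrium from_equilibrium_moments(1) coupling_difference from_equilibrium_moments(3) b q x
  have Y: "Y N (fst \<omega>) = (\<Sum>j\<in>{N..<2 * N}. from_origin j \<omega>) / N" for \<omega>
    by (simp add: Y_def from_origin_def)
  have "integrable coupled (\<lambda>\<omega>. Y N (fst \<omega>))"
    unfolding Y by (intro integrable_divide Bochner_Integration.integrable_sum burn_in_integrable[OF hyps])
  then have "integrable (distr coupled drive fst) (Y N)"
    by (subst integrable_distr_eq) auto
  then show "integrable drive (Y N)"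
    by (simp add: distr_coupled_fst)
  have "(\<integral>p. Y N p \<partial>distr coupled drive fst) = (\<integral>\<omega>. Y N (fst \<omega>) \<partial>coupled)"
    by (rule integral_distr) auto
  then show "\<bar>\<integral>p. Y N p \<partial>drive\<bar> \<le> b * q ^ N / (x * N)"
    using burn_in_bias[OF hyps, of N] by (simp add: distr_coupled_fst Y)
qed

text \<open>Stated for the nonnegative integral, so that a finite bound includes square
  integrability.\<close>

lemma gibbs_average_second_moment:
  fixes \<delta> N :: nat
  defines "Y \<equiv> \<lambda>p. (\<Sum>j\<in>{N..<2 * N}. f (gibbs v 0 p j) - m) / real N"
  assumes \<delta>: "1 / x \<le> \<delta>" "b * q ^ \<delta> \<le> S" and N: "\<delta> \<le> N" "0 < N"
  shows "(\<integral>\<^sup>+p. ennreal ((Y p)\<^sup>2) \<partial>drive) \<le> ennreal (10 * \<delta> * S\<^sup>2 / N)"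
proof -
  have [measurable]: "Y \<in> borel_measurable drive"
    unfolding Y_def by measurable
  note hyps = prob_space_coupled measurable_from_origin measurable_from_equilibrium from_equilibrium_moments(1) coupling_difference from_equilibrium_moments(3) b q x
  note sm = burn_in_second_moment[OF hyps S(1) from_equilibrium_variance_bound from_equilibrium_covariance_bound \<delta> N]
  have "(\<integral>\<^sup>+p. ennreal ((Y p)\<^sup>2) \<partial>drive) = (\<integral>\<^sup>+p. ennreal ((Y p)\<^sup>2) \<partial>distr coupled drive fst)"
    by (simp add: distr_coupled_fst)
  also have "\<dots> = (\<integral>\<^sup>+\<omega>. ennreal ((Y (fst \<omega>))\<^sup>2) \<partial>coupled)"
    by (rule nn_integral_distr) auto
  also have "\<dots> = (\<integral>\<^sup>+\<omega>. ennreal (((\<Sum>j\<in>{N..<2 * N}. from_origin j \<omega>) / N)\<^sup>2) \<partial>coupled)"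
    by (simp add: Y_def from_origin_def)
  also have "\<dots> = ennreal (\<integral>\<omega>. ((\<Sum>j\<in>{N..<2 * N}. from_origin j \<omega>) / N)\<^sup>2 \<partial>coupled)"
    by (rule nn_integral_eq_integral[OF sm(1)]) auto
  also have "\<dots> \<le> ennreal (10 * \<delta> * S\<^sup>2 / N)"
    by (rule ennreal_leI[OF sm(2)])
  finally show ?thesis .
qed

end

section \<open>Whitening of the Lipschitz condition\<close>

text \<open>With v_k = B^T e_k one has B v_k = V e_k and v_k . y = (B y)_k, so applying
  \<open>B\<close> intertwines the two recursions.\<close>

lemma Xseq_eq_gibbs:
  fixes B V :: "real^'d^'d"
  assumes B: "B ** transpose B = V"
  shows "Xseq V (fst p) (snd p) n = B *v gibbs (\<lambda>k. transpose B *v axis k 1) 0 p n"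
proof (induction n)
  case (Suc n)
  have "B *v (transpose B *v axis k 1) = column k V" for k
    unfolding B[symmetric] matrix_vector_mult_basis[symmetric] by (simp only: matrix_vector_mul_assoc)
  moreover have "(transpose B *v axis k 1) \<bullet> y = (B *v y) $ k" for k y
  proof -
    have "(transpose B *v axis k 1) \<bullet> y = axis k 1 \<bullet> (B *v y)"
      by (metis dot_lmul_matrix transpose_matrix_vector)
    then show ?thesis by (simp add: inner_axis')
  qed
  ultimately show ?case
    using Suc by (simp add: refresh_def matrix_vector_right_distrib matrix_vector_mult_scaleR
        del: transpose_matrix_vector)
qed simp

lemma integral_std_gauss_fst:
  fixes F :: "'a::euclidean_space \<Rightarrow> real"
  assumes [measurable]: "F \<in> borel_measurable borel" and "\<And>x. 0 \<le> F x"
  shows "(\<integral>p. F (fst p) \<partial>(std_gauss :: ('a \<times> 'b::euclidean_space) measure)) = (\<integral>x. F x \<partial>std_gauss)"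
proof -
  have [measurable]: "(\<lambda>p. F (fst p)) \<in> borel_measurable (borel :: ('a \<times> 'b) measure)"
    by (simp add: borel_prod[symmetric])
  show ?thesis
    using assms by (simp add: integral_eq_nn_integral nn_integral_std_gauss_pair)
qed

context
  fixes B V :: "real^'d^'d" and h :: "real^'d \<Rightarrow> real" and \<kappa> \<gamma> :: real
  assumes B: "B ** transpose B = V" and V_diag: "\<forall>k. V $ k $ k = 1"
    and h_lip: "gauss_lipschitz \<kappa> \<gamma> V h" and gamma: "0 < \<gamma>" "\<gamma> \<le> 1"
begin

lemma norm_transpose_factor: "(norm (transpose B *v x))\<^sup>2 = x \<bullet> (V *v x)"
proof -
  have "(transpose B *v x) \<bullet> (transpose B *v x) = x \<bullet> (B *v (transpose B *v x))"
    by (metis dot_lmul_matrix transpose_matrix_vector)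
  then show ?thesis
    unfolding power2_norm_eq_inner by (simp only: matrix_vector_mul_assoc B)
qed

text \<open>The unit diagonal enters here: \<open>V $ k $ k\<close> is the squared length of the
  k-th row of \<open>B\<close>.\<close>

lemma norm_row_factor: "norm (transpose B *v axis k 1) = 1"
proof -
  have "axis k 1 \<bullet> (V *v axis k 1) = V $ k $ k"
    by (simp add: inner_axis' matrix_vector_mult_basis column_def)
  then have "(norm (transpose B *v axis k 1))\<^sup>2 = 1"
    unfolding norm_transpose_factor by (simp add: V_diag)
  then show ?thesis
    by (simp add: power2_eq_1_iff) (smt (verit) norm_ge_zero)
qed

lemma sum_row_inner_sq: "(\<Sum>k\<in>UNIV. ((transpose B *v axis k 1) \<bullet> y)\<^sup>2) = (norm (B *v y))\<^sup>2"
proof -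
  have "(transpose B *v axis k 1) \<bullet> y = (B *v y) $ k" for k
  proof -
    have "(transpose B *v axis k 1) \<bullet> y = axis k 1 \<bullet> (B *v y)"
      by (metis dot_lmul_matrix transpose_matrix_vector)
    then show ?thesis by (simp add: inner_axis')
  qed
  moreover have "(norm w)\<^sup>2 = (\<Sum>k\<in>UNIV. (w $ k)\<^sup>2)" for w :: "real^'d"
    unfolding power2_norm_eq_inner inner_vec_def by (simp add: power2_eq_square)
  ultimately show ?thesis
    by (simp only:)
qed

text \<open>Each of the d coordinates of \<open>B *v y\<close> is an inner product with a unit row.
  This is one of the two sources of a power of d in the final constant.\<close>

lemma norm_factor_le: "(norm (B *v y))\<^sup>2 \<le> CARD('d) * (norm y)\<^sup>2"
proof -
  have "((transpose B *v axis k 1) \<bullet> y)\<^sup>2 \<le> (norm y)\<^sup>2" for k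
    using Cauchy_Schwarz_ineq[of "transpose B *v axis k 1" y]
    by (simp add: power2_norm_eq_inner[symmetric] norm_row_factor del: transpose_matrix_vector)
  then have "(\<Sum>k\<in>UNIV. ((transpose B *v axis k 1) \<bullet> y)\<^sup>2) \<le> (\<Sum>k\<in>(UNIV::'d set). (norm y)\<^sup>2)"
    by (intro sum_mono)
  then show ?thesis
    unfolding sum_row_inner_sq by simp
qed

lemma h_measurable [measurable]: "h \<in> borel_measurable borel"
  using h_lip by (simp add: gauss_lipschitz_def)

text \<open>If the adjoint of D is a contraction, then |D^T B^T x|^2 <= |B^T x|^2 = x . V x, so the
  covariance of B D z is at most \<open>V\<close> and the Lipschitz hypothesis applies.\<close>

lemma gauss_lipschitz_whitened:
  fixes A C :: "(real^'d) \<times> (real^'d) \<Rightarrow> real^'d"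
  assumes A: "linear A" "\<And>y. norm (adjoint A y) \<le> norm y" and C: "linear C" "\<And>y. norm (adjoint C y) \<le> norm y"
  shows "(\<integral>\<^sup>+z. \<integral>\<^sup>+z'. ennreal ((h (B *v A (z, z')) - h (B *v C (z, z')))\<^sup>2) \<partial>std_gauss \<partial>std_gauss)
    \<le> ennreal (\<kappa>\<^sup>2 * (\<integral>p. (norm (B *v (A p - C p)))\<^sup>2 \<partial>std_gauss) powr \<gamma>)"
proof -
  have psd: "linear (\<lambda>p. B *v D p)" "psd_le (cov_std (\<lambda>p. B *v D p)) V"
    if D: "linear D" "\<And>y. norm (adjoint D y) \<le> norm y" for D :: "(real^'d) \<times> (real^'d) \<Rightarrow> real^'d"
  proof -
    show lin: "linear (\<lambda>p. B *v D p)"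
      using linear_compose[OF D(1) matrix_vector_mul_linear[of B]] by (simp add: o_def)
    have adj: "adjoint (\<lambda>p. B *v D p) = (\<lambda>x. adjoint D (transpose B *v x))"
    proof (rule adjoint_unique, intro allI)
      fix p x
      have "(B *v D p) \<bullet> x = D p \<bullet> (transpose B *v x)"
        by (metis dot_lmul_matrix transpose_matrix_vector inner_commute)
      then show "(B *v D p) \<bullet> x = p \<bullet> adjoint D (transpose B *v x)"
        by (simp add: adjoint_works[OF D(1)] del: transpose_matrix_vector)
    qed
    have "(norm (adjoint D (transpose B *v x)))\<^sup>2 \<le> x \<bullet> (V *v x)" for x
      unfolding norm_transpose_factor[symmetric] by (intro power_mono D(2)) simp
    then show "psd_le (cov_std (\<lambda>p. B *v D p)) V"
      unfolding psd_le_cov_std_iff[OF lin] adj by blast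
  qed
  have [measurable]: "A \<in> borel_measurable borel" "C \<in> borel_measurable borel"
    by (rule borel_measurable_linear[OF A(1)], rule borel_measurable_linear[OF C(1)])
  have "(\<integral>\<^sup>+p. ennreal ((h (B *v A p) - h (B *v C p))\<^sup>2) \<partial>std_gauss)
      \<le> ennreal (\<kappa>\<^sup>2 * (\<integral>p. (norm (B *v A p - B *v C p))\<^sup>2 \<partial>std_gauss) powr \<gamma>)"
    using h_lip psd[OF A] psd[OF C] unfolding gauss_lipschitz_def by blast
  then show ?thesis
    by (simp add: nn_integral_std_gauss_pair matrix_vector_mult_diff_distrib)
qed

text \<open>This is the hypothesis \<open>lip\<close> of \<open>gibbs_coupling\<close>. The pair is
  built with \<open>z'\<close> in the first component and \<open>z\<close> in the second, and the
  invariant makes both adjoints contractions.\<close>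

lemma whitened_coupling_bound:
  fixes a c :: "real^'d \<Rightarrow> real^'d"
  assumes a: "linear a" and c: "linear c" and ac: "\<And>y. (norm (adjoint a y))\<^sup>2 + (norm (adjoint c y))\<^sup>2 \<le> (norm y)\<^sup>2"
  shows "(\<integral>\<^sup>+z'. \<integral>\<^sup>+z. ennreal ((h (B *v a z) - h (B *v (a z + c z')))\<^sup>2) \<partial>std_gauss \<partial>std_gauss)
    \<le> ennreal ((\<kappa>\<^sup>2 * CARD('d) powr \<gamma>) * (\<integral>z. (norm (c z))\<^sup>2 \<partial>std_gauss) powr \<gamma>)"
proof -
  let ?A = "\<lambda>p :: (real^'d) \<times> (real^'d). a (snd p)" and ?C = "\<lambda>p :: (real^'d) \<times> (real^'d). a (snd p) + c (fst p)"
  have lA: "linear ?A" and lC: "linear ?C"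
    by (intro linearI; simp add: linear_add[OF a] linear_add[OF c] linear_scale[OF a] linear_scale[OF c] algebra_simps)+
  have adjA: "adjoint ?A = (\<lambda>y. (0, adjoint a y))"
    by (rule adjoint_unique) (simp add: inner_prod_def adjoint_works[OF a])
  have adjC: "adjoint ?C = (\<lambda>y. (adjoint c y, adjoint a y))"
    by (rule adjoint_unique) (simp add: inner_prod_def adjoint_works[OF a] adjoint_works[OF c] inner_add_left)
  have nA: "norm (adjoint ?A y) \<le> norm y" for y
    unfolding adjA norm_Pair using ac[of y]
    by (simp add: power2_le_imp_le[OF order_trans[OF _ ac[of y]]])
  have nC: "norm (adjoint ?C y) \<le> norm y" for y
    unfolding adjC norm_Pair using ac[of y] by (simp add: real_le_lsqrt add.commute)
  have mc [measurable]: "c \<in> borel_measurable borel"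
    by (rule borel_measurable_linear[OF c])
  have lBc: "linear (\<lambda>z. B *v c z)"
    using linear_compose[OF c matrix_vector_mul_linear[of B]] by (simp add: o_def)
  have "(\<integral>p. (norm (B *v (?A p - ?C p)))\<^sup>2 \<partial>std_gauss) = (\<integral>p. (norm (B *v c (fst p)))\<^sup>2 \<partial>(std_gauss :: ((real^'d) \<times> (real^'d)) measure))"
    by (simp add: linear_neg[OF matrix_vector_mul_linear])
  also have "\<dots> = (\<integral>z. (norm (B *v c z))\<^sup>2 \<partial>std_gauss)"
    by (rule integral_std_gauss_fst) auto
  also have "\<dots> \<le> (\<integral>z. CARD('d) * (norm (c z))\<^sup>2 \<partial>std_gauss)"
    by (intro integral_mono integrable_mult_right integrable_std_gauss_norm_sq norm_factor_le c lBc)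
  finally have le: "(\<integral>p. (norm (B *v (?A p - ?C p)))\<^sup>2 \<partial>std_gauss) \<le> CARD('d) * (\<integral>z. (norm (c z))\<^sup>2 \<partial>std_gauss)"
    by simp
  have "(\<integral>\<^sup>+z'. \<integral>\<^sup>+z. ennreal ((h (B *v a z) - h (B *v (a z + c z')))\<^sup>2) \<partial>std_gauss \<partial>std_gauss)
    \<le> ennreal (\<kappa>\<^sup>2 * (\<integral>p. (norm (B *v (?A p - ?C p)))\<^sup>2 \<partial>std_gauss) powr \<gamma>)"
    using gauss_lipschitz_whitened[OF lA nA lC nC] by simp
  also have "\<dots> \<le> ennreal (\<kappa>\<^sup>2 * (CARD('d) * (\<integral>z. (norm (c z))\<^sup>2 \<partial>std_gauss)) powr \<gamma>)"
    using gamma by (intro ennreal_leI mult_left_mono powr_mono2 le) auto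
  finally show ?thesis
    by (simp add: powr_mult mult.assoc)
qed

lemma whitened_integrable:
  shows "integrable std_gauss (\<lambda>z. h (B *v z))" "integrable std_gauss (\<lambda>z. (h (B *v z) - m)\<^sup>2)"
proof -
  have adj: "adjoint (\<lambda>z::real^'d. 0::real^'d) = (\<lambda>y. 0)" "adjoint (\<lambda>z::real^'d. z) = (\<lambda>y. y)"
    by (intro adjoint_unique; simp)+
  \<comment> \<open>Comparing \<open>h (B *v z)\<close> with the constant \<open>h 0\<close>, the
    image of the degenerate Gaussian at the origin, extracts square integrability from the Lipschitz
    condition.\<close>
  have "(\<integral>\<^sup>+z. ennreal ((h 0 - h (B *v z))\<^sup>2) \<partial>std_gauss) < \<infinity>"
    using whitened_coupling_bound[of "\<lambda>_. 0" "\<lambda>z. z"]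
    by (auto simp: adj linear_zero linear_id[unfolded id_def] intro: le_less_trans)
  then have int: "integrable std_gauss (\<lambda>z. (h 0 - h (B *v z))\<^sup>2)"
    by (intro integrableI_nonneg) auto
  then have "integrable std_gauss (\<lambda>z. (h 0 - h (B *v z)) * 1)"
    by (intro integrable_mult_square) auto
  then have int1: "integrable std_gauss (\<lambda>z. h 0 - h (B *v z))"
    by simp
  have "integrable std_gauss (\<lambda>z. h 0 - (h 0 - h (B *v z)))"
    by (rule Bochner_Integration.integrable_diff[OF _ int1]) simp
  then show "integrable std_gauss (\<lambda>z. h (B *v z))"
    by simp
  have "integrable std_gauss (\<lambda>z. (h 0 - h (B *v z))\<^sup>2 - 2 * (h 0 - m) * (h 0 - h (B *v z)) + (h 0 - m)\<^sup>2)"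
    using int int1 by simp
  then show "integrable std_gauss (\<lambda>z. (h (B *v z) - m)\<^sup>2)"
    by (simp add: power2_eq_square algebra_simps)
qed

text \<open>Twice the variance is the mean square distance between two independent copies.\<close>

lemma whitened_variance_le:
  assumes m: "m = (\<integral>z. h (B *v z) \<partial>std_gauss)"
  shows "2 * (\<integral>z. (h (B *v z) - m)\<^sup>2 \<partial>std_gauss) \<le> \<kappa>\<^sup>2 * (2 * CARD('d)) powr \<gamma>"
proof -
  define F where "F z = h (B *v z) - m" for z
  define s where "s = (\<integral>z. (F z)\<^sup>2 \<partial>std_gauss)"
  have s0: "0 \<le> s" unfolding s_def by simp
  have F [measurable]: "F \<in> borel_measurable borel"
    unfolding F_def by measurable
  have iF: "integrable std_gauss F" "integrable std_gauss (\<lambda>z. (F z)\<^sup>2)"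
    unfolding F_def using whitened_integrable by auto
  have F0: "(\<integral>z. F z \<partial>std_gauss) = 0"
    unfolding F_def using whitened_integrable(1) by (simp add: m std_gauss.prob_space[simplified])
  let ?A = "\<lambda>p :: (real^'d) \<times> (real^'d). fst p" and ?C = "\<lambda>p :: (real^'d) \<times> (real^'d). snd p"
  have lA: "linear ?A" and lC: "linear ?C"
    by (auto intro: linearI)
  have adjA: "adjoint ?A = (\<lambda>y. (y, 0))" and adjC: "adjoint ?C = (\<lambda>y. (0, y))"
    by (intro adjoint_unique; simp add: inner_prod_def)+
  have lin: "linear (\<lambda>p :: (real^'d) \<times> (real^'d). B *v (fst p - snd p))"
    by (intro linearI) (simp_all add: matrix_vector_right_distrib matrix_vector_mult_diff_distrib
        matrix_vector_mult_scaleR algebra_simps)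
  have adj: "adjoint (\<lambda>p :: (real^'d) \<times> (real^'d). B *v (fst p - snd p)) = (\<lambda>x. (transpose B *v x, - (transpose B *v x)))"
  proof (rule adjoint_unique, intro allI)
    fix p :: "(real^'d) \<times> (real^'d)" and x
    have "(B *v (fst p - snd p)) \<bullet> x = (fst p - snd p) \<bullet> (transpose B *v x)"
      by (metis dot_lmul_matrix transpose_matrix_vector inner_commute)
    then show "(B *v (fst p - snd p)) \<bullet> x = p \<bullet> (transpose B *v x, - (transpose B *v x))"
      by (simp add: inner_prod_def inner_diff_left del: transpose_matrix_vector)
  qed
  \<comment> \<open>Each coordinate of the difference of two independent copies has variance 2,
    because the rows of \<open>B\<close> are unit vectors; the sum is twice the trace of
    \<open>V\<close>.\<close>
  have "(\<integral>p. (norm (B *v (?A p - ?C p)))\<^sup>2 \<partial>std_gauss) = (\<Sum>b\<in>(Basis::(real^'d) set). 2)"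
    unfolding integral_std_gauss_norm_sq[OF lin] adj
  proof (rule sum.cong)
    fix b :: "real^'d" assume "b \<in> Basis"
    then obtain k where b: "b = axis k 1" by (auto simp: Basis_vec_def)
    show "(norm (transpose B *v b, - (transpose B *v b)))\<^sup>2 = 2"
      unfolding b norm_Pair norm_minus_cancel norm_row_factor by simp
  qed simp
  also have "\<dots> = 2 * CARD('d)" by simp
  finally have dist: "(\<integral>p. (norm (B *v (?A p - ?C p)))\<^sup>2 \<partial>std_gauss) = 2 * CARD('d)" .
  \<comment> \<open>For fixed \<open>z\<close> the cross term vanishes because \<open>F\<close> is
    centred.\<close>
  have inner: "(\<integral>\<^sup>+z'. ennreal ((h (B *v z) - h (B *v z'))\<^sup>2) \<partial>std_gauss) = ennreal ((F z)\<^sup>2 + s)" for z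
  proof -
    have eq: "(h (B *v z) - h (B *v z'))\<^sup>2 = (F z)\<^sup>2 - 2 * F z * F z' + (F z')\<^sup>2" for z'
      by (simp add: F_def power2_eq_square algebra_simps)
    have int: "integrable std_gauss (\<lambda>z'. (F z)\<^sup>2 - 2 * F z * F z' + (F z')\<^sup>2)"
      using iF by simp
    have "(\<integral>\<^sup>+z'. ennreal ((h (B *v z) - h (B *v z'))\<^sup>2) \<partial>std_gauss)
        = ennreal (\<integral>z'. (F z)\<^sup>2 - 2 * F z * F z' + (F z')\<^sup>2 \<partial>std_gauss)"
      unfolding eq by (rule nn_integral_eq_integral[OF int]) (simp add: eq[symmetric])
    also have "(\<integral>z'. (F z)\<^sup>2 - 2 * F z * F z' + (F z')\<^sup>2 \<partial>std_gauss) = (F z)\<^sup>2 + s"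
      using iF by (simp add: F0 s_def std_gauss.prob_space[simplified])
    finally show ?thesis .
  qed
  have "(\<integral>\<^sup>+z. \<integral>\<^sup>+z'. ennreal ((h (B *v z) - h (B *v z'))\<^sup>2) \<partial>std_gauss \<partial>std_gauss)
      = (\<integral>\<^sup>+z. ennreal ((F z)\<^sup>2 + s) \<partial>std_gauss)"
    unfolding inner ..
  also have "\<dots> = ennreal (\<integral>z. (F z)\<^sup>2 + s \<partial>std_gauss)"
    using iF s0 by (intro nn_integral_eq_integral) auto
  also have "(\<integral>z. (F z)\<^sup>2 + s \<partial>std_gauss) = 2 * s"
    using iF by (simp add: s_def std_gauss.prob_space[simplified])
  finally have "ennreal (2 * s) \<le> ennreal (\<kappa>\<^sup>2 * (2 * CARD('d)) powr \<gamma>)"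
    using gauss_lipschitz_whitened[OF lA _ lC] unfolding dist adjA adjC by (simp add: norm_Pair)
  then show ?thesis
    unfolding s_def F_def by (subst (asm) ennreal_le_iff) auto
qed

end

section \<open>Bias and second moment of the average\<close>

text \<open>A Bochner integral takes the value 0 on non-integrable functions. Integrability of
  \<open>Y\<close> is therefore part of the conclusion, and the second moment is a nonnegative
  integral.\<close>

theorem theorem5p2:
  fixes V :: "real^'d^'d"
    and M :: "'a measure"
    and i :: "nat \<Rightarrow> 'a \<Rightarrow> 'd"
    and g :: "nat \<Rightarrow> 'a \<Rightarrow> real"
    and h :: "real^'d \<Rightarrow> real"
    and \<kappa> \<gamma> lam m \<Sigma>2 :: real
    and n :: nat
  assumes d3: "CARD('d) \<ge> 3"
    and V_sym: "transpose V = V"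
    and V_diag: "\<forall>k. V $ k $ k = 1"
    and V_pd: "pos_def V"
    and lam_eig: "is_eigenvalue V lam"
    and lam_min: "\<forall>l. is_eigenvalue V l \<longrightarrow> lam \<le> l"
    and P: "prob_space M"
    and i_rv: "\<forall>k. i k \<in> measurable M (count_space UNIV)"
    and i_unif: "\<forall>k. distr M (count_space UNIV) (i k) = uniform_count_measure UNIV"
    and i_indep: "prob_space.indep_vars M (\<lambda>_. count_space UNIV) i UNIV"
    and g_gauss: "\<forall>k. distributed M lborel (g k) std_normal_density"
    and g_indep: "prob_space.indep_vars M (\<lambda>_. borel) g UNIV"
    and ig_indep: "prob_space.indep_set M
                     (sets (vimage_algebra (space M) (\<lambda>\<omega> k. i k \<omega>) (Pi\<^sub>M UNIV (\<lambda>_. count_space UNIV))))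
                     (sets (vimage_algebra (space M) (\<lambda>\<omega> k. g k \<omega>) (Pi\<^sub>M UNIV (\<lambda>_. borel))))"
    and kappa_pos: "\<kappa> > 0"
    and gamma: "0 < \<gamma>" "\<gamma> \<le> 1"
    and h_lip: "gauss_lipschitz \<kappa> \<gamma> V h"
    and m_def: "m = (\<integral> x. h x \<partial>gauss_meas V)"
    and Sigma_def: "\<Sigma>2 = (\<integral> x. (h x - m)\<^sup>2 \<partial>gauss_meas V)"
    and Sigma_pos: "\<Sigma>2 > 0"
    and n_even: "even n" and n_pos: "n > 0"
  shows
    "let d = real CARD('d);
         \<kappa>' = 2 * \<kappa> * d powr (1 + \<gamma>) / (lam * \<gamma>);
         \<delta> = real_of_int \<lceil>4 / (lam * \<gamma>) * d * ln (\<kappa> * d / sqrt \<Sigma>2)\<rceil>;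
         Y = (\<lambda>\<omega>. (\<Sum>j\<in>{n div 2..<n}. h (Xseq V (\<lambda>k. i k \<omega>) (\<lambda>k. g k \<omega>) j)) / (real n / 2) - m)
     in integrable M Y
        \<and> \<bar>\<integral> \<omega>. Y \<omega> \<partial>M\<bar> \<le> 2 * \<kappa>' * exp (- lam * \<gamma> * real n / (4 * d)) / real n
        \<and> (real n > 2 * \<delta> \<longrightarrow>
             (\<integral>\<^sup>+ \<omega>. ennreal ((Y \<omega>)\<^sup>2) \<partial>M) \<le> ennreal (34 * \<delta> * \<Sigma>2 / real n))"
proof -
  define d where "d = real CARD('d)"
  have d: "3 \<le> d"
    using d3 by (simp add: d_def)
  have lam_pos: "0 < lam"
  proof -
    obtain w where w: "w \<noteq> 0" "V *v w = lam *\<^sub>R w"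
      using lam_eig by (auto simp: is_eigenvalue_def)
    then have "0 < lam * (w \<bullet> w)"
      using V_pd by (metis pos_def_def inner_scaleR_right)
    moreover have "0 < w \<bullet> w"
      using w by simp
    ultimately show ?thesis
      by (rule zero_less_mult_pos2)
  qed
  have lam_form: "lam * (norm y)\<^sup>2 \<le> y \<bullet> (V *v y)" for y
    using lam_min by (intro least_eigenvalue_le_quadratic_form[OF V_sym]) auto
  \<comment> \<open>The quadratic form equals 1 at a basis vector. This keeps the contraction factor
    \<open>r\<close> positive.\<close>
  have lam_le: "lam \<le> 1"
    using lam_form[of "axis undefined 1"] V_diag
    by (simp add: inner_axis' matrix_vector_mult_basis column_def)
  obtain B B' :: "real^'d^'d" where B: "B ** transpose B = V" and B': "B ** B' = mat 1" "B' ** B = mat 1"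
    using pos_def_factorization[OF V_sym V_pd] by blast
  define f where "f z = h (B *v z)" for z
  define v where "v k = transpose B *v axis k 1" for k
  define r where "r = 1 - lam / CARD('d)"
  \<comment> \<open>The exponent is halved because \<open>q\<close> is the rate of the L2 norm, not
    of its square. Below, \<open>x\<close> is the linear lower bound for \<open>1 - q\<close>, and
    \<open>b\<close> is the square root of the product of the two factors
    \<open>\<kappa>\<^sup>2 * d powr \<gamma>\<close> and \<open>d powr \<gamma>\<close>.\<close>
  define q where "q = r powr (\<gamma> / 2)"
  define x where "x = lam * \<gamma> / (2 * d)"
  define b where "b = \<kappa> * d powr \<gamma>"
  define S where "S = sqrt \<Sigma>2"
  have r: "0 < r" "r = 1 - lam / d"
  proof -
    show r_d: "r = 1 - lam / d" by (simp add: r_def d_def)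
    have "lam < d" using lam_le d by linarith
    then show "0 < r" using d by (simp add: r_d)
  qed
  have q: "0 < q" "q \<le> 1 - x"
  proof -
    show "0 < q" using r(1) by (simp add: q_def)
    \<comment> \<open>Young's inequality against the number 1 is Bernoulli's inequality (1 -
      \<lambda>/d)^(\<gamma>/2) <= 1 - \<lambda> \<gamma> / (2 d).\<close>
    have "r powr (\<gamma> / 2) * 1 powr (1 - \<gamma> / 2) \<le> \<gamma> / 2 * r + (1 - \<gamma> / 2) * 1"
      using gamma r by (intro Youngs_inequality_0) auto
    then show "q \<le> 1 - x"
      using d by (simp add: q_def x_def r(2) field_simps)
  qed
  have x: "0 < x"
    using lam_pos gamma d by (simp add: x_def)
  have b: "0 < b"
    using kappa_pos d by (simp add: b_def)
  have S: "0 < S" "S\<^sup>2 = \<Sigma>2"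
    using Sigma_pos by (auto simp: S_def)
  note whitened = B V_diag h_lip gamma
  note [measurable] = h_measurable[OF whitened]
  have f [measurable]: "f \<in> borel_measurable borel"
    unfolding f_def by measurable
  have gm: "gauss_meas V = distr std_gauss borel ((*v) B)"
    by (rule gauss_meas_eq_distr[OF B B'])
  have m: "m = (\<integral>z. f z \<partial>std_gauss)"
    unfolding m_def gm f_def by (rule integral_distr) auto
  have S2: "S\<^sup>2 = (\<integral>z. (f z - m)\<^sup>2 \<partial>std_gauss)"
    unfolding S Sigma_def gm f_def by (rule integral_distr) auto
  have f2: "integrable std_gauss (\<lambda>z. (f z - m)\<^sup>2)"
    unfolding f_def by (rule whitened_integrable(2)[OF whitened])
  have rate: "\<kappa>\<^sup>2 * CARD('d) powr \<gamma> * (r ^ k * DIM(real^'d)) powr \<gamma> = (b * q ^ k)\<^sup>2" for k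
  proof -
    have "(q ^ k)\<^sup>2 = (q\<^sup>2) ^ k"
      by (simp add: power_mult[symmetric] mult.commute)
    also have "q\<^sup>2 = r powr \<gamma>"
      by (simp add: q_def power2_eq_square powr_add[symmetric])
    also have "(r powr \<gamma>) ^ k = (r ^ k) powr \<gamma>"
      using r(1) by (simp add: powr_power powr_realpow[symmetric] powr_powr mult.commute)
    finally have "(q ^ k)\<^sup>2 = (r ^ k) powr \<gamma>" .
    then show ?thesis
      using r(1) d by (simp add: b_def d_def[symmetric] power_mult_distrib powr_mult) (simp add: power2_eq_square)
  qed
  have K: "0 \<le> \<kappa>\<^sup>2 * CARD('d) powr \<gamma>" by simp
  have lip: "(\<integral>\<^sup>+z'. \<integral>\<^sup>+z. ennreal ((f (a z) - f (a z + c z'))\<^sup>2) \<partial>std_gauss \<partial>std_gauss)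
      \<le> ennreal (\<kappa>\<^sup>2 * CARD('d) powr \<gamma> * (\<integral>z. (norm (c z))\<^sup>2 \<partial>std_gauss) powr \<gamma>)"
    if "linear a" "linear c" "\<And>y. (norm (adjoint a y))\<^sup>2 + (norm (adjoint c y))\<^sup>2 \<le> (norm y)\<^sup>2"
    for a c :: "real^'d \<Rightarrow> real^'d"
    unfolding f_def by (rule whitened_coupling_bound[OF whitened that])
  have v: "norm (v k) = 1" for k
    unfolding v_def by (rule norm_row_factor[OF whitened])
  have low: "lam * (norm y)\<^sup>2 \<le> (\<Sum>k\<in>UNIV. (v k \<bullet> y)\<^sup>2)" for y
    unfolding v_def sum_row_inner_sq[OF whitened] by (rule norm_factor_ge[OF B lam_pos lam_form B'(2)])
  note bias = gibbs_average_bias[OF f K gamma lip v low r_def less_imp_le[OF r(1)] f2 m S(1) S2 b q x rate]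
  note moment = gibbs_average_second_moment[OF f K gamma lip v low r_def less_imp_le[OF r(1)] f2 m S(1) S2 b q x rate]
  define N where "N = n div 2"
  have N: "n = 2 * N" "0 < N"
    using n_even n_pos by (auto simp: N_def elim: evenE)
  define T where "T \<omega> = (\<lambda>k. i k \<omega>, \<lambda>k. g k \<omega>)" for \<omega>
  have T [measurable]: "T \<in> measurable M drive" and dT: "distr M drive T = drive"
    unfolding T_def using distr_eq_drive[OF P _ _ i_indep _ g_indep ig_indep] i_rv i_unif g_gauss by auto
  define G where "G p = (\<Sum>j\<in>{N..<2 * N}. f (gibbs v 0 p j) - m) / real N" for p
  have [measurable]: "G \<in> borel_measurable drive"
    unfolding G_def by measurable
  define Y where "Y \<omega> = (\<Sum>j\<in>{n div 2..<n}. h (Xseq V (\<lambda>k. i k \<omega>) (\<lambda>k. g k \<omega>) j)) / (real n / 2) - m" for \<omega>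
  have Y: "Y \<omega> = G (T \<omega>)" for \<omega>
  proof -
    have "h (Xseq V (\<lambda>k. i k \<omega>) (\<lambda>k. g k \<omega>) j) = f (gibbs v 0 (T \<omega>) j)" for j
      using Xseq_eq_gibbs[OF B, of "T \<omega>" j] by (simp add: T_def f_def v_def[abs_def])
    then have "Y \<omega> = (\<Sum>j\<in>{N..<2 * N}. f (gibbs v 0 (T \<omega>) j)) / real N - m"
      unfolding Y_def using N by simp
    then show ?thesis
      using N by (simp add: G_def sum_subtractf field_simps)
  qed
  have Y_int: "integrable M Y"
  proof -
    have "integrable (distr M drive T) G"
      unfolding dT G_def by (rule bias(1))
    then show ?thesis
      unfolding Y[abs_def] by (rule integrable_distr[OF T])
  qed
  have Y_mean: "(\<integral>\<omega>. Y \<omega> \<partial>M) = (\<integral>p. G p \<partial>drive)"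
    using integral_distr[OF T, of G] by (simp add: dT Y)
  have q_exp: "q ^ k \<le> exp (- x * real k)" for k
  proof -
    have "q \<le> exp (- x)"
      using q(2) exp_ge_add_one_self[of "- x"] by simp
    then have "q ^ k \<le> exp (- x) ^ k"
      using q(1) by (intro power_mono) auto
    then show ?thesis
      by (simp add: exp_of_nat_mult[symmetric] mult.commute)
  qed
  have "\<bar>\<integral>\<omega>. Y \<omega> \<partial>M\<bar> \<le> b * q ^ N / (x * N)"
    unfolding Y_mean G_def by (rule bias(2))
  also have "\<dots> \<le> b * exp (- x * N) / (x * N)"
    using b x N q_exp[of N] by (intro divide_right_mono mult_left_mono) auto
  also have "\<dots> = 2 * (2 * \<kappa> * d powr (1 + \<gamma>) / (lam * \<gamma>)) * exp (- lam * \<gamma> * real n / (4 * d)) / real n"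
  proof -
    have "- x * N = - lam * \<gamma> * real n / (4 * d)"
      using N(1) by (simp add: x_def field_simps)
    moreover have "b / (x * N) = 2 * (2 * \<kappa> * d powr (1 + \<gamma>) / (lam * \<gamma>)) / real n"
      using N d lam_pos gamma by (simp add: b_def x_def powr_add field_simps)
    ultimately show ?thesis
      by (simp add: field_simps)
  qed
  finally have Y_bias: "\<bar>\<integral>\<omega>. Y \<omega> \<partial>M\<bar> \<le> 2 * (2 * \<kappa> * d powr (1 + \<gamma>) / (lam * \<gamma>)) * exp (- lam * \<gamma> * real n / (4 * d)) / real n" .
  define \<rho> where "\<rho> = \<kappa> * d / S"
  define \<delta> where "\<delta> = nat \<lceil>4 / (lam * \<gamma>) * d * ln \<rho>\<rceil>"
  \<comment> \<open>Since 2 d >= 1, the exponent \<gamma> may be raised to 1, and the factor 2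
    cancels.\<close>
  have S_le: "\<Sigma>2 \<le> \<kappa>\<^sup>2 * d"
  proof -
    have "2 * \<Sigma>2 \<le> \<kappa>\<^sup>2 * (2 * d) powr \<gamma>"
      using whitened_variance_le[OF whitened m[unfolded f_def]] S2
      by (simp add: f_def S d_def)
    also have "\<dots> \<le> \<kappa>\<^sup>2 * (2 * d) powr 1"
      using gamma d by (intro mult_left_mono powr_mono) auto
    finally show ?thesis using d by simp
  qed
  \<comment> \<open>The square of \<rho> is \<kappa>^2 d^2 / \<Sigma>^2, so the variance bound
    leaves one factor d.\<close>
  have \<rho>2: "d \<le> \<rho>\<^sup>2"
    using S_le S Sigma_pos d mult_right_mono[OF S_le, of d]
    by (simp add: \<rho>_def power_divide power_mult_distrib pos_le_divide_eq power2_eq_square mult_ac)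
  have \<rho>_pos: "0 < \<rho>"
    using kappa_pos d S by (simp add: \<rho>_def)
  \<comment> \<open>This is where d >= 3 is used: \<rho>^2 >= d >= 3 >= e.\<close>
  have ln_\<rho>: "1 / 2 \<le> ln \<rho>"
  proof -
    have "exp 1 \<le> \<rho>\<^sup>2"
      using exp_le d \<rho>2 by linarith
    then have "1 \<le> ln (\<rho>\<^sup>2)"
      using \<rho>_pos by (simp add: ln_ge_iff)
    then show ?thesis
      using \<rho>_pos by (simp add: ln_realpow)
  qed
  have two_x: "4 / (lam * \<gamma>) * d = 2 / x"
    using d by (simp add: x_def)
  have \<delta>_ge: "2 / x * ln \<rho> \<le> \<delta>"
    unfolding \<delta>_def two_x by (rule of_nat_ceiling)
  \<comment> \<open>Conversion by \<open>nat\<close> would truncate a negative ceiling; since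
    \<open>ln \<rho>\<close> is positive, the natural number agrees with the real \<delta> of the
    statement.\<close>
  have \<delta>_eq: "real \<delta> = real_of_int \<lceil>4 / (lam * \<gamma>) * d * ln \<rho>\<rceil>"
  proof -
    have "0 \<le> 2 / x * ln \<rho>"
      using x ln_\<rho> by simp
    then have "0 \<le> \<lceil>2 / x * ln \<rho>\<rceil>"
      by (simp add: zero_le_ceiling)
    then show ?thesis
      unfolding \<delta>_def two_x by simp
  qed
  have \<delta>1: "1 / x \<le> \<delta>"
  proof -
    have "2 / x * (1 / 2) \<le> 2 / x * ln \<rho>"
      using x ln_\<rho> by (intro mult_left_mono) auto
    then show ?thesis using \<delta>_ge by simp
  qed
  \<comment> \<open>The factor 2 in \<open>2 / x * ln \<rho>\<close> gives
    \<open>q ^ \<delta> \<le> 1 / \<rho>\<^sup>2\<close>. One power of \<rho> turns \<kappa> d into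
    S, and the other is at least 1.\<close>
  have \<delta>2: "b * q ^ \<delta> \<le> S"
  proof -
    have "b \<le> \<kappa> * d powr 1"
      unfolding b_def using kappa_pos gamma d by (intro mult_left_mono powr_mono) auto
    then have b_le: "b \<le> \<kappa> * d"
      using d by simp
    have "2 * ln \<rho> \<le> x * \<delta>"
      using \<delta>_ge x by (simp add: field_simps)
    then have "exp (- x * \<delta>) \<le> exp (- (2 * ln \<rho>))"
      by simp
    also have "\<dots> = 1 / \<rho>\<^sup>2"
      using \<rho>_pos by (simp add: exp_minus exp_double divide_inverse)
    finally have "q ^ \<delta> \<le> 1 / \<rho>\<^sup>2"
      using q_exp[of \<delta>] by linarith
    then have "b * q ^ \<delta> \<le> (\<kappa> * d) * (1 / \<rho>\<^sup>2)"
      using b b_le q kappa_pos d by (intro mult_mono) auto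
    also have "\<dots> = S / \<rho>"
      using kappa_pos d S by (simp add: \<rho>_def power2_eq_square)
    also have "\<dots> \<le> S / 1"
    proof -
      have "1\<^sup>2 \<le> \<rho>\<^sup>2"
        using \<rho>2 d by simp
      then have "1 \<le> \<rho>"
        using \<rho>_pos by (intro power2_le_imp_le[of 1 \<rho>]) auto
      then show ?thesis
        using S by (intro divide_left_mono) auto
    qed
    finally show ?thesis by simp
  qed
  have Y_moment: "(\<integral>\<^sup>+\<omega>. ennreal ((Y \<omega>)\<^sup>2) \<partial>M) \<le> ennreal (34 * real \<delta> * \<Sigma>2 / real n)" if n: "real n > 2 * real \<delta>"
  proof -
    have \<delta>N: "\<delta> \<le> N"
      using n N by simp
    have "(\<integral>\<^sup>+\<omega>. ennreal ((Y \<omega>)\<^sup>2) \<partial>M) = (\<integral>\<^sup>+p. ennreal ((G p)\<^sup>2) \<partial>distr M drive T)"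
      unfolding Y by (subst nn_integral_distr) auto
    also have "\<dots> \<le> ennreal (10 * \<delta> * S\<^sup>2 / N)"
      unfolding dT G_def by (rule moment[OF _ _ _ \<delta>1 \<delta>2 \<delta>N N(2)])
    also have "\<dots> \<le> ennreal (34 * real \<delta> * \<Sigma>2 / real n)"
    proof (rule ennreal_leI)
      \<comment> \<open>With n = 2 N the constant 10 becomes 20, so the estimate proved here is
        stronger than the stated 34.\<close>
      have "10 * \<delta> * S\<^sup>2 / N = 20 * (real \<delta> * \<Sigma>2) / real n"
        using N S by simp
      also have "\<dots> \<le> 34 * (real \<delta> * \<Sigma>2) / real n"
        using Sigma_pos by (intro divide_right_mono mult_right_mono) auto
      finally show "10 * \<delta> * S\<^sup>2 / N \<le> 34 * real \<delta> * \<Sigma>2 / real n"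
        by (simp add: mult.assoc)
    qed
    finally show ?thesis .
  qed
  show ?thesis
    using Y_int Y_bias Y_moment
    unfolding Let_def Y_def[abs_def] \<delta>_eq \<rho>_def S_def d_def by blast
qed

end
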